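(* Let $G$ be a separable locally compact unimodular group of type I and let $a:G\to\mathbb C$ be continuous, bounded and square-integrable with $\|a\|_{L^2(G)}=1$. Let $\sigma$ be a symbol in $C_b(G,\mathcal FL^1(G))$ with convolution kernel $\kappa\in C_b(G,L^1(G))$, i.e. $\sigma(x,\pi)=\mathcal F\kappa_x(\pi)$. Then $$\mathrm{Op}^{\mathrm{Wick}}(\sigma)f(x)=f*\kappa_x^{\mathrm{Wick}}(x),\qquad f\in C_c(G),\ x\in G,$$ where $\kappa^{\mathrm{Wick}}\in C_b(G,L^1(G))$ is given by $$\kappa_x^{\mathrm{Wick}}(w)=\int_Ga(z^{-1}xw^{-1})\,\bar a(z^{-1}x)\,\kappa_z(w)\,dz=\int_Ga(z'w^{-1})\,\bar a(z')\,\kappa_{xz'^{-1}}(w)\,dz'.$$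
   Context: $dx$ is a fixed Haar measure; $(f_1*f_2)(x)=\int_Gf_1(y)f_2(y^{-1}x)dy$; $C_c(G)$ is the space of continuous compactly supported functions. $\widehat G$ is the set of equivalence classes of irreducible strongly continuous unitary representations $\pi$ of $G$ on separable Hilbert spaces $\mathcal H_\pi$, with Plancherel measure $\mu$ (so that $\|f\|_{L^2(G)}^2=\int_{\widehat G}\|\widehat f(\pi)\|_{HS}^2d\mu(\pi)$), and $\mathcal Ff(\pi)=\widehat f(\pi)=\int_Gf(z)\pi(z)^*dz$. $C_b(G,L^1(G))$ is the space of continuous maps $\kappa:x\mapsto\kappa_x$ from $G$ to $L^1(G)$ with $\int_G\sup_{x\in G}|\kappa_x(y)|\,dy<\infty$ (the supremum of the family $|\kappa_x|$, $x\in G$, being taken in the lattice of measurable functions modulo null sets). $C_b(G,\mathcal FL^1(G))$ is the space of the corresponding symbols $\sigma(x,\pi)=\mathcal F\kappa_x(\pi)$. $L^2(G\times\widehat G)$ is the Hilbert space of measurable fields of Hilbert–Schmidt operators $\tau(x,\pi)$ on $\mathcal H_\pi$ with $\int\|\tau(x,\pi)\|_{HS}^2dx\,d\mu(\pi)<\infty$. The map $\mathcal B=\mathcal B_a$, $\mathcal B[f](x,\pi)=\mathcal F(f\,a(x^{-1}\,\cdot))(\pi)$, extends to an isometry $L^2(G)\to L^2(G\times\widehat G)$ with adjoint $\mathcal B^*$. For $\sigma\in L^\infty(G\times\widehat G)$ (essentially bounded measurable fields of bounded operators $\sigma(x,\pi)$ on $\mathcal H_\pi$, acting on $L^2(G\times\widehat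 G)$ by left composition), the Wick quantization is $\mathrm{Op}^{\mathrm{Wick}}(\sigma)f=\mathcal B^*\sigma\mathcal B[f]$. Symbols in $C_b(G,\mathcal FL^1(G))$ belong to $L^\infty(G\times\widehat G)$. *)

theory Defs
  imports "HOL-Analysis.Analysis"
begin

text \<open>
  The group \<open>G\<close> is a type of the library class \<open>topological_group_add\<close>.  This class does not
  make addition commutative: \<open>x + y\<close> stands for the product \<open>xy\<close>, \<open>- x\<close> for the inverse of \<open>x\<close>
  and \<open>x - y\<close> for \<open>x\<close> times the inverse of \<open>y\<close>.  The order of the factors matters throughout.
\<close>

section \<open>Haar measure and function spaces on the group\<close>

definition haar_measure :: "'g::topological_group_add measure \<Rightarrow> bool" where
  "haar_measure M \<longleftrightarrow>
     sets M = sets borel \<and>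
     emeasure M UNIV \<noteq> 0 \<and>
     (\<forall>K. compact K \<longrightarrow> emeasure M K < \<infinity>) \<and>
     (\<forall>A\<in>sets borel. emeasure M A = (INF U\<in>{U. open U \<and> A \<subseteq> U}. emeasure M U)) \<and>
     (\<forall>U. open U \<longrightarrow> emeasure M U = (SUP K\<in>{K. compact K \<and> K \<subseteq> U}. emeasure M K)) \<and>
     (\<forall>x. \<forall>A\<in>sets borel. emeasure M ((\<lambda>y. x + y) ` A) = emeasure M A)"

definition unimodular :: "'g::topological_group_add itself \<Rightarrow> bool" where
  "unimodular _ \<longleftrightarrow>
     (\<forall>M :: 'g measure. haar_measure M \<longrightarrow>
        (\<forall>x. \<forall>A\<in>sets borel. emeasure M ((\<lambda>y. y + x) ` A) = emeasure M A))"

definition L2 :: "'a measure \<Rightarrow> ('a \<Rightarrow> complex) set" where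
  "L2 M = {f. f \<in> borel_measurable M \<and> integrable M (\<lambda>x. (cmod (f x))\<^sup>2)}"

definition L2_inner :: "'a measure \<Rightarrow> ('a \<Rightarrow> complex) \<Rightarrow> ('a \<Rightarrow> complex) \<Rightarrow> complex" where
  "L2_inner M f g = (\<integral>x. f x * cnj (g x) \<partial>M)"

definition L2_norm :: "'a measure \<Rightarrow> ('a \<Rightarrow> complex) \<Rightarrow> real" where
  "L2_norm M f = sqrt (\<integral>x. (cmod (f x))\<^sup>2 \<partial>M)"

definition Cc :: "('g::topological_space \<Rightarrow> complex) set" where
  "Cc = {f. continuous_on UNIV f \<and> compact (closure {x. f x \<noteq> 0})}"

definition group_conv ::
  "'g::topological_group_add measure \<Rightarrow> ('g \<Rightarrow> complex) \<Rightarrow> ('g \<Rightarrow> complex) \<Rightarrow> 'g \<Rightarrow> complex" where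
  "group_conv M f g x = (\<integral>y. f y * g (- y + x) \<partial>M)"

text \<open>
  \<open>S\<close> is the supremum of the family \<open>F\<close> in the lattice of measurable functions with values in
  \<open>[0,\<infinity>]\<close> modulo null sets.
\<close>

definition is_lattice_sup :: "'a measure \<Rightarrow> ('a \<Rightarrow> ennreal) set \<Rightarrow> ('a \<Rightarrow> ennreal) \<Rightarrow> bool" where
  "is_lattice_sup M F S \<longleftrightarrow>
     S \<in> borel_measurable M \<and>
     (\<forall>f\<in>F. AE y in M. f y \<le> S y) \<and>
     (\<forall>T\<in>borel_measurable M. (\<forall>f\<in>F. AE y in M. f y \<le> T y) \<longrightarrow> (AE y in M. S y \<le> T y))"

text \<open>
  The space \<open>C\<^sub>b(G, L\<^sup>1(G))\<close>.  An element of \<open>L\<^sup>1(G)\<close> is given by any integrable representative, so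
  nothing is required of \<open>x \<mapsto> \<kappa> x y\<close> for an individual \<open>y\<close>.
\<close>

definition Cb_L1 :: "'g::topological_group_add measure \<Rightarrow> ('g \<Rightarrow> 'g \<Rightarrow> complex) set" where
  "Cb_L1 M = {\<kappa>.
     (\<forall>x. integrable M (\<kappa> x)) \<and>
     (\<forall>x0. ((\<lambda>x. \<integral>y. cmod (\<kappa> x y - \<kappa> x0 y) \<partial>M) \<longlongrightarrow> 0) (at x0)) \<and>
     (\<exists>S. is_lattice_sup M (range (\<lambda>x y. ennreal (cmod (\<kappa> x y)))) S \<and>
          (\<integral>\<^sup>+y. S y \<partial>M) < \<infinity>)}"

text \<open>
  A jointly measurable choice of representatives of the classes \<open>\<kappa>\<^sub>z\<close>.  It is needed to give a
  meaning to integrals over \<open>z\<close> of \<open>\<kappa>\<^sub>z(w)\<close> with \<open>w\<close> fixed.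
\<close>

definition measurable_version ::
  "'g measure \<Rightarrow> ('g \<Rightarrow> 'g \<Rightarrow> complex) \<Rightarrow> ('g \<Rightarrow> 'g \<Rightarrow> complex) \<Rightarrow> bool" where
  "measurable_version M \<kappa> k \<longleftrightarrow>
     (\<lambda>(z, w). k z w) \<in> borel_measurable (M \<Otimes>\<^sub>M M) \<and>
     (\<forall>z. AE w in M. k z w = \<kappa> z w)"

section \<open>Separable Hilbert spaces\<close>

text \<open>
  Up to unitary equivalence there is exactly one separable complex Hilbert space of each dimension
  \<open>d \<in> {0, 1, 2, \<dots>, \<infinity>}\<close>; \<open>hilb d\<close> is the one inside \<open>\<ell>\<^sup>2(\<nat>)\<close> consisting of the sequences
  supported on the indices below \<open>d\<close>.  Operators on \<open>hilb d\<close> are functions on sequences of which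
  only the values on \<open>hilb d\<close> matter.
\<close>

type_synonym cvec = "nat \<Rightarrow> complex"
type_synonym cop = "cvec \<Rightarrow> cvec"

definition hilb :: "enat \<Rightarrow> cvec set" where
  "hilb d = {v. summable (\<lambda>n. (cmod (v n))\<^sup>2) \<and> (\<forall>n. d \<le> enat n \<longrightarrow> v n = 0)}"

definition ip :: "cvec \<Rightarrow> cvec \<Rightarrow> complex" where
  "ip u v = (\<Sum>n. u n * cnj (v n))"

definition vnorm :: "cvec \<Rightarrow> real" where
  "vnorm v = sqrt (\<Sum>n. (cmod (v n))\<^sup>2)"

definition ebasis :: "nat \<Rightarrow> cvec" where
  "ebasis j = (\<lambda>n. if n = j then 1 else 0)"

definition linear_op :: "enat \<Rightarrow> enat \<Rightarrow> cop \<Rightarrow> bool" where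
  "linear_op d e T \<longleftrightarrow>
     (\<forall>u\<in>hilb d. T u \<in> hilb e) \<and>
     (\<forall>u\<in>hilb d. \<forall>v\<in>hilb d. \<forall>a b. T (\<lambda>n. a * u n + b * v n) = (\<lambda>n. a * T u n + b * T v n))"

definition bounded_op :: "enat \<Rightarrow> cop \<Rightarrow> bool" where
  "bounded_op d T \<longleftrightarrow>
     linear_op d d T \<and> (\<exists>C. \<forall>u\<in>hilb d. vnorm (T u) \<le> C * vnorm u)"

definition isometric_op :: "enat \<Rightarrow> enat \<Rightarrow> cop \<Rightarrow> bool" where
  "isometric_op d e T \<longleftrightarrow> linear_op d e T \<and> (\<forall>u\<in>hilb d. vnorm (T u) = vnorm u)"

definition unitary_op :: "enat \<Rightarrow> enat \<Rightarrow> cop \<Rightarrow> bool" where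
  "unitary_op d e T \<longleftrightarrow> isometric_op d e T \<and> T ` hilb d = hilb e"

text \<open>The coordinates of \<open>T\<^sup>*u\<close> are \<open>\<langle>T\<^sup>*u, e\<^sub>n\<rangle> = \<langle>u, T e\<^sub>n\<rangle>\<close>.\<close>

definition adjoint_op :: "enat \<Rightarrow> cop \<Rightarrow> cop" where
  "adjoint_op d T u = (\<lambda>n. if enat n < d then ip u (T (ebasis n)) else 0)"

definition hs_norm2 :: "enat \<Rightarrow> cop \<Rightarrow> ennreal" where
  "hs_norm2 d T = (\<Sum>j. if enat j < d then ennreal ((vnorm (T (ebasis j)))\<^sup>2) else 0)"

text \<open>\<open>\<langle>S, T\<rangle> = Tr (T\<^sup>* S)\<close>\<close>

definition hs_inner :: "enat \<Rightarrow> cop \<Rightarrow> cop \<Rightarrow> complex" where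
  "hs_inner d S T = (\<Sum>j. if enat j < d then ip (S (ebasis j)) (T (ebasis j)) else 0)"

definition closed_subspace :: "enat \<Rightarrow> cvec set \<Rightarrow> bool" where
  "closed_subspace d K \<longleftrightarrow>
     K \<subseteq> hilb d \<and>
     (\<lambda>_. 0) \<in> K \<and>
     (\<forall>u\<in>K. \<forall>v\<in>K. \<forall>a b. (\<lambda>n. a * u n + b * v n) \<in> K) \<and>
     (\<forall>s. \<forall>v\<in>hilb d. (\<forall>i. s i \<in> K) \<and> (\<lambda>i. vnorm (\<lambda>n. s i n - v n)) \<longlonglongrightarrow> 0 \<longrightarrow> v \<in> K)"

section \<open>Unitary representations, type I, the unitary dual\<close>

text \<open>A representation is a pair consisting of the dimension of its space and the action.\<close>

type_synonym 'g rep = "enat \<times> ('g \<Rightarrow> cop)"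

definition unitary_rep :: "'g::topological_group_add rep \<Rightarrow> bool" where
  "unitary_rep = (\<lambda>(d, \<pi>).
     (\<forall>x. unitary_op d d (\<pi> x)) \<and>
     (\<forall>x y. \<forall>u\<in>hilb d. \<pi> (x + y) u = \<pi> x (\<pi> y u)) \<and>
     (\<forall>u\<in>hilb d. \<forall>x0. ((\<lambda>x. vnorm (\<lambda>n. \<pi> x u n - \<pi> x0 u n)) \<longlongrightarrow> 0) (at x0)))"

definition irreducible_rep :: "'g::topological_group_add rep \<Rightarrow> bool" where
  "irreducible_rep = (\<lambda>(d, \<pi>).
     unitary_rep (d, \<pi>) \<and> d \<noteq> 0 \<and>
     (\<forall>K. closed_subspace d K \<and> (\<forall>x. \<forall>u\<in>K. \<pi> x u \<in> K) \<longrightarrow> K = {\<lambda>_. 0} \<or> K = hilb d))"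

definition intertwines :: "'g rep \<Rightarrow> 'g rep \<Rightarrow> cop \<Rightarrow> bool" where
  "intertwines = (\<lambda>(d, \<pi>) (e, \<rho>) T. \<forall>x. \<forall>u\<in>hilb d. T (\<pi> x u) = \<rho> x (T u))"

definition equivalent_rep :: "'g rep \<Rightarrow> 'g rep \<Rightarrow> bool" where
  "equivalent_rep r s \<longleftrightarrow> (\<exists>U. unitary_op (fst r) (fst s) U \<and> intertwines r s U)"

definition commutant :: "'g rep \<Rightarrow> cop set" where
  "commutant r = {T. bounded_op (fst r) T \<and> intertwines r r T}"

text \<open>Primary (factor) representation: the centre of the commutant consists of scalars.\<close>

definition primary_rep :: "'g::topological_group_add rep \<Rightarrow> bool" where
  "primary_rep r \<longleftrightarrow>
     unitary_rep r \<and> fst r \<noteq> 0 \<and>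
     (\<forall>T\<in>commutant r.
        (\<forall>S\<in>commutant r. \<forall>u\<in>hilb (fst r). S (T u) = T (S u)) \<longrightarrow>
        (\<exists>c. \<forall>u\<in>hilb (fst r). T u = (\<lambda>n. c * u n)))"

text \<open>
  \<open>r\<close> is a direct sum of copies of \<open>s\<close>: there are isometric embeddings of \<open>s\<close> into \<open>r\<close> with
  mutually orthogonal ranges whose closed span is the whole space.
\<close>

definition multiple_of_rep :: "'g rep \<Rightarrow> 'g rep \<Rightarrow> bool" where
  "multiple_of_rep r s \<longleftrightarrow>
     (\<exists>(J :: nat set) V.
        (\<forall>i\<in>J. isometric_op (fst s) (fst r) (V i) \<and> intertwines s r (V i)) \<and>
        (\<forall>i\<in>J. \<forall>j\<in>J. i \<noteq> j \<longrightarrow> (\<forall>u\<in>hilb (fst s). \<forall>v\<in>hilb (fst s). ip (V i u) (V j v) = 0)) \<and>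
        (\<forall>w\<in>hilb (fst r). (\<forall>i\<in>J. \<forall>u\<in>hilb (fst s). ip w (V i u) = 0) \<longrightarrow> w = (\<lambda>_. 0)))"

definition type_I :: "'g::topological_group_add itself \<Rightarrow> bool" where
  "type_I _ \<longleftrightarrow>
     (\<forall>r :: 'g rep. primary_rep r \<longrightarrow> (\<exists>s. irreducible_rep s \<and> multiple_of_rep r s))"

definition irreps :: "'g::topological_group_add rep set" where
  "irreps = {r. irreducible_rep r}"

definition unitary_dual :: "'g::topological_group_add rep set set" where
  "unitary_dual = irreps // {(r, s). r \<in> irreps \<and> s \<in> irreps \<and> equivalent_rep r s}"

text \<open>
  The Mackey Borel structure.  On the irreducible representations on a fixed \<open>hilb d\<close> it is
  generated by the matrix coefficients \<open>\<pi> \<mapsto> \<langle>\<pi>(x)u, v\<rangle>\<close>; the union over \<open>d\<close> carries the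
  disjoint union structure, and the unitary dual the quotient structure.
\<close>

definition irrep_borel :: "'g::topological_group_add rep measure" where
  "irrep_borel = sigma irreps
     {{r\<in>irreps. fst r = d \<and> ip (snd r x u) v \<in> B} | d x u v B.
        u \<in> hilb d \<and> v \<in> hilb d \<and> B \<in> sets borel}"

definition dual_borel :: "'g::topological_group_add rep set measure" where
  "dual_borel = sigma unitary_dual {A. A \<subseteq> unitary_dual \<and> \<Union>A \<in> sets irrep_borel}"

text \<open>
  A measurable choice of a representative \<open>\<rho> c\<close>, acting on \<open>hilb (fst (\<rho> c))\<close>, in each class \<open>c\<close>;
  it turns the spaces of the representations into a measurable field over the dual.
\<close>

definition measurable_choice ::
  "('g::topological_group_add rep set \<Rightarrow> 'g rep) \<Rightarrow> bool" where
  "measurable_choice \<rho> \<longleftrightarrow>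
     (\<forall>c\<in>unitary_dual. \<rho> c \<in> c) \<and> \<rho> \<in> measurable dual_borel irrep_borel"

section \<open>Fourier transform and Plancherel measure\<close>

text \<open>
  The operator \<open>\<integral> f(z) \<pi>(z)\<^sup>* dz\<close>, the integral being taken in the weak sense, that is, in each
  coordinate.
\<close>

definition fourier :: "'g measure \<Rightarrow> ('g \<Rightarrow> complex) \<Rightarrow> 'g rep \<Rightarrow> cop" where
  "fourier M f r u = (\<lambda>n. \<integral>z. f z * adjoint_op (fst r) (snd r z) u n \<partial>M)"

text \<open>
  The Hilbert-Schmidt norm of the Fourier transform is invariant under unitary equivalence, so
  this notion does not depend on the choice \<open>\<rho>\<close> of representatives.
\<close>

definition plancherel_measure ::
  "'g::topological_group_add measure \<Rightarrow> ('g rep set \<Rightarrow> 'g rep) \<Rightarrow> 'g rep set measure \<Rightarrow> bool" where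
  "plancherel_measure M \<rho> \<mu> \<longleftrightarrow>
     sets \<mu> = sets dual_borel \<and>
     sigma_finite_measure \<mu> \<and>
     (\<forall>f. integrable M f \<and> f \<in> L2 M \<longrightarrow>
        (\<integral>\<^sup>+x. ennreal ((cmod (f x))\<^sup>2) \<partial>M) =
        (\<integral>\<^sup>+c. hs_norm2 (fst (\<rho> c)) (fourier M f (\<rho> c)) \<partial>\<mu>))"

section \<open>Measurable fields of operators\<close>

text \<open>
  Over a measure space \<open>N\<close>, the fibre at the point \<open>p\<close> is \<open>hilb (d p)\<close>; the measurable structure of
  the field of Hilbert spaces is the canonical one, given by the coordinates.
\<close>

definition vector_field :: "'p measure \<Rightarrow> ('p \<Rightarrow> enat) \<Rightarrow> ('p \<Rightarrow> cvec) \<Rightarrow> bool" where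
  "vector_field N d v \<longleftrightarrow>
     (\<forall>p\<in>space N. v p \<in> hilb (d p)) \<and> (\<forall>n. (\<lambda>p. v p n) \<in> borel_measurable N)"

definition op_field :: "'p measure \<Rightarrow> ('p \<Rightarrow> enat) \<Rightarrow> ('p \<Rightarrow> cop) \<Rightarrow> bool" where
  "op_field N d T \<longleftrightarrow>
     (\<forall>p\<in>space N. bounded_op (d p) (T p)) \<and>
     (\<forall>v. vector_field N d v \<longrightarrow> vector_field N d (\<lambda>p. T p (v p)))"

text \<open>Finiteness of the integral forces the operators to be Hilbert-Schmidt almost everywhere.\<close>

definition L2_fields :: "'p measure \<Rightarrow> ('p \<Rightarrow> enat) \<Rightarrow> ('p \<Rightarrow> cop) set" where
  "L2_fields N d = {T. op_field N d T \<and> (\<integral>\<^sup>+p. hs_norm2 (d p) (T p) \<partial>N) < \<infinity>}"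

definition L2_fields_inner ::
  "'p measure \<Rightarrow> ('p \<Rightarrow> enat) \<Rightarrow> ('p \<Rightarrow> cop) \<Rightarrow> ('p \<Rightarrow> cop) \<Rightarrow> complex" where
  "L2_fields_inner N d S T = (\<integral>p. hs_inner (d p) (S p) (T p) \<partial>N)"

definition Linf_fields :: "'p measure \<Rightarrow> ('p \<Rightarrow> enat) \<Rightarrow> ('p \<Rightarrow> cop) set" where
  "Linf_fields N d =
     {T. op_field N d T \<and> (\<exists>C. AE p in N. \<forall>u\<in>hilb (d p). vnorm (T p u) \<le> C * vnorm u)}"

section \<open>Wick quantization\<close>

definition fdim :: "('g rep set \<Rightarrow> 'g rep) \<Rightarrow> 'g \<times> 'g rep set \<Rightarrow> enat" where
  "fdim \<rho> = (\<lambda>(x, c). fst (\<rho> c))"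

text \<open>
  For \<open>a\<close> bounded and square-integrable, \<open>f a(x\<^sup>-\<^sup>1 \<cdot>)\<close> is in \<open>L\<^sup>1 \<inter> L\<^sup>2\<close> for every \<open>f\<close> in \<open>L\<^sup>2\<close>, so the
  defining formula makes sense on all of \<open>L\<^sup>2(G)\<close> and no extension by density is needed.
\<close>

definition wick_B ::
  "'g::topological_group_add measure \<Rightarrow> ('g rep set \<Rightarrow> 'g rep) \<Rightarrow> ('g \<Rightarrow> complex) \<Rightarrow>
    ('g \<Rightarrow> complex) \<Rightarrow> 'g \<times> 'g rep set \<Rightarrow> cop" where
  "wick_B M \<rho> a f = (\<lambda>(x, c). fourier M (\<lambda>y. f y * a (- x + y)) (\<rho> c))"

text \<open>The value of the adjoint is determined up to a null set.\<close>

definition wick_B_adj ::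
  "'g::topological_group_add measure \<Rightarrow> 'g rep set measure \<Rightarrow> ('g rep set \<Rightarrow> 'g rep) \<Rightarrow>
    ('g \<Rightarrow> complex) \<Rightarrow> ('g \<times> 'g rep set \<Rightarrow> cop) \<Rightarrow> 'g \<Rightarrow> complex" where
  "wick_B_adj M \<mu> \<rho> a = (\<lambda>\<tau>\<in>L2_fields (M \<Otimes>\<^sub>M \<mu>) (fdim \<rho>).
     SOME h. h \<in> L2 M \<and>
       (\<forall>g\<in>L2 M. L2_inner M h g = L2_fields_inner (M \<Otimes>\<^sub>M \<mu>) (fdim \<rho>) \<tau> (wick_B M \<rho> a g)))"

definition Op_Wick ::
  "'g::topological_group_add measure \<Rightarrow> 'g rep set measure \<Rightarrow> ('g rep set \<Rightarrow> 'g rep) \<Rightarrow>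
    ('g \<Rightarrow> complex) \<Rightarrow> ('g \<times> 'g rep set \<Rightarrow> cop) \<Rightarrow> ('g \<Rightarrow> complex) \<Rightarrow> 'g \<Rightarrow> complex" where
  "Op_Wick M \<mu> \<rho> a = (\<lambda>\<sigma>\<in>Linf_fields (M \<Otimes>\<^sub>M \<mu>) (fdim \<rho>). \<lambda>f\<in>L2 M.
     wick_B_adj M \<mu> \<rho> a (\<lambda>p. \<sigma> p \<circ> wick_B M \<rho> a f p))"

definition conv_kernel ::
  "'g::topological_group_add measure \<Rightarrow> ('g rep set \<Rightarrow> 'g rep) \<Rightarrow>
    ('g \<times> 'g rep set \<Rightarrow> cop) \<Rightarrow> ('g \<Rightarrow> 'g \<Rightarrow> complex) \<Rightarrow> bool" where
  "conv_kernel M \<rho> \<sigma> \<kappa> \<longleftrightarrow>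
     (\<forall>x. \<forall>c\<in>unitary_dual. \<forall>u\<in>hilb (fst (\<rho> c)). \<sigma> (x, c) u = fourier M (\<kappa> x) (\<rho> c) u)"

definition Cb_FL1 ::
  "'g::topological_group_add measure \<Rightarrow> ('g rep set \<Rightarrow> 'g rep) \<Rightarrow> ('g \<times> 'g rep set \<Rightarrow> cop) set" where
  "Cb_FL1 M \<rho> = {\<sigma>. \<exists>\<kappa>\<in>Cb_L1 M. conv_kernel M \<rho> \<sigma> \<kappa>}"

definition wick_kernel ::
  "'g::topological_group_add measure \<Rightarrow> ('g \<Rightarrow> complex) \<Rightarrow> ('g \<Rightarrow> 'g \<Rightarrow> complex) \<Rightarrow>
    'g \<Rightarrow> 'g \<Rightarrow> complex" where
  "wick_kernel M a k x w = (\<integral>z. a (- z + x - w) * cnj (a (- z + x)) * k z w \<partial>M)"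

end

theory Submission
  imports Defs
begin

text \<open>
  Write \<open>K\<close> for the Wick kernel and \<open>B\<close> for the map \<open>f \<mapsto> F(f a(x\<^sup>-\<^sup>1 \<cdot>))(\<pi>)\<close>. The operator
  \<open>B\<^sup>* \<sigma> B\<close> is characterized by the inner products of \<open>\<sigma> B[f]\<close> with \<open>B[g]\<close>, so the theorem
  amounts to the identity of such an inner product with that of \<open>x \<mapsto> (f * K\<^sub>x)(x)\<close> and \<open>g\<close>.
  For fixed \<open>x\<close> the operators \<open>\<sigma>(x, \<pi>) B[f](x, \<pi>) = F\<kappa>\<^sub>x(\<pi>) F(f a(x\<^sup>-\<^sup>1 \<cdot>))(\<pi>)\<close> form the Fourier
  transform of \<open>f a(x\<^sup>-\<^sup>1 \<cdot>) * \<kappa>\<^sub>x\<close>, since the Fourier transform, being defined with adjoints,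
  reverses products (\<open>fourier_group_conv\<close>). By the polarized Plancherel formula, integrated over
  \<open>x\<close> (\<open>fourier_field_Parseval\<close>), the inner product is an integral over \<open>G \<times> G\<close> of functions
  on the group, and it becomes a triple integral of
  \<open>f(yw\<^sup>-\<^sup>1) \<kappa>\<^sub>x(w) a(x\<^sup>-\<^sup>1yw\<^sup>-\<^sup>1)\<close> times the conjugate of \<open>g(y) a(x\<^sup>-\<^sup>1y)\<close>. Carrying out the
  integration over \<open>x\<close> first produces \<open>K\<^sub>y(w)\<close> (\<open>wick_conv_inner\<close>).

  All estimates come from two sources. By the definition of \<open>C\<^sub>b(G, L\<^sup>1(G))\<close> there is an integrable
  function \<open>s\<close> with \<open>\<bar>\<kappa>\<^sub>x\<bar> \<le> s\<close> almost everywhere, for each \<open>x\<close>. And by the Cauchy-Schwarz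
  inequality and the invariance of the Haar measure under translations and inversion, the integral
  over \<open>z\<close> of the modulus of \<open>a(z\<^sup>-\<^sup>1xw\<^sup>-\<^sup>1) a(z\<^sup>-\<^sup>1x)\<close> is at most \<open>\<parallel>a\<parallel>\<^sup>2 = 1\<close>. Hence
  \<open>\<bar>K\<^sub>x\<bar> \<le> s\<close> as well (\<open>K_le_s\<close>), which, together with continuity of \<open>x \<mapsto> K\<^sub>x\<close> in \<open>L\<^sup>1\<close>
  (\<open>K_L1_continuous\<close>), places \<open>K\<close> in \<open>C\<^sub>b(G, L\<^sup>1(G))\<close>. Young's inequality turns the same bound
  into square-integrability of all convolutions and into the absolute convergence that Fubini's
  theorem needs.

  The remaining work is measurability. Integrals over \<open>z\<close> of \<open>\<kappa>\<^sub>z(w)\<close> require a jointly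
  measurable version of \<open>\<kappa>\<close>, which exists because \<open>\<kappa>\<close> is continuous into \<open>L\<^sup>1\<close> and the group
  is second countable (\<open>ex_measurable_version\<close>). The fields of operators are measurable because
  matrix coefficients of irreducible representations are continuous on the group and measurable on
  the dual, hence jointly measurable (\<open>matrix_coeff_measurable\<close>).
\<close>

section \<open>Square-integrable functions and unimodular Haar measures\<close>

lemma cnj_measurable [measurable (raw)]:
  assumes "f \<in> borel_measurable N" shows "(\<lambda>x. cnj (f x)) \<in> borel_measurable N"
  using bounded_linear_cnj[THEN borel_measurable_continuous_onI[OF linear_continuous_on]]
  by (rule measurable_compose[OF assms])

lemma tendsto_0_le_ennreal:
  fixes f g :: "nat \<Rightarrow> ennreal"
  assumes "g \<longlonglongrightarrow> 0" "\<And>n. f n \<le> g n"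
  shows "f \<longlonglongrightarrow> 0"
  by (rule tendsto_sandwich[OF _ _ tendsto_const assms(1)]) (use assms(2) in auto)

lemma norm_add_sq_le: "(cmod (x + y))\<^sup>2 \<le> 2 * (cmod x)\<^sup>2 + 2 * (cmod y)\<^sup>2"
proof -
  have "(cmod (x + y))\<^sup>2 \<le> (cmod x + cmod y)\<^sup>2"
    by (intro power_mono norm_triangle_ineq) auto
  also have "\<dots> \<le> 2 * (cmod x)\<^sup>2 + 2 * (cmod y)\<^sup>2"
    using sum_squares_bound[of "cmod x" "cmod y"] by (simp add: power2_sum)
  finally show ?thesis .
qed

text \<open>
  Absolute integrability is a statement about nonnegative integrals, where the order of
  integration is irrelevant; in this form it can be checked for whichever order is convenient.
\<close>

lemma (in pair_sigma_finite) Fubini_absolute: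
  fixes f :: "'a \<Rightarrow> 'b \<Rightarrow> complex"
  assumes [measurable]: "case_prod f \<in> borel_measurable (M1 \<Otimes>\<^sub>M M2)"
    and fin: "(\<integral>\<^sup>+x. \<integral>\<^sup>+y. ennreal (cmod (f x y)) \<partial>M2 \<partial>M1) < \<infinity>"
  shows "(\<integral>x. \<integral>y. f x y \<partial>M2 \<partial>M1) = (\<integral>y. \<integral>x. f x y \<partial>M1 \<partial>M2)"
    and "integrable M1 (\<lambda>x. \<integral>y. f x y \<partial>M2)"
    and "AE x in M1. integrable M2 (f x)"
    and "integrable (M1 \<Otimes>\<^sub>M M2) (case_prod f)"
proof -
  have "(\<integral>\<^sup>+p. ennreal (cmod (case_prod f p)) \<partial>(M1 \<Otimes>\<^sub>M M2)) < \<infinity>"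
    using fin by (subst M2.nn_integral_fst[symmetric]) auto
  then show int: "integrable (M1 \<Otimes>\<^sub>M M2) (case_prod f)"
    by (intro integrableI_bounded) auto
  show "(\<integral>x. \<integral>y. f x y \<partial>M2 \<partial>M1) = (\<integral>y. \<integral>x. f x y \<partial>M1 \<partial>M2)"
    using Fubini_integral[OF int] by simp
  show "integrable M1 (\<lambda>x. \<integral>y. f x y \<partial>M2)"
    using integrable_fst'[OF int] by simp
  show "AE x in M1. integrable M2 (f x)"
    using AE_integrable_fst'[OF int] by simp
qed

lemma nn_integral_cmod_Cauchy_Schwarz:
  assumes [measurable]: "u \<in> borel_measurable M" "v \<in> borel_measurable M"
  shows "(\<integral>\<^sup>+x. ennreal (cmod (u x) * cmod (v x)) \<partial>M)\<^sup>2 \<le>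
    (\<integral>\<^sup>+x. ennreal ((cmod (u x))\<^sup>2) \<partial>M) * (\<integral>\<^sup>+x. ennreal ((cmod (v x))\<^sup>2) \<partial>M)"
  using Cauchy_Schwarz_nn_integral[of "\<lambda>x. ennreal (cmod (u x))" M "\<lambda>x. ennreal (cmod (v x))"]
  by (simp add: ennreal_mult ennreal_power)

lemma L2_nn_integral_finite:
  "f \<in> L2 M \<Longrightarrow> (\<integral>\<^sup>+x. ennreal ((cmod (f x))\<^sup>2) \<partial>M) < \<infinity>"
  by (auto simp: L2_def integrable_iff_bounded)

lemma L2I:
  "f \<in> borel_measurable M \<Longrightarrow> (\<integral>\<^sup>+x. ennreal ((cmod (f x))\<^sup>2) \<partial>M) < \<infinity> \<Longrightarrow> f \<in> L2 M"
  by (auto simp: L2_def integrable_iff_bounded)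

lemma L2_mult_nn_integral_finite:
  assumes "f \<in> L2 M" "g \<in> L2 M"
  shows "(\<integral>\<^sup>+x. ennreal (cmod (f x) * cmod (g x)) \<partial>M) < \<infinity>"
proof -
  have m: "f \<in> borel_measurable M" "g \<in> borel_measurable M"
    using assms by (auto simp: L2_def)
  have "(\<integral>\<^sup>+x. ennreal (cmod (f x) * cmod (g x)) \<partial>M)\<^sup>2 < \<infinity>"
    using L2_nn_integral_finite[OF assms(1)] L2_nn_integral_finite[OF assms(2)]
    by (intro order_le_less_trans[OF nn_integral_cmod_Cauchy_Schwarz[OF m]])
      (simp add: ennreal_mult_less_top)
  then show ?thesis
    by (simp add: power_less_top_ennreal)
qed

lemma L2_mult_integrable:
  assumes "f \<in> L2 M" "g \<in> L2 M"
  shows "integrable M (\<lambda>x. f x * g x)"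
  using L2_mult_nn_integral_finite[OF assms] assms
  by (auto simp: L2_def integrable_iff_bounded norm_mult)

lemma L2_cnj: "f \<in> L2 M \<Longrightarrow> (\<lambda>x. cnj (f x)) \<in> L2 M"
  by (auto simp: L2_def)

lemma L2_scale: "f \<in> L2 M \<Longrightarrow> (\<lambda>x. c * f x) \<in> L2 M"
  by (auto simp: L2_def norm_mult power_mult_distrib)

lemma L2_add:
  assumes "f \<in> L2 M" "g \<in> L2 M"
  shows "(\<lambda>x. f x + g x) \<in> L2 M"
proof -
  have "integrable M (\<lambda>x. 2 * (cmod (f x))\<^sup>2 + 2 * (cmod (g x))\<^sup>2)"
    using assms by (auto simp: L2_def)
  then have "integrable M (\<lambda>x. (cmod (f x + g x))\<^sup>2)"
  proof (rule Bochner_Integration.integrable_bound)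
    show "AE x in M. norm ((cmod (f x + g x))\<^sup>2) \<le> norm (2 * (cmod (f x))\<^sup>2 + 2 * (cmod (g x))\<^sup>2)"
      using norm_add_sq_le by auto
  qed (use assms in \<open>auto simp: L2_def\<close>)
  then show ?thesis using assms by (auto simp: L2_def)
qed

lemma L2_diff:
  assumes "f \<in> L2 M" "g \<in> L2 M"
  shows "(\<lambda>x. f x - g x) \<in> L2 M"
  using L2_add[OF assms(1) L2_scale[OF assms(2), of "-1"]] by simp

lemma L2_mult_bounded:
  assumes "f \<in> L2 M" "b \<in> borel_measurable M" "\<And>x. cmod (b x) \<le> B"
  shows "(\<lambda>x. f x * b x) \<in> L2 M"
proof (rule L2I)
  show "(\<lambda>x. f x * b x) \<in> borel_measurable M" using assms by (auto simp: L2_def)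
  have [measurable]: "f \<in> borel_measurable M" using assms by (auto simp: L2_def)
  have "B \<ge> 0" using assms(3)[of undefined] norm_ge_zero[of "b undefined"] by linarith
  have "(\<integral>\<^sup>+x. ennreal ((cmod (f x * b x))\<^sup>2) \<partial>M) \<le> (\<integral>\<^sup>+x. ennreal (B\<^sup>2) * ennreal ((cmod (f x))\<^sup>2) \<partial>M)"
  proof (rule nn_integral_mono)
    fix x
    have "(cmod (b x))\<^sup>2 \<le> B\<^sup>2" using assms(3) by (intro power_mono) auto
    then show "ennreal ((cmod (f x * b x))\<^sup>2) \<le> ennreal (B\<^sup>2) * ennreal ((cmod (f x))\<^sup>2)"
      by (auto simp: norm_mult power_mult_distrib ennreal_mult[symmetric] mult.commute[of "B\<^sup>2"]
          intro!: ennreal_leI mult_left_mono)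
  qed
  also have "\<dots> < \<infinity>"
    using L2_nn_integral_finite[OF assms(1)] by (simp add: nn_integral_cmult ennreal_mult_less_top)
  finally show "(\<integral>\<^sup>+x. ennreal ((cmod (f x * b x))\<^sup>2) \<partial>M) < \<infinity>" .
qed

text \<open>
  Invariance is stated for push-forwards, so that it applies to integrals of measurable functions;
  \<open>\<sigma>\<close>-finiteness, on which Fubini's theorem rests, is proved from local compactness and second
  countability in \<open>unimodular_haarI\<close>.
\<close>

locale unimodular_haar = sigma_finite_measure M
  for M :: "'g::{topological_group_add, t2_space, second_countable_topology} measure" +
  assumes sets_M [measurable_cong, simp]: "sets M = sets borel"
    and nonzero: "emeasure M UNIV \<noteq> 0"
    and finite_compact: "compact K \<Longrightarrow> emeasure M K < \<infinity>"
    and distr_left: "distr M M (\<lambda>y. x + y) = M"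
    and distr_right: "distr M M (\<lambda>y. y + x) = M"
begin

sublocale MM: pair_sigma_finite M M ..

lemma space_M [simp]: "space M = UNIV"
  using sets_eq_imp_space_eq[OF sets_M] by simp

lemma borel_measurable_M: "borel_measurable M = borel_measurable borel"
  by (rule measurable_cong_sets) auto

lemma plus_measurable [measurable]:
  assumes "f \<in> measurable N M" "g \<in> measurable N M"
  shows "(\<lambda>x. f x + g x) \<in> measurable N M"
proof -
  have "(\<lambda>p::'g \<times> 'g. fst p + snd p) \<in> borel_measurable borel"
    by (intro borel_measurable_continuous_onI continuous_intros)
  then have *: "(\<lambda>p::'g \<times> 'g. fst p + snd p) \<in> measurable (M \<Otimes>\<^sub>M M) M"
    by (simp add: borel_prod[symmetric] cong: measurable_cong_sets)
  have "(\<lambda>x. (f x, g x)) \<in> measurable N (M \<Otimes>\<^sub>M M)" using assms by simp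
  from measurable_compose[OF this *] show ?thesis by simp
qed

lemma uminus_measurable [measurable]:
  assumes "f \<in> measurable N M"
  shows "(\<lambda>x. - f x) \<in> measurable N M"
proof -
  have "(\<lambda>p::'g. - p) \<in> borel_measurable borel"
    by (intro borel_measurable_continuous_onI continuous_intros)
  then have *: "(\<lambda>p::'g. - p) \<in> measurable M M"
    by (simp cong: measurable_cong_sets)
  from measurable_compose[OF assms this] show ?thesis by simp
qed

lemma diff_measurable [measurable]:
  assumes "f \<in> measurable N M" "g \<in> measurable N M"
  shows "(\<lambda>x. f x - g x) \<in> measurable N M"
  using plus_measurable[OF assms(1) uminus_measurable[OF assms(2)]] by simp

lemma nn_integral_left:
  "h \<in> borel_measurable M \<Longrightarrow> (\<integral>\<^sup>+y. h (x + y) \<partial>M) = (\<integral>\<^sup>+y. h y \<partial>M)"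
  by (subst (2) distr_left[of x, symmetric]) (simp add: nn_integral_distr)

lemma nn_integral_right:
  "h \<in> borel_measurable M \<Longrightarrow> (\<integral>\<^sup>+y. h (y + x) \<partial>M) = (\<integral>\<^sup>+y. h y \<partial>M)"
  by (subst (2) distr_right[of x, symmetric]) (simp add: nn_integral_distr)

lemma ex_finite_positive: "\<exists>B\<in>sets M. 0 < emeasure M B \<and> emeasure M B < \<infinity>"
proof -
  obtain A :: "nat \<Rightarrow> 'g set" where A: "range A \<subseteq> sets M" "(\<Union>i. A i) = space M"
      "\<And>i. emeasure M (A i) \<noteq> \<infinity>"
    using sigma_finite by blast
  have "\<exists>i. emeasure M (A i) \<noteq> 0"
  proof (rule ccontr)
    assume "\<nexists>i. emeasure M (A i) \<noteq> 0"
    then have "emeasure M (\<Union>i. A i) = 0"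
      using A by (intro emeasure_UN_eq_0) auto
    with A nonzero show False by simp
  qed
  with A show ?thesis
    by (metis infinity_ennreal_def not_gr_zero range_subsetD top.not_eq_extremum)
qed

text \<open>
  Inversion preserves a bi-invariant measure. For a set \<open>B\<close> of positive finite measure compute
  the double integral of \<open>h x * indicator B (y + x)\<close> in two ways. Right invariance in \<open>y\<close>
  gives \<open>(\<integral>h) |B|\<close>. Replacing \<open>x\<close> by \<open>- y + x\<close> moves the dependence on \<open>y\<close> to
  \<open>h (- y + x)\<close>, whose integral over \<open>y\<close> is that of \<open>h (- y)\<close> by left invariance; this
  gives \<open>(\<integral>h (- y)) |B|\<close>. Cancel \<open>|B|\<close>.
\<close>

lemma nn_integral_inv:
  assumes [measurable]: "h \<in> borel_measurable M"
  shows "(\<integral>\<^sup>+y. h (- y) \<partial>M) = (\<integral>\<^sup>+y. h y \<partial>M)"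
proof -
  obtain B where [measurable]: "B \<in> sets M" and B: "0 < emeasure M B" "emeasure M B < \<infinity>"
    using ex_finite_positive by blast
  define g :: "'g \<Rightarrow> ennreal" where "g = indicator B"
  have [measurable]: "g \<in> borel_measurable M" by (simp add: g_def)
  have "(\<integral>\<^sup>+x. h x \<partial>M) * emeasure M B = (\<integral>\<^sup>+x. h x * (\<integral>\<^sup>+y. g (y + x) \<partial>M) \<partial>M)"
    using \<open>B \<in> sets M\<close> by (simp add: nn_integral_right nn_integral_multc) (simp add: g_def)
  also have "\<dots> = (\<integral>\<^sup>+x. \<integral>\<^sup>+y. h x * g (y + x) \<partial>M \<partial>M)"
    by (simp add: nn_integral_cmult)
  also have "\<dots> = (\<integral>\<^sup>+y. \<integral>\<^sup>+x. h x * g (y + x) \<partial>M \<partial>M)"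
    by (rule MM.Fubini'[symmetric]) measurable
  also have "\<dots> = (\<integral>\<^sup>+y. \<integral>\<^sup>+x. h (- y + x) * g x \<partial>M \<partial>M)"
  proof (rule nn_integral_cong)
    fix y
    show "(\<integral>\<^sup>+x. h x * g (y + x) \<partial>M) = (\<integral>\<^sup>+x. h (- y + x) * g x \<partial>M)"
      using nn_integral_left[of "\<lambda>x. h (- y + x) * g x" y]
      by (simp add: add.assoc[symmetric])
  qed
  also have "\<dots> = (\<integral>\<^sup>+x. \<integral>\<^sup>+y. h (- y + x) * g x \<partial>M \<partial>M)"
    by (rule MM.Fubini') measurable
  also have "\<dots> = (\<integral>\<^sup>+x. (\<integral>\<^sup>+y. h (- y) \<partial>M) * g x \<partial>M)"
  proof (rule nn_integral_cong)
    fix x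
    have "(\<integral>\<^sup>+y. h (- y + x) \<partial>M) = (\<integral>\<^sup>+y. h (- y) \<partial>M)"
      using nn_integral_left[of "\<lambda>y. h (- y)" "- x"] by (simp add: minus_add)
    then show "(\<integral>\<^sup>+y. h (- y + x) * g x \<partial>M) = (\<integral>\<^sup>+y. h (- y) \<partial>M) * g x"
      by (simp add: nn_integral_multc)
  qed
  also have "\<dots> = (\<integral>\<^sup>+y. h (- y) \<partial>M) * emeasure M B"
    using \<open>B \<in> sets M\<close> by (simp add: nn_integral_cmult) (simp add: g_def)
  finally show ?thesis using B
    by (auto simp: mult.commute[of _ "emeasure M B"] ennreal_mult_cancel_left)
qed

definition preserving :: "('g \<Rightarrow> 'g) \<Rightarrow> bool" where
  "preserving \<phi> \<longleftrightarrow> \<phi> \<in> measurable M M \<and> distr M M \<phi> = M"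

lemma preserving_comp: "preserving \<phi> \<Longrightarrow> preserving \<psi> \<Longrightarrow> preserving (\<lambda>x. \<psi> (\<phi> x))"
  unfolding preserving_def using distr_distr[of \<psi> M M \<phi> M] by (auto simp: comp_def)

lemma preserving_left: "preserving (\<lambda>y. x + y)" and preserving_right: "preserving (\<lambda>y. y + x)"
  by (auto simp: preserving_def distr_left distr_right)

lemma preserving_diff_const: "preserving (\<lambda>y. y - x)"
  using preserving_right[of "- x"] by simp

lemma preserving_inv: "preserving (\<lambda>y. - y)"
proof -
  have "distr M M uminus = M"
  proof (rule measure_eqI)
    fix A assume "A \<in> sets (distr M M uminus)"
    then have [measurable]: "A \<in> sets M" by simp
    have "emeasure (distr M M uminus) A = (\<integral>\<^sup>+y. indicator A y \<partial>distr M M uminus)"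
      using \<open>A \<in> sets M\<close> by (subst nn_integral_indicator) auto
    also have "\<dots> = (\<integral>\<^sup>+y. indicator A (- y) \<partial>M)" by (subst nn_integral_distr) auto
    also have "\<dots> = (\<integral>\<^sup>+y. indicator A y \<partial>M)" by (rule nn_integral_inv) measurable
    finally show "emeasure (distr M M uminus) A = emeasure M A" using \<open>A \<in> sets M\<close> by simp
  qed simp
  then show ?thesis by (simp add: preserving_def)
qed

lemma preserving_reflect_left: "preserving (\<lambda>y. x - y)"
  using preserving_comp[OF preserving_inv preserving_left[of x]] by simp

lemma preserving_reflect_right: "preserving (\<lambda>y. - y + x)"
  using preserving_comp[OF preserving_inv preserving_right[of x]] by simp

lemma nn_integral_preserving:
  "preserving \<phi> \<Longrightarrow> h \<in> borel_measurable M \<Longrightarrow> (\<integral>\<^sup>+y. h (\<phi> y) \<partial>M) = (\<integral>\<^sup>+y. h y \<partial>M)"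
  unfolding preserving_def using nn_integral_distr[of \<phi> M M h] by auto

lemma integral_preserving:
  fixes h :: "'g \<Rightarrow> complex"
  shows "preserving \<phi> \<Longrightarrow> h \<in> borel_measurable M \<Longrightarrow> (\<integral>y. h (\<phi> y) \<partial>M) = (\<integral>y. h y \<partial>M)"
  unfolding preserving_def using integral_distr[of \<phi> M M h] by auto

lemma integrable_preserving:
  fixes h :: "'g \<Rightarrow> 'b::{banach, second_countable_topology}"
  shows "preserving \<phi> \<Longrightarrow> h \<in> borel_measurable M \<Longrightarrow> integrable M (\<lambda>y. h (\<phi> y)) \<longleftrightarrow> integrable M h"
  unfolding preserving_def using integrable_distr_eq[of \<phi> M M h] by auto

lemma L2_preserving: "preserving \<phi> \<Longrightarrow> f \<in> L2 M \<Longrightarrow> (\<lambda>y. f (\<phi> y)) \<in> L2 M"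
  using integrable_preserving[of \<phi> "\<lambda>y. (cmod (f y))\<^sup>2"]
  by (auto simp: L2_def) (auto simp: preserving_def intro: measurable_compose)

text \<open>
  The substitution \<open>w = - y + x\<close> is measure preserving by inversion invariance. It moves the
  translation onto the first factor, which is the continuous or square-integrable one, and leaves
  the kernel untouched.
\<close>

lemma group_conv_diff:
  assumes [measurable]: "f \<in> borel_measurable M" "g \<in> borel_measurable M"
  shows "group_conv M f g x = (\<integral>w. f (x - w) * g w \<partial>M)"
proof -
  have "(\<integral>w. f (x - w) * g w \<partial>M) = (\<integral>y. f (x - (- y + x)) * g (- y + x) \<partial>M)"
    by (rule integral_preserving[symmetric, OF preserving_reflect_right]) measurable
  then show ?thesis by (simp add: group_conv_def diff_conv_add_uminus minus_add add.assoc[symmetric] del: add_uminus_conv_diff)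
qed

text \<open>
  Young's inequality for the convolution of a square-integrable and an integrable function:
  split \<open>s = sqrt s * sqrt s\<close>, apply the Cauchy-Schwarz inequality to the inner integral, and
  integrate over \<open>x\<close> first.
\<close>

lemma Young_L2_L1:
  assumes [measurable]: "u \<in> borel_measurable M" "s \<in> borel_measurable M" and s: "\<And>w. 0 \<le> s w"
  shows "(\<integral>\<^sup>+x. (\<integral>\<^sup>+w. ennreal (cmod (u (x - w)) * s w) \<partial>M)\<^sup>2 \<partial>M) \<le>
    (\<integral>\<^sup>+w. ennreal (s w) \<partial>M)\<^sup>2 * (\<integral>\<^sup>+x. ennreal ((cmod (u x))\<^sup>2) \<partial>M)"
proof -
  have "(\<integral>\<^sup>+w. ennreal (cmod (u (x - w)) * s w) \<partial>M)\<^sup>2 \<le>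
      (\<integral>\<^sup>+w. ennreal ((cmod (u (x - w)))\<^sup>2 * s w) \<partial>M) * (\<integral>\<^sup>+w. ennreal (s w) \<partial>M)" for x
  proof -
    have "ennreal (cmod (u (x - w)) * s w) = ennreal (cmod (u (x - w)) * sqrt (s w)) * ennreal (sqrt (s w))" for w
      using s[of w] by (simp add: ennreal_mult[symmetric])
    then have "(\<integral>\<^sup>+w. ennreal (cmod (u (x - w)) * s w) \<partial>M)\<^sup>2 =
      (\<integral>\<^sup>+w. ennreal (cmod (u (x - w)) * sqrt (s w)) * ennreal (sqrt (s w)) \<partial>M)\<^sup>2"
      by simp
    also have "\<dots> \<le> (\<integral>\<^sup>+w. (ennreal (cmod (u (x - w)) * sqrt (s w)))\<^sup>2 \<partial>M) * (\<integral>\<^sup>+w. (ennreal (sqrt (s w)))\<^sup>2 \<partial>M)"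
      by (rule Cauchy_Schwarz_nn_integral) measurable
    finally show ?thesis using s by (simp add: ennreal_power power_mult_distrib)
  qed
  then have "(\<integral>\<^sup>+x. (\<integral>\<^sup>+w. ennreal (cmod (u (x - w)) * s w) \<partial>M)\<^sup>2 \<partial>M) \<le>
    (\<integral>\<^sup>+x. (\<integral>\<^sup>+w. ennreal ((cmod (u (x - w)))\<^sup>2 * s w) \<partial>M) * (\<integral>\<^sup>+w. ennreal (s w) \<partial>M) \<partial>M)"
    by (intro nn_integral_mono)
  also have "\<dots> = (\<integral>\<^sup>+x. (\<integral>\<^sup>+w. ennreal ((cmod (u (x - w)))\<^sup>2 * s w) \<partial>M) \<partial>M) * (\<integral>\<^sup>+w. ennreal (s w) \<partial>M)"
    by (rule nn_integral_multc) measurable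
  also have "(\<integral>\<^sup>+x. (\<integral>\<^sup>+w. ennreal ((cmod (u (x - w)))\<^sup>2 * s w) \<partial>M) \<partial>M) =
      (\<integral>\<^sup>+w. (\<integral>\<^sup>+x. ennreal ((cmod (u (x - w)))\<^sup>2 * s w) \<partial>M) \<partial>M)"
    by (rule MM.Fubini') measurable
  also have "\<dots> = (\<integral>\<^sup>+w. (\<integral>\<^sup>+x. ennreal ((cmod (u x))\<^sup>2) \<partial>M) * ennreal (s w) \<partial>M)"
  proof (rule nn_integral_cong)
    fix w
    have "(\<integral>\<^sup>+x. ennreal ((cmod (u (x - w)))\<^sup>2 * s w) \<partial>M) = (\<integral>\<^sup>+x. ennreal ((cmod (u x))\<^sup>2 * s w) \<partial>M)"
      by (rule nn_integral_preserving[OF preserving_diff_const, of "\<lambda>x. ennreal ((cmod (u x))\<^sup>2 * s w)"]) measurable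
    also have "\<dots> = (\<integral>\<^sup>+x. ennreal ((cmod (u x))\<^sup>2) \<partial>M) * ennreal (s w)"
      using s by (simp add: ennreal_mult nn_integral_multc)
    finally show "(\<integral>\<^sup>+x. ennreal ((cmod (u (x - w)))\<^sup>2 * s w) \<partial>M) = (\<integral>\<^sup>+x. ennreal ((cmod (u x))\<^sup>2) \<partial>M) * ennreal (s w)" .
  qed
  also have "\<dots> = (\<integral>\<^sup>+x. ennreal ((cmod (u x))\<^sup>2) \<partial>M) * (\<integral>\<^sup>+w. ennreal (s w) \<partial>M)"
    by (rule nn_integral_cmult) measurable
  finally show ?thesis by (simp add: power2_eq_square ac_simps)
qed

end

text \<open>
  By local compactness the relatively compact open sets cover the group, and by second
  countability countably many of them suffice; this gives \<open>\<sigma>\<close>-finiteness.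
\<close>

lemma unimodular_haarI:
  fixes M :: "'g::{topological_group_add, t2_space, second_countable_topology} measure"
  assumes lc: "locally_compact_space (euclidean :: 'g topology)"
    and um: "unimodular TYPE('g)" and hm: "haar_measure M"
  shows "unimodular_haar M"
proof -
  have sets: "sets M = sets borel" and nz: "emeasure M UNIV \<noteq> 0"
    and fc: "\<And>K. compact K \<Longrightarrow> emeasure M K < \<infinity>"
    and li: "\<And>x A. A \<in> sets borel \<Longrightarrow> emeasure M ((\<lambda>y. x + y) ` A) = emeasure M A"
    using hm by (auto simp: haar_measure_def)
  have ri: "\<And>x A. A \<in> sets borel \<Longrightarrow> emeasure M ((\<lambda>y. y + x) ` A) = emeasure M A"
    using um hm by (auto simp: unimodular_def)
  have sp: "space M = UNIV" using sets_eq_imp_space_eq[OF sets] by simp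
  define F :: "'g set set" where "F = {U. open U \<and> (\<exists>K. compact K \<and> U \<subseteq> K)}"
  have "\<exists>U\<in>F. x \<in> U" for x
    using lc[unfolded locally_compact_space_def, rule_format, of x] by (auto simp: F_def)
  then have "\<Union>F = UNIV" by blast
  moreover obtain F' where F': "F' \<subseteq> F" "countable F'" "\<Union>F' = \<Union>F"
    using Lindelof[of F] by (auto simp: F_def)
  ultimately have "\<Union>F' = UNIV" by simp
  have "sigma_finite_measure M"
  proof
    show "\<exists>A. countable A \<and> A \<subseteq> sets M \<and> \<Union>A = space M \<and> (\<forall>a\<in>A. emeasure M a \<noteq> \<infinity>)"
    proof (intro exI[of _ F'] conjI ballI)
      fix U assume "U \<in> F'"
      then obtain K where K: "compact K" "U \<subseteq> K" using F' by (auto simp: F_def)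
      have "emeasure M U \<le> emeasure M K"
        using K sets by (intro emeasure_mono) (auto simp: compact_imp_closed)
      then show "emeasure M U \<noteq> \<infinity>" using fc[OF K(1)] by auto
    qed (use F' sets sp \<open>\<Union>F' = UNIV\<close> in \<open>auto simp: F_def\<close>)
  qed
  then interpret sigma_finite_measure M .
  have [measurable_cong]: "sets M = sets borel" by fact
  have inv: "distr M M \<phi> = M"
    if c: "continuous_on UNIV \<phi>" and b: "\<And>y. \<psi> (\<phi> y) = y" "\<And>y. \<phi> (\<psi> y) = y"
      and e: "\<And>A. A \<in> sets borel \<Longrightarrow> emeasure M (\<psi> ` A) = emeasure M A" for \<phi> \<psi> :: "'g \<Rightarrow> 'g"
  proof (rule measure_eqI)
    have m: "\<phi> \<in> measurable M M"
      using borel_measurable_continuous_onI[OF c] sets by (simp cong: measurable_cong_sets)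
    fix A assume "A \<in> sets (distr M M \<phi>)"
    then have A: "A \<in> sets M" by simp
    have "\<phi> -` A = \<psi> ` A" by (auto simp: b intro: rev_image_eqI)
    then show "emeasure (distr M M \<phi>) A = emeasure M A"
      using A e sets by (simp add: emeasure_distr[OF m A] sp)
  qed simp
  show ?thesis
  proof
    show "distr M M (\<lambda>y. x + y) = M" for x
      by (rule inv[where \<psi> = "\<lambda>y. - x + y"]) (auto intro!: continuous_intros li simp: add.assoc[symmetric])
    show "distr M M (\<lambda>y. y + x) = M" for x
      by (rule inv[where \<psi> = "\<lambda>y. y + - x"]) (use ri[of _ "- x"] in \<open>auto intro!: continuous_intros simp: add.assoc\<close>)
  qed (use sets nz fc in auto)
qed

section \<open>The space of bounded continuous kernels\<close>

text \<open>
  The lattice supremum is finite almost everywhere because its integral is; its real-valued version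
  is the integrable majorant on which all later estimates rest.
\<close>

lemma Cb_L1_dominated:
  assumes "\<kappa> \<in> Cb_L1 M"
  obtains s :: "'g::topological_group_add \<Rightarrow> real"
  where "integrable M s" "\<And>w. 0 \<le> s w" "\<And>x. AE w in M. cmod (\<kappa> x w) \<le> s w"
proof -
  obtain S where S: "is_lattice_sup M (range (\<lambda>x y. ennreal (cmod (\<kappa> x y)))) S" "(\<integral>\<^sup>+y. S y \<partial>M) < \<infinity>"
    using assms unfolding Cb_L1_def mem_Collect_eq by blast
  have [measurable]: "S \<in> borel_measurable M" using S by (auto simp: is_lattice_sup_def)
  have fin: "AE w in M. S w \<noteq> \<infinity>"
    using S(2) by (intro nn_integral_PInf_AE) auto
  have eq: "AE w in M. ennreal (enn2real (S w)) = S w"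
    using fin by eventually_elim (simp add: less_top)
  show ?thesis
  proof (rule that[of "\<lambda>w. enn2real (S w)"])
    have "(\<integral>\<^sup>+w. ennreal (norm (enn2real (S w))) \<partial>M) = (\<integral>\<^sup>+w. S w \<partial>M)"
      using eq by (intro nn_integral_cong_AE) (auto elim!: eventually_mono)
    then show "integrable M (\<lambda>w. enn2real (S w))"
      using S(2) by (intro integrableI_bounded) auto
    fix x
    have "AE w in M. ennreal (cmod (\<kappa> x w)) \<le> S w"
      using S(1) by (auto simp: is_lattice_sup_def)
    with eq show "AE w in M. cmod (\<kappa> x w) \<le> enn2real (S w)"
    proof eventually_elim
      case (elim w)
      then have "ennreal (cmod (\<kappa> x w)) \<le> ennreal (enn2real (S w))" by simp
      then show ?case by (subst (asm) ennreal_le_iff) auto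
    qed
  qed simp
qed

text \<open>
  Conversely, an integrable majorant yields the lattice supremum. The candidate \<open>S\<close> is the pointwise
  supremum over a countable dense set \<open>D\<close>. That it bounds \<open>\<bar>K x\<bar>\<close> also for \<open>x\<close> outside
  \<open>D\<close> follows from continuity: for every \<open>d\<close> in \<open>D\<close> the integral of the positive part of
  \<open>\<bar>K x\<bar> - S\<close> is at most the distance in \<open>L\<^sup>1\<close> of \<open>K x\<close> and \<open>K d\<close>, which can be made
  arbitrarily small.
\<close>

lemma Cb_L1I:
  fixes K :: "'g::{topological_group_add, second_countable_topology} \<Rightarrow> 'g \<Rightarrow> complex"
  assumes int: "\<And>x. integrable M (K x)"
    and cont: "\<And>x0. ((\<lambda>x. \<integral>y. cmod (K x y - K x0 y) \<partial>M) \<longlongrightarrow> 0) (at x0)"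
    and s: "integrable M s" "\<And>x. AE w in M. cmod (K x w) \<le> s w"
  shows "K \<in> Cb_L1 M"
proof -
  obtain D :: "'g set" where D: "countable D" "\<And>X. open X \<Longrightarrow> X \<noteq> {} \<Longrightarrow> \<exists>d\<in>D. d \<in> X"
    by (rule countable_dense_setE) blast
  have [measurable]: "K x \<in> borel_measurable M" for x using int by auto
  define S where "S = (\<lambda>y. SUP d\<in>D. ennreal (cmod (K d y)))"
  have [measurable]: "S \<in> borel_measurable M"
    unfolding S_def using D(1) by (intro borel_measurable_SUP) auto
  have upper: "AE y in M. ennreal (cmod (K x y)) \<le> S y" for x
  proof -
    (* subtraction in the extended nonnegative reals is truncated at 0,
       so the integrand is the positive part *)
    have "(\<integral>\<^sup>+y. ennreal (cmod (K x y)) - S y \<partial>M) \<le> ennreal e" if "e > 0" for e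
    proof -
      have "eventually (\<lambda>x'. (\<integral>y. cmod (K x' y - K x y) \<partial>M) < e) (at x)"
        using cont[of x] that by (rule order_tendstoD)
      then obtain U where U: "open U" "x \<in> U" "\<forall>x'\<in>U. x' \<noteq> x \<longrightarrow> (\<integral>y. cmod (K x' y - K x y) \<partial>M) < e"
        by (auto simp: eventually_at_topological)
      then obtain d where d: "d \<in> D" "d \<in> U" using D(2)[of U] by blast
      with U have "(\<integral>y. cmod (K d y - K x y) \<partial>M) \<le> e" using that by (cases "d = x") auto
      have "(\<integral>\<^sup>+y. ennreal (cmod (K x y)) - S y \<partial>M) \<le> (\<integral>\<^sup>+y. ennreal (cmod (K d y - K x y)) \<partial>M)"
      proof (rule nn_integral_mono)
        fix y
        have "ennreal (cmod (K x y)) \<le> ennreal (cmod (K d y - K x y) + cmod (K d y))"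
          using norm_triangle_sub[of "K x y" "K d y"]
          by (intro ennreal_leI) (simp add: norm_minus_commute)
        also have "\<dots> \<le> ennreal (cmod (K d y - K x y)) + S y"
          unfolding S_def using d(1) by (auto intro!: add_left_mono SUP_upper)
        finally show "ennreal (cmod (K x y)) - S y \<le> ennreal (cmod (K d y - K x y))"
          by (cases "S y = top") (auto simp: ennreal_minus_le_iff add.commute)
      qed
      also have "\<dots> = ennreal (\<integral>y. cmod (K d y - K x y) \<partial>M)"
        using int by (intro nn_integral_eq_integral) auto
      also have "\<dots> \<le> ennreal e" by (intro ennreal_leI) fact
      finally show ?thesis .
    qed
    then have "(\<integral>\<^sup>+y. ennreal (cmod (K x y)) - S y \<partial>M) \<le> 0"
      by - (rule ennreal_le_epsilon, simp)
    then have "AE y in M. ennreal (cmod (K x y)) - S y = 0"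
      by (subst (asm) le_zero_eq, subst (asm) nn_integral_0_iff_AE) auto
    then show ?thesis by eventually_elim (auto simp: diff_eq_0_iff_ennreal)
  qed
  have "is_lattice_sup M (range (\<lambda>x y. ennreal (cmod (K x y)))) S"
    unfolding is_lattice_sup_def
  proof (intro conjI ballI impI)
    fix T assume T: "\<forall>f\<in>range (\<lambda>x y. ennreal (cmod (K x y))). AE y in M. f y \<le> T y"
    then have "AE y in M. \<forall>d\<in>D. ennreal (cmod (K d y)) \<le> T y"
      using D(1) by (subst AE_ball_countable) auto
    then show "AE y in M. S y \<le> T y"
      by eventually_elim (auto simp: S_def intro!: SUP_least)
  qed (use upper in auto)
  moreover have "(\<integral>\<^sup>+y. S y \<partial>M) < \<infinity>"
  proof -
    have "AE y in M. \<forall>d\<in>D. cmod (K d y) \<le> s y"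
      using D(1) s(2) by (subst AE_ball_countable) auto
    then have "AE y in M. S y \<le> ennreal (norm (s y))"
      by eventually_elim (auto simp: S_def intro!: SUP_least ennreal_leI)
    then have "(\<integral>\<^sup>+y. S y \<partial>M) \<le> (\<integral>\<^sup>+y. ennreal (norm (s y)) \<partial>M)"
      by (rule nn_integral_mono_AE)
    also have "\<dots> < \<infinity>" using s(1) by (simp add: integrable_iff_bounded)
    finally show ?thesis .
  qed
  ultimately show ?thesis using int cont by (auto simp: Cb_L1_def)
qed

lemma measurable_version_Cb_L1:
  fixes \<kappa> :: "'g::{topological_group_add, second_countable_topology} \<Rightarrow> 'g \<Rightarrow> complex"
  assumes "measurable_version M \<kappa> k" "\<kappa> \<in> Cb_L1 M" and sets: "sets M = sets borel"
  shows "k \<in> Cb_L1 M"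
proof -
  have [measurable]: "case_prod k \<in> borel_measurable (M \<Otimes>\<^sub>M M)" and ae: "\<And>z. AE w in M. k z w = \<kappa> z w"
    using assms(1) by (auto simp: measurable_version_def)
  have [measurable]: "k x \<in> borel_measurable M" for x
    using measurable_Pair2[of "case_prod k" M M borel x] sets_eq_imp_space_eq[OF sets] by simp
  obtain s where s: "integrable M s" "\<And>w. 0 \<le> s w" "\<And>x. AE w in M. cmod (\<kappa> x w) \<le> s w"
    using Cb_L1_dominated[OF assms(2)] by blast
  have int: "integrable M (\<kappa> x)" for x using assms(2) by (auto simp: Cb_L1_def)
  then have [measurable]: "\<kappa> x \<in> borel_measurable M" for x by auto
  show ?thesis
  proof (rule Cb_L1I)
    show "integrable M (k x)" for x
      using int[of x] ae[of x] by (subst integrable_cong_AE[of _ _ "\<kappa> x"]) auto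
    fix x0
    have "(\<integral>y. cmod (k x y - k x0 y) \<partial>M) = (\<integral>y. cmod (\<kappa> x y - \<kappa> x0 y) \<partial>M)" for x
      using ae[of x] ae[of x0] by (intro integral_cong_AE) auto
    then show "((\<lambda>x. \<integral>y. cmod (k x y - k x0 y) \<partial>M) \<longlongrightarrow> 0) (at x0)"
      using assms(2) by (simp add: Cb_L1_def)
    show "AE w in M. cmod (k x w) \<le> s w" for x
      using s(3)[of x] ae[of x] by eventually_elim auto
  qed fact
qed

text \<open>
  Cover the group by countably many open sets on which \<open>\<kappa>\<close> varies by less than \<open>(1/2)^n\<close> in
  \<open>L\<^sup>1\<close>, and replace \<open>\<kappa>\<close> on each of them by its value at one centre. The resulting kernels
  \<open>kn n\<close> are jointly measurable because their first argument takes countably many values. As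
  the errors are summable, for every fixed \<open>x\<close> they converge to \<open>\<kappa> x\<close> almost everywhere, so
  the pointwise limit is the required version.
\<close>

lemma ex_measurable_version:
  fixes \<kappa> :: "'g::{topological_group_add, second_countable_topology} \<Rightarrow> 'g \<Rightarrow> complex"
  assumes \<kappa>: "\<kappa> \<in> Cb_L1 M" and sets: "sets M = sets borel"
  shows "\<exists>k. measurable_version M \<kappa> k"
proof -
  have [measurable_cong]: "sets M = sets borel" by fact
  have int: "integrable M (\<kappa> x)" for x using \<kappa> by (auto simp: Cb_L1_def)
  then have [measurable]: "\<kappa> x \<in> borel_measurable M" for x by auto
  define N where "N = (\<lambda>x x'. \<integral>y. cmod (\<kappa> x y - \<kappa> x' y) \<partial>M)"
  have cont: "((\<lambda>x. N x x0) \<longlongrightarrow> 0) (at x0)" for x0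
    using \<kappa> by (auto simp: Cb_L1_def N_def)
  have "\<exists>V c. (\<forall>i::nat. open (V i)) \<and> (\<Union>i. V i) = UNIV \<and> (\<forall>i. \<forall>x\<in>V i. N x (c i) < (1/2)^n)" for n
  proof -
    define F where "F = {U. open U \<and> U \<noteq> {} \<and> (\<exists>c. \<forall>x\<in>U. N x c < (1/2)^n)}"
    have "\<exists>U\<in>F. x0 \<in> U" for x0
    proof -
      have "eventually (\<lambda>x'. N x' x0 < (1/2)^n) (at x0)"
        using cont[of x0] by (rule order_tendstoD) auto
      then obtain U where U: "open U" "x0 \<in> U" "\<forall>x'\<in>U. x' \<noteq> x0 \<longrightarrow> N x' x0 < (1/2)^n"
        by (auto simp: eventually_at_topological)
      moreover have "N x0 x0 < (1/2)^n" by (simp add: N_def)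
      ultimately have "\<forall>x'\<in>U. N x' x0 < (1/2)^n" by metis
      with U show ?thesis by (auto simp: F_def)
    qed
    then have UF: "\<Union>F = UNIV" by blast
    obtain F' where F': "F' \<subseteq> F" "countable F'" "\<Union>F' = \<Union>F"
      using Lindelof[of F] by (auto simp: F_def)
    then have ne: "F' \<noteq> {}" using UF by auto
    define V where "V = from_nat_into F'"
    have V: "V i \<in> F" for i using from_nat_into[OF ne, of i] F'(1) by (auto simp: V_def)
    moreover have "(\<Union>i. V i) = UNIV" using F' UF ne by (simp add: V_def range_from_nat_into)
    moreover have "\<exists>c. \<forall>i. \<forall>x\<in>V i. N x (c i) < (1/2)^n"
      using V by (intro choice) (auto simp: F_def)
    ultimately show ?thesis by (auto simp: F_def)
  qed
  then obtain V c where V: "\<And>n i::nat. open (V n i)" "\<And>n. (\<Union>i. V n i) = UNIV"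
      "\<And>n i x. x \<in> V n i \<Longrightarrow> N x (c n i) < (1/2)^n"
    by metis
  define idx where "idx = (\<lambda>n x. LEAST i. x \<in> V n i)"
  have idx: "x \<in> V n (idx n x)" for n x
    unfolding idx_def by (rule LeastI_ex) (use V(2)[of n] in auto)
  have [measurable]: "V n i \<in> sets M" for n i using V(1) sets by auto
  have idx_m [measurable]: "idx n \<in> measurable M (count_space UNIV)" for n
    unfolding idx_def by measurable
  define kn where "kn = (\<lambda>n x w. \<kappa> (c n (idx n x)) w)"
  have [measurable]: "case_prod (kn n) \<in> borel_measurable (M \<Otimes>\<^sub>M M)" for n
  proof -
    have "(\<lambda>p. \<kappa> (c n (idx n (fst p))) (snd p)) \<in> borel_measurable (M \<Otimes>\<^sub>M M)"
      by (rule measurable_compose_countable[where g = "\<lambda>p. idx n (fst p)"]) measurable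
    then show ?thesis by (simp add: kn_def split_beta')
  qed
  define k where "k = (\<lambda>x w. lim (\<lambda>n. kn n x w))"
  have "case_prod k \<in> borel_measurable (M \<Otimes>\<^sub>M M)"
  proof -
    have "(\<lambda>p. lim (\<lambda>n. case_prod (kn n) p)) \<in> borel_measurable (M \<Otimes>\<^sub>M M)"
      by (rule borel_measurable_lim_metric) measurable
    then show ?thesis by (simp add: k_def split_beta')
  qed
  moreover have "AE w in M. k x w = \<kappa> x w" for x
  proof -
    define e where "e = (\<lambda>n w. cmod (\<kappa> x w - kn n x w))"
    have [measurable]: "e n \<in> borel_measurable M" for n unfolding e_def kn_def by measurable
    have "(\<integral>\<^sup>+w. ennreal (e n w) \<partial>M) \<le> ennreal ((1/2)^n)" for n
    proof -
      have "(\<integral>\<^sup>+w. ennreal (e n w) \<partial>M) = ennreal (N x (c n (idx n x)))"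
        unfolding e_def kn_def N_def using int by (intro nn_integral_eq_integral) auto
      then show ?thesis using V(3)[OF idx[of x n]] by (simp add: ennreal_leI)
    qed
    then have "(\<Sum>n. \<integral>\<^sup>+w. ennreal (e n w) \<partial>M) \<le> (\<Sum>n. ennreal ((1/2)^n))"
      by (intro suminf_le) auto
    also have "\<dots> < \<infinity>"
      by (subst suminf_ennreal2) (auto intro!: summable_geometric)
    finally have "(\<integral>\<^sup>+w. (\<Sum>n. ennreal (e n w)) \<partial>M) < \<infinity>"
      by (subst nn_integral_suminf) auto
    then have "AE w in M. (\<Sum>n. ennreal (e n w)) \<noteq> \<infinity>"
      by (intro nn_integral_PInf_AE) auto
    then show ?thesis
    proof eventually_elim
      case (elim w)
      then have "summable (\<lambda>n. e n w)"
        by (intro summable_suminf_not_top) (auto simp: e_def)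
      then have "(\<lambda>n. e n w) \<longlonglongrightarrow> 0" by (rule summable_LIMSEQ_zero)
      then have "(\<lambda>n. kn n x w) \<longlonglongrightarrow> \<kappa> x w"
        by (subst LIM_zero_iff[symmetric], subst tendsto_norm_zero_iff[symmetric])
          (simp add: e_def norm_minus_commute)
      then show ?case by (simp add: k_def limI)
    qed
  qed
  ultimately show ?thesis by (auto simp: measurable_version_def)
qed

section \<open>The Wick kernel\<close>

text \<open>
  The kernel is replaced once and for all by a jointly measurable version \<open>k\<close>. The
  function \<open>s\<close> stands for the lattice supremum of the family of the \<open>\<bar>k z\<bar>\<close>; any integrable
  majorant serves.
\<close>

locale wick_kernel_data = unimodular_haar M
  for M :: "'g::{topological_group_add, t2_space, second_countable_topology} measure" +
  fixes a :: "'g \<Rightarrow> complex" and k :: "'g \<Rightarrow> 'g \<Rightarrow> complex" and s :: "'g \<Rightarrow> real" and A :: real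
  assumes a_bound: "\<And>x. cmod (a x) \<le> A"
    and a_L2: "a \<in> L2 M"
    and a_norm: "L2_norm M a = 1"
    and k_meas [measurable]: "case_prod k \<in> borel_measurable (M \<Otimes>\<^sub>M M)"
    and k_Cb: "k \<in> Cb_L1 M"
    and s_int: "integrable M s"
    and s_nonneg: "\<And>w. 0 \<le> s w"
    and k_le_s: "\<And>z. AE w in M. cmod (k z w) \<le> s w"
begin

abbreviation K :: "'g \<Rightarrow> 'g \<Rightarrow> complex" where "K \<equiv> wick_kernel M a k"

lemma a_meas [measurable]: "a \<in> borel_measurable M"
  using a_L2 by (simp add: L2_def)

lemma s_meas [measurable]: "s \<in> borel_measurable M"
  using s_int by simp

lemma k_meas2 [measurable (raw)]:
  assumes "f \<in> measurable N M" "g \<in> measurable N M"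
  shows "(\<lambda>p. k (f p) (g p)) \<in> borel_measurable N"
  using measurable_compose[OF measurable_Pair[OF assms] k_meas] by simp

lemma k_int: "integrable M (k x)"
  using k_Cb by (simp add: Cb_L1_def)

lemma nn_integral_s: "(\<integral>\<^sup>+w. ennreal (s w) \<partial>M) < \<infinity>"
  using s_int s_nonneg by (simp add: integrable_iff_bounded)

lemma nn_integral_a: "(\<integral>\<^sup>+x. ennreal ((cmod (a x))\<^sup>2) \<partial>M) = 1"
proof -
  have "(\<integral>\<^sup>+x. ennreal ((cmod (a x))\<^sup>2) \<partial>M) = ennreal (\<integral>x. (cmod (a x))\<^sup>2 \<partial>M)"
    using a_L2 by (intro nn_integral_eq_integral) (auto simp: L2_def)
  also have "(\<integral>x. (cmod (a x))\<^sup>2 \<partial>M) = 1"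
    using a_norm by (simp add: L2_norm_def)
  finally show ?thesis by simp
qed

text \<open>
  The Cauchy-Schwarz inequality: \<open>a\<close> and its right translates are unit vectors. This is the
  estimate behind every bound on the Wick kernel.
\<close>

lemma nn_integral_aa: "(\<integral>\<^sup>+z. ennreal (cmod (a (z - w)) * cmod (a z)) \<partial>M) \<le> 1"
proof -
  have "(\<integral>\<^sup>+z. ennreal (cmod (a (z - w)) * cmod (a z)) \<partial>M)\<^sup>2 \<le>
    (\<integral>\<^sup>+z. ennreal ((cmod (a (z - w)))\<^sup>2) \<partial>M) * (\<integral>\<^sup>+z. ennreal ((cmod (a z))\<^sup>2) \<partial>M)"
    by (rule nn_integral_cmod_Cauchy_Schwarz) measurable
  also have "(\<integral>\<^sup>+z. ennreal ((cmod (a (z - w)))\<^sup>2) \<partial>M) = (\<integral>\<^sup>+z. ennreal ((cmod (a z))\<^sup>2) \<partial>M)"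
    by (rule nn_integral_preserving[OF preserving_diff_const, of "\<lambda>z. ennreal ((cmod (a z))\<^sup>2)"]) measurable
  finally have "(\<integral>\<^sup>+z. ennreal (cmod (a (z - w)) * cmod (a z)) \<partial>M)\<^sup>2 \<le> 1"
    by (simp add: nn_integral_a)
  then show ?thesis
    by (metis linorder_not_le one_less_power pos2)
qed

lemma nn_integral_aa_shift:
  "(\<integral>\<^sup>+z. ennreal (cmod (a (- z + x - w)) * cmod (a (- z + x))) \<partial>M) \<le> 1"
  using nn_integral_aa[of w]
    nn_integral_preserving[OF preserving_reflect_right, of "\<lambda>z. ennreal (cmod (a (z - w)) * cmod (a z))" x]
  by simp

text \<open>
  The majorant bounds \<open>k z\<close> outside a null set that depends on \<open>z\<close>. The Wick kernel is an
  integral over \<open>z\<close> for fixed \<open>w\<close>, so the two quantifiers have to be exchanged, which joint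
  measurability of \<open>k\<close> makes possible.
\<close>

lemma AE_AE_k_le_s: "AE w in M. AE z in M. cmod (k z w) \<le> s w"
proof -
  have "(AE z in M. AE w in M. cmod (k z w) \<le> s w) \<longleftrightarrow> (AE w in M. AE z in M. cmod (k z w) \<le> s w)"
    by (rule MM.AE_commute) measurable
  then show ?thesis using k_le_s by simp
qed

text \<open>
  The exceptional null set is the one of the preceding lemma; it does not depend on \<open>x\<close>,
  because \<open>nn_integral_aa_shift\<close> holds for all \<open>x\<close> and \<open>w\<close>.
\<close>

lemma nn_integral_integrand:
  "AE w in M. \<forall>x. (\<integral>\<^sup>+z. ennreal (cmod (a (- z + x - w) * cnj (a (- z + x)) * k z w)) \<partial>M) \<le> ennreal (s w)"
  using AE_AE_k_le_s
proof eventually_elim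
  case (elim w)
  show ?case
  proof
    fix x
    have "(\<integral>\<^sup>+z. ennreal (cmod (a (- z + x - w) * cnj (a (- z + x)) * k z w)) \<partial>M) \<le>
       (\<integral>\<^sup>+z. ennreal (cmod (a (- z + x - w)) * cmod (a (- z + x))) * ennreal (s w) \<partial>M)"
      using elim by (intro nn_integral_mono_AE, eventually_elim)
        (auto simp: norm_mult ennreal_mult[symmetric] s_nonneg intro!: ennreal_leI mult_left_mono)
    also have "\<dots> = (\<integral>\<^sup>+z. ennreal (cmod (a (- z + x - w)) * cmod (a (- z + x))) \<partial>M) * ennreal (s w)"
      by (rule nn_integral_multc) measurable
    also have "\<dots> \<le> 1 * ennreal (s w)"
      by (rule mult_right_mono[OF nn_integral_aa_shift]) simp
    finally show "(\<integral>\<^sup>+z. ennreal (cmod (a (- z + x - w) * cnj (a (- z + x)) * k z w)) \<partial>M) \<le> ennreal (s w)"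
      by simp
  qed
qed

lemma integrable_integrand:
  "AE w in M. \<forall>x. integrable M (\<lambda>z. a (- z + x - w) * cnj (a (- z + x)) * k z w)"
  using nn_integral_integrand
proof eventually_elim
  case (elim w)
  show ?case
  proof
    fix x
    have "(\<integral>\<^sup>+z. ennreal (cmod (a (- z + x - w) * cnj (a (- z + x)) * k z w)) \<partial>M) < \<infinity>"
      using elim order_le_less_trans[OF _ ennreal_less_top] by auto
    then show "integrable M (\<lambda>z. a (- z + x - w) * cnj (a (- z + x)) * k z w)"
      by (intro integrableI_bounded) auto
  qed
qed

lemma K_le_s: "AE w in M. \<forall>x. cmod (K x w) \<le> s w"
  using nn_integral_integrand integrable_integrand
proof eventually_elim
  case (elim w)
  show ?case
  proof
    fix x
    have "ennreal (cmod (K x w)) \<le> ennreal (s w)"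
      unfolding wick_kernel_def
      by (rule order_trans[OF integral_norm_bound_ennreal]) (use elim in auto)
    then show "cmod (K x w) \<le> s w" by (simp add: s_nonneg)
  qed
qed

lemma K_meas: "case_prod K \<in> borel_measurable (M \<Otimes>\<^sub>M M)"
  unfolding wick_kernel_def split_beta' by measurable

lemma K_meas2 [measurable (raw)]:
  assumes "f \<in> measurable N M" "g \<in> measurable N M"
  shows "(\<lambda>p. K (f p) (g p)) \<in> borel_measurable N"
  using measurable_compose[OF measurable_Pair[OF assms] K_meas] by simp

lemma K_int: "integrable M (K x)"
  by (rule Bochner_Integration.integrable_bound[OF s_int])
    (use K_le_s s_nonneg in \<open>auto elim!: eventually_mono\<close>)

text \<open>
  In this form \<open>x\<close> occurs only in the first argument of \<open>k\<close>, so that continuity of \<open>k\<close> as a map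
  into \<open>L\<^sup>1\<close> can be used.
\<close>

lemma K_substituted: "K x w = (\<integral>z. a (z - w) * cnj (a z) * k (x - z) w \<partial>M)"
proof -
  have "K x w = (\<integral>z. a (- z + x - w) * cnj (a (- z + x)) * k (x - (- z + x)) w \<partial>M)"
    by (simp add: wick_kernel_def diff_conv_add_uminus minus_add add.assoc[symmetric] del: add_uminus_conv_diff)
  also have "\<dots> = (\<integral>z. a (z - w) * cnj (a z) * k (x - z) w \<partial>M)"
    by (rule integral_preserving[OF preserving_reflect_right, of "\<lambda>z. a (z - w) * cnj (a z) * k (x - z) w"]) measurable
  finally show ?thesis .
qed

lemma integrable_substituted:
  "AE w in M. \<forall>x. integrable M (\<lambda>z. a (z - w) * cnj (a z) * k (x - z) w)"
  using integrable_integrand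
proof eventually_elim
  case (elim w)
  show ?case
  proof
    fix x
    have "integrable M (\<lambda>z. a (- z + x - w) * cnj (a (- z + x)) * k (x - (- z + x)) w)"
      using elim by (simp add: diff_conv_add_uminus minus_add add.assoc[symmetric] del: add_uminus_conv_diff)
    then show "integrable M (\<lambda>z. a (z - w) * cnj (a z) * k (x - z) w)"
      by (subst (asm) integrable_preserving[OF preserving_reflect_right, of "\<lambda>z. a (z - w) * cnj (a z) * k (x - z) w"]) measurable
  qed
qed

lemma k_dist_nn:
  "(\<integral>\<^sup>+w. ennreal (cmod (k x w - k y w)) \<partial>M) = ennreal (\<integral>w. cmod (k x w - k y w) \<partial>M)"
  using k_int by (intro nn_integral_eq_integral) auto

text \<open>
  By the substituted formula the distance of \<open>K x\<close> and \<open>K x0\<close> is at most the integral over \<open>z\<close>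
  of \<open>\<Phi> x z\<close>, which tends to \<open>0\<close> for each \<open>z\<close> by continuity of \<open>k\<close> at \<open>x0 - z\<close>
  and boundedness of \<open>a\<close>. Dominated convergence applies with the majorant \<open>W\<close>, whose integral is
  at most twice that of \<open>s\<close>.
\<close>

lemma K_L1_continuous: "((\<lambda>x. \<integral>w. cmod (K x w - K x0 w) \<partial>M) \<longlongrightarrow> 0) (at x0)"
proof (rule iffD2[OF tendsto_at_iff_sequentially], intro allI impI)
  fix X :: "nat \<Rightarrow> 'g" assume X0: "\<forall>i. X i \<in> UNIV - {x0}" and X: "X \<longlonglongrightarrow> x0"
  define \<Phi> where "\<Phi> = (\<lambda>x z. \<integral>\<^sup>+w. ennreal (cmod (a (z - w)) * cmod (a z) * cmod (k (x - z) w - k (x0 - z) w)) \<partial>M)"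
  have [measurable]: "\<Phi> x \<in> borel_measurable M" for x unfolding \<Phi>_def by measurable
  have bound: "(\<integral>\<^sup>+w. ennreal (cmod (K x w - K x0 w)) \<partial>M) \<le> (\<integral>\<^sup>+z. \<Phi> x z \<partial>M)" for x
  proof -
    have "AE w in M. ennreal (cmod (K x w - K x0 w)) \<le>
      (\<integral>\<^sup>+z. ennreal (cmod (a (z - w)) * cmod (a z) * cmod (k (x - z) w - k (x0 - z) w)) \<partial>M)"
      using integrable_substituted
    proof eventually_elim
      case (elim w)
      have *: "K x w - K x0 w = (\<integral>z. a (z - w) * cnj (a z) * (k (x - z) w - k (x0 - z) w) \<partial>M)"
        unfolding K_substituted right_diff_distrib
        using elim by (subst Bochner_Integration.integral_diff) auto
      have "ennreal (cmod (K x w - K x0 w)) \<le>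
        (\<integral>\<^sup>+z. ennreal (cmod (a (z - w) * cnj (a z) * (k (x - z) w - k (x0 - z) w))) \<partial>M)"
        unfolding * using elim
        by (intro integral_norm_bound_ennreal) (simp only: right_diff_distrib Bochner_Integration.integrable_diff)
      then show ?case
        by (simp add: norm_mult)
    qed
    then have "(\<integral>\<^sup>+w. ennreal (cmod (K x w - K x0 w)) \<partial>M) \<le>
      (\<integral>\<^sup>+w. \<integral>\<^sup>+z. ennreal (cmod (a (z - w)) * cmod (a z) * cmod (k (x - z) w - k (x0 - z) w)) \<partial>M \<partial>M)"
      by (rule nn_integral_mono_AE)
    also have "\<dots> = (\<integral>\<^sup>+z. \<Phi> x z \<partial>M)"
      unfolding \<Phi>_def by (rule MM.Fubini') measurable
    finally show ?thesis .
  qed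
  define W where "W = (\<lambda>z. \<integral>\<^sup>+w. ennreal (cmod (a (z - w)) * cmod (a z) * (2 * s w)) \<partial>M)"
  have [measurable]: "W \<in> borel_measurable M" unfolding W_def by measurable
  have "(\<lambda>n. \<integral>\<^sup>+z. \<Phi> (X n) z \<partial>M) \<longlonglongrightarrow> (\<integral>\<^sup>+z. 0 \<partial>M)"
  proof (rule nn_integral_dominated_convergence[where w = W])
    show "AE z in M. \<Phi> (X n) z \<le> W z" for n
    proof (rule AE_I2)
      fix z
      show "\<Phi> (X n) z \<le> W z"
        unfolding \<Phi>_def W_def
      proof (rule nn_integral_mono_AE)
        show "AE w in M. ennreal (cmod (a (z - w)) * cmod (a z) * cmod (k (X n - z) w - k (x0 - z) w)) \<le>
          ennreal (cmod (a (z - w)) * cmod (a z) * (2 * s w))"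
          using k_le_s[of "X n - z"] k_le_s[of "x0 - z"]
        proof eventually_elim
          case (elim w)
          then have "cmod (k (X n - z) w - k (x0 - z) w) \<le> 2 * s w"
            using norm_triangle_ineq4[of "k (X n - z) w" "k (x0 - z) w"] by linarith
          then show ?case by (intro ennreal_leI mult_left_mono) auto
        qed
      qed
    qed
    have "(\<integral>\<^sup>+z. W z \<partial>M) = (\<integral>\<^sup>+w. \<integral>\<^sup>+z. ennreal (cmod (a (z - w)) * cmod (a z) * (2 * s w)) \<partial>M \<partial>M)"
      unfolding W_def by (rule MM.Fubini') measurable
    also have "\<dots> = (\<integral>\<^sup>+w. (\<integral>\<^sup>+z. ennreal (cmod (a (z - w)) * cmod (a z)) \<partial>M) * ennreal (2 * s w) \<partial>M)"
      using s_nonneg by (intro nn_integral_cong, subst nn_integral_multc[symmetric]) (auto simp: ennreal_mult)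
    also have "\<dots> \<le> (\<integral>\<^sup>+w. 1 * ennreal (2 * s w) \<partial>M)"
      by (intro nn_integral_mono mult_right_mono nn_integral_aa) auto
    also have "\<dots> = 2 * (\<integral>\<^sup>+w. ennreal (s w) \<partial>M)"
      using s_nonneg by (subst nn_integral_cmult[symmetric]) (auto simp: ennreal_mult)
    also have "\<dots> < \<infinity>" using nn_integral_s by (simp add: ennreal_mult_less_top)
    finally show "(\<integral>\<^sup>+z. W z \<partial>M) < \<infinity>" .
    show "AE z in M. (\<lambda>n. \<Phi> (X n) z) \<longlonglongrightarrow> 0"
    proof (rule AE_I2)
      fix z
      define e where "e = (\<lambda>n. \<integral>w. cmod (k (X n - z) w - k (x0 - z) w) \<partial>M)"
      have "e \<longlonglongrightarrow> 0"
      proof -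
        have "((\<lambda>x. \<integral>w. cmod (k x w - k (x0 - z) w) \<partial>M) \<longlongrightarrow> 0) (at (x0 - z))"
          using k_Cb by (simp add: Cb_L1_def)
        moreover have "(\<lambda>n. X n - z) \<longlonglongrightarrow> x0 - z"
          using X unfolding diff_conv_add_uminus by (intro tendsto_intros)
        moreover have "X n - z \<noteq> x0 - z" for n
        proof
          assume "X n - z = x0 - z"
          then have "X n - z + z = x0 - z + z" by (rule arg_cong)
          then show False using X0 by simp
        qed
        ultimately show ?thesis
          unfolding tendsto_at_iff_sequentially e_def comp_def by auto
      qed
      have "\<Phi> (X n) z \<le> ennreal (A * A) * ennreal (e n)" for n
      proof -
        have "\<Phi> (X n) z \<le> (\<integral>\<^sup>+w. ennreal (A * A) * ennreal (cmod (k (X n - z) w - k (x0 - z) w)) \<partial>M)"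
          unfolding \<Phi>_def
        proof (rule nn_integral_mono)
          fix w
          have "A \<ge> 0" using a_bound[of 0] norm_ge_zero order_trans by blast
          then show "ennreal (cmod (a (z - w)) * cmod (a z) * cmod (k (X n - z) w - k (x0 - z) w)) \<le>
             ennreal (A * A) * ennreal (cmod (k (X n - z) w - k (x0 - z) w))"
            by (auto simp: ennreal_mult[symmetric] intro!: ennreal_leI mult_right_mono mult_mono a_bound)
        qed
        also have "\<dots> = ennreal (A * A) * ennreal (e n)"
          by (simp add: nn_integral_cmult k_dist_nn e_def)
        finally show ?thesis .
      qed
      moreover have "(\<lambda>n. ennreal (A * A) * ennreal (e n)) \<longlonglongrightarrow> ennreal (A * A) * ennreal 0"
        using \<open>e \<longlonglongrightarrow> 0\<close> by (intro ennreal_tendsto_cmult tendsto_ennrealI) auto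
      ultimately show "(\<lambda>n. \<Phi> (X n) z) \<longlonglongrightarrow> 0"
        by - (rule tendsto_0_le_ennreal[where g = "\<lambda>n. ennreal (A * A) * ennreal (e n)"], simp_all)
    qed
  qed measurable
  then have "(\<lambda>n. \<integral>\<^sup>+z. \<Phi> (X n) z \<partial>M) \<longlonglongrightarrow> 0" by simp
  then have "(\<lambda>n. \<integral>\<^sup>+w. ennreal (cmod (K (X n) w - K x0 w)) \<partial>M) \<longlonglongrightarrow> 0"
    using bound by - (rule tendsto_0_le_ennreal[where g = "\<lambda>n. \<integral>\<^sup>+z. \<Phi> (X n) z \<partial>M"], simp_all)
  moreover have "(\<integral>\<^sup>+w. ennreal (cmod (K (X n) w - K x0 w)) \<partial>M) = ennreal (\<integral>w. cmod (K (X n) w - K x0 w) \<partial>M)" for n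
    using K_int by (intro nn_integral_eq_integral) auto
  ultimately have "(\<lambda>n. ennreal (\<integral>w. cmod (K (X n) w - K x0 w) \<partial>M)) \<longlonglongrightarrow> ennreal 0"
    by simp
  then have "(\<lambda>n. \<integral>w. cmod (K (X n) w - K x0 w) \<partial>M) \<longlonglongrightarrow> 0"
    by (subst (asm) tendsto_ennreal_iff) auto
  then show "((\<lambda>x. \<integral>w. cmod (K x w - K x0 w) \<partial>M) \<circ> X) \<longlonglongrightarrow> 0"
    by (simp add: comp_def)
qed

lemma K_Cb_L1: "K \<in> Cb_L1 M"
  by (rule Cb_L1I[OF K_int K_L1_continuous s_int])
    (use K_le_s in \<open>auto elim!: eventually_mono\<close>)

text \<open>
  Write the difference of the values at \<open>X n\<close> and \<open>x0\<close> as a term with \<open>K (X n) - K x0\<close>,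
  controlled by continuity of \<open>K\<close> in \<open>L\<^sup>1\<close>, and a term with \<open>f\<close> translated, controlled by
  dominated convergence.
\<close>

lemma conv_K_continuous:
  assumes f: "continuous_on UNIV f" and B: "\<And>x. cmod (f x) \<le> B"
  shows "continuous_on UNIV (\<lambda>x. group_conv M f (K x) x)"
proof -
  have [measurable]: "f \<in> borel_measurable M"
    using borel_measurable_continuous_onI[OF f] by (simp add: borel_measurable_M)
  have "((\<lambda>x. \<integral>w. f (x - w) * K x w \<partial>M) \<longlongrightarrow> (\<integral>w. f (x0 - w) * K x0 w \<partial>M)) (at x0)" for x0
  proof (rule iffD2[OF tendsto_at_iff_sequentially], intro allI impI)
    fix X :: "nat \<Rightarrow> 'g" assume X0: "\<forall>i. X i \<in> UNIV - {x0}" and X: "X \<longlonglongrightarrow> x0"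
    have int: "integrable M (\<lambda>w. f (x - w) * K y w)" for x y
      by (rule Bochner_Integration.integrable_bound[OF integrable_mult_right[OF K_int[of y], of "complex_of_real B"]])
        (auto simp: norm_mult intro!: AE_I2 mult_right_mono order_trans[OF B abs_ge_self])
    (* the kernel is fixed at x0 and only the translate of f moves *)
    have 1: "(\<lambda>n. \<integral>w. f (X n - w) * K x0 w \<partial>M) \<longlonglongrightarrow> (\<integral>w. f (x0 - w) * K x0 w \<partial>M)"
    proof (rule integral_dominated_convergence[where w = "\<lambda>w. B * cmod (K x0 w)"])
      show "AE w in M. (\<lambda>n. f (X n - w) * K x0 w) \<longlonglongrightarrow> f (x0 - w) * K x0 w"
      proof (rule AE_I2)
        fix w
        have "(\<lambda>n. X n - w) \<longlonglongrightarrow> x0 - w"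
          using X unfolding diff_conv_add_uminus by (intro tendsto_intros)
        then have "(\<lambda>n. f (X n - w)) \<longlonglongrightarrow> f (x0 - w)"
          using f by (intro continuous_on_tendsto_compose[OF f]) auto
        then show "(\<lambda>n. f (X n - w) * K x0 w) \<longlonglongrightarrow> f (x0 - w) * K x0 w"
          by (intro tendsto_intros)
      qed
    qed (use K_int B in \<open>auto simp: norm_mult intro!: mult_right_mono\<close>)
    (* the change of the kernel, bounded by the supremum of f *)
    have 2: "(\<lambda>n. \<integral>w. f (X n - w) * (K (X n) w - K x0 w) \<partial>M) \<longlonglongrightarrow> 0"
    proof (rule Lim_null_comparison[where g = "\<lambda>n. B * (\<integral>w. cmod (K (X n) w - K x0 w) \<partial>M)"])
      show "\<forall>\<^sub>F n in sequentially. norm (\<integral>w. f (X n - w) * (K (X n) w - K x0 w) \<partial>M) \<le> B * (\<integral>w. cmod (K (X n) w - K x0 w) \<partial>M)"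
      proof (rule always_eventually, rule allI)
        fix n
        have "norm (\<integral>w. f (X n - w) * (K (X n) w - K x0 w) \<partial>M) \<le> (\<integral>w. B * cmod (K (X n) w - K x0 w) \<partial>M)"
        proof (rule order_trans[OF integral_norm_bound integral_mono])
          show "integrable M (\<lambda>w. cmod (f (X n - w) * (K (X n) w - K x0 w)))"
            using int by (simp add: right_diff_distrib)
          show "cmod (f (X n - w) * (K (X n) w - K x0 w)) \<le> B * cmod (K (X n) w - K x0 w)" for w
            unfolding norm_mult using B by (rule mult_right_mono) simp
        qed (use K_int in auto)
        then show "norm (\<integral>w. f (X n - w) * (K (X n) w - K x0 w) \<partial>M) \<le> B * (\<integral>w. cmod (K (X n) w - K x0 w) \<partial>M)"
          by simp
      qed
      have "(\<lambda>n. \<integral>w. cmod (K (X n) w - K x0 w) \<partial>M) \<longlonglongrightarrow> 0"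
        using K_L1_continuous[of x0] X X0 unfolding tendsto_at_iff_sequentially comp_def by auto
      then show "(\<lambda>n. B * (\<integral>w. cmod (K (X n) w - K x0 w) \<partial>M)) \<longlonglongrightarrow> 0"
        by (rule tendsto_mult_right_zero)
    qed
    have "(\<integral>w. f (X n - w) * K (X n) w \<partial>M) =
      (\<integral>w. f (X n - w) * (K (X n) w - K x0 w) \<partial>M) + (\<integral>w. f (X n - w) * K x0 w \<partial>M)" for n
      using int by (simp add: right_diff_distrib)
    then show "((\<lambda>x. \<integral>w. f (x - w) * K x w \<partial>M) \<circ> X) \<longlonglongrightarrow> (\<integral>w. f (x0 - w) * K x0 w \<partial>M)"
      using tendsto_add[OF 2 1] by (simp add: comp_def)
  qed
  then show ?thesis
    by (simp add: continuous_on_def group_conv_diff)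
qed

end

lemma Cc_bounded:
  assumes "f \<in> Cc" obtains B where "\<And>x. cmod (f x) \<le> B"
proof -
  let ?S = "closure {x. f x \<noteq> 0}"
  have "compact (f ` ?S)"
    using assms by (intro compact_continuous_image) (auto simp: Cc_def intro: continuous_on_subset)
  then have "\<exists>B. \<forall>y\<in>f ` ?S. cmod y \<le> B"
    by (simp only: bounded_iff[symmetric] compact_imp_bounded)
  then obtain B where B: "\<forall>y\<in>f ` ?S. cmod y \<le> B" ..
  have "cmod (f x) \<le> max B 0" for x
  proof (cases "f x = 0")
    case False
    then have "x \<in> ?S" using closure_subset by fast
    then show ?thesis using B by auto
  qed auto
  then show ?thesis using that by blast
qed

lemma (in unimodular_haar) Cc_L2:
  assumes "f \<in> Cc" shows "f \<in> L2 M"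
proof -
  obtain B where B: "\<And>x. cmod (f x) \<le> B" using Cc_bounded[OF assms] by blast
  have f: "continuous_on UNIV f" and c: "compact (closure {x. f x \<noteq> 0})"
    using assms by (auto simp: Cc_def)
  have m: "f \<in> borel_measurable M"
    using borel_measurable_continuous_onI[OF f] by (simp add: borel_measurable_M)
  have "(\<integral>\<^sup>+x. ennreal ((cmod (f x))\<^sup>2) \<partial>M) \<le> (\<integral>\<^sup>+x. ennreal (B\<^sup>2) * indicator (closure {x. f x \<noteq> 0}) x \<partial>M)"
  proof (rule nn_integral_mono)
    fix x
    have "(cmod (f x))\<^sup>2 \<le> B\<^sup>2" using B by (intro power_mono) auto
    moreover have "f x \<noteq> 0 \<Longrightarrow> x \<in> closure {x. f x \<noteq> 0}" using closure_subset by fast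
    ultimately show "ennreal ((cmod (f x))\<^sup>2) \<le> ennreal (B\<^sup>2) * indicator (closure {x. f x \<noteq> 0}) x"
      by (cases "f x = 0") (auto intro!: ennreal_leI)
  qed
  also have "\<dots> = ennreal (B\<^sup>2) * emeasure M (closure {x. f x \<noteq> 0})"
    by (rule nn_integral_cmult_indicator) simp
  also have "\<dots> < \<infinity>" using finite_compact[OF c] by (simp add: ennreal_mult_less_top)
  finally show ?thesis by (rule L2I[OF m])
qed

section \<open>Hilbert spaces of sequences and unitary representations\<close>

lemma hilbD: "v \<in> hilb d \<Longrightarrow> summable (\<lambda>n. (cmod (v n))\<^sup>2)" "v \<in> hilb d \<Longrightarrow> d \<le> enat n \<Longrightarrow> v n = 0"
  by (auto simp: hilb_def)

lemma hilb_lincomb: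
  assumes "u \<in> hilb d" "v \<in> hilb d"
  shows "(\<lambda>n. a * u n + b * v n) \<in> hilb d"
proof -
  have s: "summable (\<lambda>n. 2 * (cmod a)\<^sup>2 * (cmod (u n))\<^sup>2 + 2 * (cmod b)\<^sup>2 * (cmod (v n))\<^sup>2)"
    using assms by (intro summable_add summable_mult hilbD)
  have "summable (\<lambda>n. (cmod (a * u n + b * v n))\<^sup>2)"
    by (rule summable_comparison_test'[OF s, of 0])
      (use norm_add_sq_le[of "a * u _" "b * v _"] in \<open>simp add: norm_mult power_mult_distrib mult.assoc\<close>)
  then show ?thesis using assms by (auto simp: hilb_def)
qed

lemma hilb_diff:
  assumes "u \<in> hilb d" "v \<in> hilb d"
  shows "(\<lambda>n. u n - v n) \<in> hilb d"
  using hilb_lincomb[OF assms, of 1 "-1"] by simp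

lemma zero_hilb: "(\<lambda>_. 0) \<in> hilb d"
  by (simp add: hilb_def)

lemma ebasis_hilb: "enat j < d \<Longrightarrow> ebasis j \<in> hilb d"
proof -
  assume "enat j < d"
  moreover have "summable (\<lambda>n. (cmod (ebasis j n))\<^sup>2)"
    by (rule summable_finite[of "{j}"]) (auto simp: ebasis_def)
  ultimately show ?thesis by (auto simp: hilb_def ebasis_def)
qed

lemma ip_ebasis: "ip u (ebasis n) = u n"
proof -
  have "(\<Sum>m. u m * cnj (ebasis n m)) = (\<Sum>m\<in>{n}. u m * cnj (ebasis n m))"
    by (rule suminf_finite) (auto simp: ebasis_def)
  then show ?thesis by (simp add: ip_def ebasis_def)
qed

lemma vnorm_nonneg: "v \<in> hilb d \<Longrightarrow> 0 \<le> vnorm v"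
  unfolding vnorm_def by (auto intro!: suminf_nonneg hilbD)

lemma vnorm_sq: "v \<in> hilb d \<Longrightarrow> (vnorm v)\<^sup>2 = (\<Sum>n. (cmod (v n))\<^sup>2)"
  unfolding vnorm_def by (auto intro!: suminf_nonneg hilbD)

lemma sum_le_vnorm_sq: "v \<in> hilb d \<Longrightarrow> (\<Sum>n<N. (cmod (v n))\<^sup>2) \<le> (vnorm v)\<^sup>2"
  by (subst vnorm_sq) (auto intro!: sum_le_suminf hilbD)

lemma coord_le_vnorm:
  assumes "v \<in> hilb d" shows "cmod (v n) \<le> vnorm v"
proof -
  have "(\<Sum>m\<in>{n}. (cmod (v m))\<^sup>2) \<le> (vnorm v)\<^sup>2"
    unfolding vnorm_sq[OF assms] by (rule sum_le_suminf) (use assms hilbD in auto)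
  then show ?thesis by (auto intro: power2_le_imp_le simp: vnorm_nonneg[OF assms])
qed

lemma ip_partial_le:
  assumes "u \<in> hilb d" "v \<in> hilb d"
  shows "(\<Sum>n<N. cmod (u n * cnj (v n))) \<le> vnorm u * vnorm v"
proof -
  have "(\<Sum>n<N. cmod (u n) * cmod (v n))\<^sup>2 \<le> (\<Sum>n<N. (cmod (u n))\<^sup>2) * (\<Sum>n<N. (cmod (v n))\<^sup>2)"
    by (rule Cauchy_Schwarz_ineq_sum)
  also have "\<dots> \<le> (vnorm u)\<^sup>2 * (vnorm v)\<^sup>2"
    using assms by (intro mult_mono sum_le_vnorm_sq sum_nonneg) auto
  finally have "(\<Sum>n<N. cmod (u n) * cmod (v n))\<^sup>2 \<le> (vnorm u * vnorm v)\<^sup>2"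
    by (simp add: power_mult_distrib)
  then have "(\<Sum>n<N. cmod (u n) * cmod (v n)) \<le> vnorm u * vnorm v"
    by (rule power2_le_imp_le) (simp add: vnorm_nonneg[OF assms(1)] vnorm_nonneg[OF assms(2)])
  then show ?thesis by (simp add: norm_mult)
qed

lemma ip_abs_summable:
  assumes "u \<in> hilb d" "v \<in> hilb d"
  shows "summable (\<lambda>n. cmod (u n * cnj (v n)))" "(\<Sum>n. cmod (u n * cnj (v n))) \<le> vnorm u * vnorm v"
proof -
  show s: "summable (\<lambda>n. cmod (u n * cnj (v n)))"
    by (rule summableI_nonneg_bounded[OF _ ip_partial_le[OF assms]]) auto
  show "(\<Sum>n. cmod (u n * cnj (v n))) \<le> vnorm u * vnorm v"
    by (rule suminf_le_const[OF s ip_partial_le[OF assms]])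
qed

lemma ip_summable:
  assumes "u \<in> hilb d" "v \<in> hilb d"
  shows "summable (\<lambda>n. u n * cnj (v n))"
  using ip_abs_summable(1)[OF assms] by (rule summable_norm_cancel)

lemma ip_Cauchy_Schwarz:
  assumes "u \<in> hilb d" "v \<in> hilb d"
  shows "cmod (ip u v) \<le> vnorm u * vnorm v"
  unfolding ip_def using summable_norm[OF ip_abs_summable(1)[OF assms]] ip_abs_summable(2)[OF assms]
  by linarith

lemma ip_lincomb_left:
  assumes "u \<in> hilb d" "v \<in> hilb d" "w \<in> hilb d"
  shows "ip (\<lambda>n. a * u n + b * v n) w = a * ip u w + b * ip v w"
proof -
  have "(\<lambda>n. a * (u n * cnj (w n)) + b * (v n * cnj (w n))) sums (a * ip u w + b * ip v w)"
    unfolding ip_def by (intro sums_add sums_mult summable_sums ip_summable[of _ d] assms)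
  then show ?thesis unfolding ip_def by (simp add: sums_iff algebra_simps)
qed

lemma ip_commute:
  assumes "u \<in> hilb d" "v \<in> hilb d"
  shows "ip v u = cnj (ip u v)"
proof -
  have "(\<lambda>n. cnj (u n * cnj (v n))) sums cnj (ip u v)"
    unfolding ip_def by (subst sums_cnj) (intro summable_sums ip_summable[of _ d] assms)
  then show ?thesis unfolding ip_def by (simp add: sums_iff mult.commute)
qed

lemma ip_self: "u \<in> hilb d \<Longrightarrow> ip u u = of_real ((vnorm u)\<^sup>2)"
  unfolding ip_def by (simp add: vnorm_sq suminf_of_real[symmetric] hilbD complex_norm_square[symmetric] flip: of_real_power)

lemma ip_lincomb_self:
  assumes "u \<in> hilb d" "v \<in> hilb d"
  shows "ip (\<lambda>n. 1 * u n + c * v n) (\<lambda>n. 1 * u n + c * v n) =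
    ip u u + cnj c * ip u v + c * cnj (ip u v) + c * cnj c * ip v v"
proof -
  let ?w = "\<lambda>n. 1 * u n + c * v n"
  have w: "?w \<in> hilb d" using assms by (rule hilb_lincomb)
  have 1: "ip ?w ?w = 1 * ip u ?w + c * ip v ?w"
    using assms w by (intro ip_lincomb_left)
  have 2: "ip u ?w = cnj (1 * ip u u + c * ip v u)"
    by (subst ip_commute[OF w assms(1)], subst ip_lincomb_left) (use assms in auto)
  have 3: "ip v ?w = cnj (1 * ip u v + c * ip v v)"
    by (subst ip_commute[OF w assms(2)], subst ip_lincomb_left) (use assms in auto)
  show ?thesis
    unfolding 1 2 3 using ip_commute[OF assms] ip_commute[OF assms(1,1)] ip_commute[OF assms(2,2)]
    by (simp add: algebra_simps)
qed

text \<open>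
  Polarization: the cross terms of \<open>u + c v\<close> with \<open>c = 1\<close> and \<open>c = \<i>\<close> determine the real
  and the imaginary part of the inner product.
\<close>

lemma isometric_ip:
  assumes T: "isometric_op d e T" and u: "u \<in> hilb d" "v \<in> hilb d"
  shows "ip (T u) (T v) = ip u v"
proof -
  have Tm: "T w \<in> hilb e" if "w \<in> hilb d" for w
    using T that by (auto simp: isometric_op_def linear_op_def)
  have Tn: "ip (T w) (T w) = ip w w" if "w \<in> hilb d" for w
    using T that Tm[OF that] by (auto simp: ip_self[of _ d] ip_self[of _ e] isometric_op_def)
  have pol: "cnj c * ip (T u) (T v) + c * cnj (ip (T u) (T v)) = cnj c * ip u v + c * cnj (ip u v)" for c
  proof -
    have "T (\<lambda>n. 1 * u n + c * v n) = (\<lambda>n. 1 * T u n + c * T v n)"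
      using T u unfolding isometric_op_def linear_op_def by blast
    then show ?thesis
      using Tn[OF hilb_lincomb[OF u, of 1 c]] ip_lincomb_self[OF u, of c]
        ip_lincomb_self[OF Tm[OF u(1)] Tm[OF u(2)], of c] Tn[OF u(1)] Tn[OF u(2)]
      by simp
  qed
  show ?thesis
    using pol[of 1] pol[of \<i>] by (simp add: complex_eq_iff)
qed

lemma unitary_repD:
  assumes "unitary_rep (d, \<pi>)"
  shows "isometric_op d d (\<pi> x)" "\<pi> x ` hilb d = hilb d"
    and "u \<in> hilb d \<Longrightarrow> \<pi> x u \<in> hilb d"
    and "u \<in> hilb d \<Longrightarrow> \<pi> (x + y) u = \<pi> x (\<pi> y u)"
    and "u \<in> hilb d \<Longrightarrow> ((\<lambda>x. vnorm (\<lambda>n. \<pi> x u n - \<pi> x0 u n)) \<longlongrightarrow> 0) (at x0)"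
    and "u \<in> hilb d \<Longrightarrow> vnorm (\<pi> x u) = vnorm u"
  using assms by (auto simp: unitary_rep_def unitary_op_def isometric_op_def linear_op_def)

lemma unitary_rep_lincomb:
  assumes "unitary_rep (d, \<pi>)" "u \<in> hilb d" "v \<in> hilb d"
  shows "\<pi> x (\<lambda>n. a * u n + b * v n) = (\<lambda>n. a * \<pi> x u n + b * \<pi> x v n)"
  using assms unitary_repD(1)[OF assms(1), of x] by (auto simp: isometric_op_def linear_op_def)

lemma unitary_rep_zero:
  assumes "unitary_rep (d, \<pi>)" "u \<in> hilb d"
  shows "\<pi> 0 u = u"
proof -
  obtain v where "v \<in> hilb d" "u = \<pi> 0 v"
    using unitary_repD(2)[OF assms(1), of 0] assms(2) by blast
  then show ?thesis using unitary_repD(4)[OF assms(1), of v 0 0] by simp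
qed

lemma unitary_rep_ip_adjoint:
  assumes r: "unitary_rep (d, \<pi>)" and u: "u \<in> hilb d" "v \<in> hilb d"
  shows "ip u (\<pi> x v) = ip (\<pi> (- x) u) v"
proof -
  have "ip (\<pi> (- x) u) v = ip (\<pi> x (\<pi> (- x) u)) (\<pi> x v)"
    using r u by (intro isometric_ip[symmetric]) (auto intro: unitary_repD)
  also have "\<pi> x (\<pi> (- x) u) = u"
    using unitary_repD(4)[OF r u(1), of x "- x"] unitary_rep_zero[OF r u(1)] by simp
  finally show ?thesis ..
qed

text \<open>
  The adjoint in the definition of the Fourier transform is the operator of the inverse element.
  This turns coordinates of Fourier transforms into integrals of coordinates of the representation.
\<close>

lemma adjoint_op_unitary_rep:
  assumes r: "unitary_rep (d, \<pi>)" and u: "u \<in> hilb d"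
  shows "adjoint_op d (\<pi> x) u = \<pi> (- x) u"
proof
  fix n
  show "adjoint_op d (\<pi> x) u n = \<pi> (- x) u n"
  proof (cases "enat n < d")
    case True
    then show ?thesis
      using unitary_rep_ip_adjoint[OF r u ebasis_hilb[OF True]] by (simp add: adjoint_op_def ip_ebasis)
  next
    case False
    then show ?thesis
      using unitary_repD(3)[OF r u, of "- x"] by (auto simp: adjoint_op_def hilb_def)
  qed
qed

lemma unitary_rep_coord_continuous:
  assumes r: "unitary_rep (d, \<pi>)" and u: "u \<in> hilb d"
  shows "continuous_on UNIV (\<lambda>x. \<pi> x u n)"
proof -
  have "((\<lambda>x. \<pi> x u n) \<longlongrightarrow> \<pi> x0 u n) (at x0)" for x0
  proof -
    have "((\<lambda>x. \<pi> x u n - \<pi> x0 u n) \<longlongrightarrow> 0) (at x0)"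
      by (rule Lim_null_comparison[OF _ unitary_repD(5)[OF r u, of x0]])
        (auto intro!: always_eventually coord_le_vnorm[OF hilb_diff] unitary_repD(3)[OF r u])
    then show ?thesis by (simp add: LIM_zero_iff)
  qed
  then show ?thesis by (simp add: continuous_on_def)
qed

section \<open>The Fourier transform of integrable functions\<close>

context unimodular_haar
begin

lemma rep_coord_measurable:
  assumes "unitary_rep (d, \<pi>)" "u \<in> hilb d" "h \<in> measurable N M"
  shows "(\<lambda>p. \<pi> (h p) u n) \<in> borel_measurable N"
proof -
  have "(\<lambda>x. \<pi> x u n) \<in> borel_measurable M"
    using borel_measurable_continuous_onI[OF unitary_rep_coord_continuous[OF assms(1,2)]]
    by (simp add: borel_measurable_M)
  from measurable_compose[OF assms(3) this] show ?thesis .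
qed

lemma rep_coord_bound:
  assumes "unitary_rep (d, \<pi>)" "u \<in> hilb d"
  shows "cmod (\<pi> x u n) \<le> vnorm u"
  using coord_le_vnorm[OF unitary_repD(3)[OF assms], of x n] unitary_repD(6)[OF assms, of x] by simp

lemma fourier_unitary_rep:
  assumes "unitary_rep (d, \<pi>)" "u \<in> hilb d"
  shows "fourier M f (d, \<pi>) u = (\<lambda>n. \<integral>z. f z * \<pi> (- z) u n \<partial>M)"
  using adjoint_op_unitary_rep[OF assms] by (simp add: fourier_def)

lemma fourier_integrable:
  assumes f: "integrable M f" and r: "unitary_rep (d, \<pi>)" "u \<in> hilb d" and h [measurable]: "h \<in> measurable M M"
  shows "integrable M (\<lambda>z. f z * \<pi> (h z) u n)"
proof (rule Bochner_Integration.integrable_bound[OF integrable_mult_left[OF f, of "complex_of_real (vnorm u)"]])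
  have [measurable]: "f \<in> borel_measurable M" using f by simp
  have [measurable]: "(\<lambda>z. \<pi> (h z) u n) \<in> borel_measurable M"
    by (rule rep_coord_measurable[OF r]) measurable
  show "(\<lambda>z. f z * \<pi> (h z) u n) \<in> borel_measurable M" by measurable
  show "AE z in M. norm (f z * \<pi> (h z) u n) \<le> norm (f z * complex_of_real (vnorm u))"
    using rep_coord_bound[OF r] vnorm_nonneg[OF r(2)]
    by (auto simp: norm_mult intro!: mult_left_mono)
qed

text \<open>
  The Fourier transform is defined coordinatewise; this is the corresponding statement for an
  arbitrary vector \<open>v\<close>. Sum and integral may be exchanged because the partial sums of
  \<open>\<langle>\<pi>(- z) u, v\<rangle>\<close> are bounded by \<open>\<parallel>u\<parallel> \<parallel>v\<parallel>\<close> uniformly in \<open>z\<close>.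
\<close>

lemma fourier_weak:
  assumes f: "integrable M f" and r: "unitary_rep (d, \<pi>)" and u: "u \<in> hilb d" "v \<in> hilb d"
  shows "ip (fourier M f (d, \<pi>) u) v = (\<integral>z. f z * ip (\<pi> (- z) u) v \<partial>M)"
proof -
  let ?g = "\<lambda>n z. f z * \<pi> (- z) u n * cnj (v n)"
  have int: "integrable M (?g n)" for n
    by (intro integrable_mult_left fourier_integrable[OF f r u(1)]) measurable
  have sn: "(\<lambda>n. norm (?g n z)) = (\<lambda>n. cmod (f z) * cmod (\<pi> (- z) u n * cnj (v n)))" for z
    by (simp add: norm_mult mult.assoc)
  have ru: "\<pi> (- z) u \<in> hilb d" for z by (rule unitary_repD(3)[OF r u(1)])
  have "(\<integral>z. (\<Sum>n. ?g n z) \<partial>M) = (\<Sum>n. \<integral>z. ?g n z \<partial>M)"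
  proof (rule integral_suminf[OF int])
    show "AE z in M. summable (\<lambda>n. norm (?g n z))"
      unfolding sn by (intro AE_I2 summable_mult ip_abs_summable[OF ru u(2)])
    show "summable (\<lambda>n. \<integral>z. norm (?g n z) \<partial>M)"
    proof (rule summableI_nonneg_bounded)
      fix N
      have "(\<Sum>n<N. \<integral>z. norm (?g n z) \<partial>M) = (\<integral>z. (\<Sum>n<N. norm (?g n z)) \<partial>M)"
        by (rule Bochner_Integration.integral_sum[symmetric]) (intro integrable_norm int)
      also have "\<dots> \<le> (\<integral>z. cmod (f z) * (vnorm u * vnorm v) \<partial>M)"
      proof (rule integral_mono)
        show "integrable M (\<lambda>z. \<Sum>n<N. norm (?g n z))"
          by (intro Bochner_Integration.integrable_sum integrable_norm int)
        show "integrable M (\<lambda>z. cmod (f z) * (vnorm u * vnorm v))"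
          using f by simp
        show "(\<Sum>n<N. norm (?g n z)) \<le> cmod (f z) * (vnorm u * vnorm v)" for z
          using ip_partial_le[OF ru[of z] u(2), of N] unitary_repD(6)[OF r u(1), of "- z"]
          by (simp only: sn sum_distrib_left[symmetric] mult_left_mono norm_ge_zero)
      qed
      finally show "(\<Sum>n<N. \<integral>z. norm (?g n z) \<partial>M) \<le> (\<integral>z. cmod (f z) * (vnorm u * vnorm v) \<partial>M)" .
    qed simp
  qed
  also have "(\<lambda>z. \<Sum>n. ?g n z) = (\<lambda>z. f z * ip (\<pi> (- z) u) v)"
    using ip_summable[OF ru u(2)] by (simp add: ip_def mult.assoc suminf_mult)
  finally show ?thesis
    by (simp add: ip_def fourier_unitary_rep[OF r u(1)])
qed

text \<open>
  That the coordinates of the weak integral are square-summable is seen by pairing it with its own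
  truncation \<open>c\<close> to the first \<open>N\<close> coordinates: \<open>\<parallel>c\<parallel>\<^sup>2 \<le> \<parallel>f\<parallel>\<^sub>1 \<parallel>u\<parallel> \<parallel>c\<parallel>\<close>, uniformly
  in \<open>N\<close>.
\<close>

lemma fourier_hilb:
  assumes f: "integrable M f" and r: "unitary_rep (d, \<pi>)" and u: "u \<in> hilb d"
  shows "fourier M f (d, \<pi>) u \<in> hilb d"
    and "vnorm (fourier M f (d, \<pi>) u) \<le> (\<integral>z. cmod (f z) \<partial>M) * vnorm u"
proof -
  let ?v = "fourier M f (d, \<pi>) u" and ?C = "(\<integral>z. cmod (f z) \<partial>M) * vnorm u"
  have C: "0 \<le> ?C" using vnorm_nonneg[OF u] by simp
  have zero: "?v n = 0" if "d \<le> enat n" for n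
    using unitary_repD(3)[OF r u] that by (auto simp: fourier_unitary_rep[OF r u] hilb_def)
  have part: "(\<Sum>n<N. (cmod (?v n))\<^sup>2) \<le> ?C\<^sup>2" for N
  proof -
    (* testing against a finitely supported vector does not presuppose that ?v is
       square-summable *)
    define c where "c = (\<lambda>n. if n < N then ?v n else 0)"
    have csum: "(\<lambda>n. (cmod (c n))\<^sup>2) sums (\<Sum>n<N. (cmod (c n))\<^sup>2)"
      by (rule sums_finite) (auto simp: c_def)
    have c: "c \<in> hilb d"
      using csum zero by (auto simp: hilb_def sums_iff c_def)
    let ?S = "\<Sum>n<N. (cmod (?v n))\<^sup>2"
    have S: "?S = (vnorm c)\<^sup>2"
      using csum unfolding vnorm_sq[OF c] by (simp add: sums_iff c_def)
    have "ip ?v c = (\<Sum>n<N. ?v n * cnj (c n))"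
      unfolding ip_def by (rule suminf_finite) (auto simp: c_def)
    also have "\<dots> = of_real ?S"
      by (simp add: c_def complex_norm_square[symmetric] flip: of_real_power)
    finally have "cmod (ip ?v c) = \<bar>?S\<bar>"
      by (simp only: norm_of_real)
    then have "?S = cmod (ip ?v c)"
      by (simp only: abs_of_nonneg[OF sum_nonneg] zero_le_power2)
    also have "\<dots> \<le> (\<integral>z. cmod (f z * ip (\<pi> (- z) u) c) \<partial>M)"
      unfolding fourier_weak[OF f r u c] by (rule integral_norm_bound)
    also have "\<dots> \<le> (\<integral>z. cmod (f z) * (vnorm u * vnorm c) \<partial>M)"
    proof (rule integral_mono')
      show "cmod (f z * ip (\<pi> (- z) u) c) \<le> cmod (f z) * (vnorm u * vnorm c)" for z
        using ip_Cauchy_Schwarz[OF unitary_repD(3)[OF r u] c, of "- z"] unitary_repD(6)[OF r u, of "- z"]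
        by (simp add: norm_mult mult_left_mono)
    qed (use f vnorm_nonneg[OF u] vnorm_nonneg[OF c] in auto)
    finally have "(vnorm c)\<^sup>2 \<le> ?C * vnorm c" by (simp add: S mult.assoc)
    then have "vnorm c \<le> ?C"
      using vnorm_nonneg[OF c] C by (cases "vnorm c = 0") (auto simp: power2_eq_square)
    then show ?thesis unfolding S using vnorm_nonneg[OF c] by (rule power_mono)
  qed
  have s: "summable (\<lambda>n. (cmod (?v n))\<^sup>2)"
    by (rule summableI_nonneg_bounded[OF _ part]) simp
  then show h: "?v \<in> hilb d" using zero by (auto simp: hilb_def)
  have "(vnorm ?v)\<^sup>2 \<le> ?C\<^sup>2"
    unfolding vnorm_sq[OF h] by (rule suminf_le_const[OF s part])
  then show "vnorm ?v \<le> ?C" using C by (rule power2_le_imp_le)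
qed

lemma fourier_bounded_op:
  assumes f: "integrable M f" and r: "unitary_rep (d, \<pi>)"
  shows "bounded_op d (fourier M f (d, \<pi>))"
proof -
  have "fourier M f (d, \<pi>) (\<lambda>n. a * u n + b * v n) = (\<lambda>n. a * fourier M f (d, \<pi>) u n + b * fourier M f (d, \<pi>) v n)"
    if u: "u \<in> hilb d" "v \<in> hilb d" for u v a b
  proof
    fix n
    have "(\<lambda>z. f z * \<pi> (- z) (\<lambda>n. a * u n + b * v n) n) = (\<lambda>z. a * (f z * \<pi> (- z) u n) + b * (f z * \<pi> (- z) v n))"
      by (simp add: unitary_rep_lincomb[OF r u] algebra_simps)
    moreover have "integrable M (\<lambda>z. f z * \<pi> (- z) u n)" "integrable M (\<lambda>z. f z * \<pi> (- z) v n)"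
      using fourier_integrable[OF f r u(1)] fourier_integrable[OF f r u(2)] by auto
    ultimately show "fourier M f (d, \<pi>) (\<lambda>n. a * u n + b * v n) n = a * fourier M f (d, \<pi>) u n + b * fourier M f (d, \<pi>) v n"
      by (simp add: fourier_unitary_rep[OF r u(1)] fourier_unitary_rep[OF r u(2)]
          fourier_unitary_rep[OF r hilb_lincomb[OF u]])
  qed
  then show ?thesis
    unfolding bounded_op_def linear_op_def using fourier_hilb[OF f r] by blast
qed

lemma fourier_cong_AE:
  assumes "AE z in M. f z = g z" "f \<in> borel_measurable M" "g \<in> borel_measurable M"
    and r: "unitary_rep (d, \<pi>)" and u: "u \<in> hilb d"
  shows "fourier M f (d, \<pi>) u = fourier M g (d, \<pi>) u"
proof -
  have [measurable]: "(\<lambda>z. \<pi> (- z) u n) \<in> borel_measurable M" for n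
    by (rule rep_coord_measurable[OF r u]) measurable
  have [measurable]: "f \<in> borel_measurable M" "g \<in> borel_measurable M" by fact+
  show ?thesis
    unfolding fourier_unitary_rep[OF r u]
    by (intro ext integral_cong_AE) (use assms(1) in auto)
qed

lemma nn_integral_prod_finite:
  assumes "integrable M f" "integrable M g"
  shows "(\<integral>\<^sup>+x. \<integral>\<^sup>+y. ennreal (cmod (f x) * cmod (g y) * C) \<partial>M \<partial>M) < \<infinity>"
proof -
  have [measurable]: "f \<in> borel_measurable M" "g \<in> borel_measurable M" using assms by auto
  have "(\<integral>\<^sup>+x. \<integral>\<^sup>+y. ennreal (cmod (f x) * cmod (g y) * C) \<partial>M \<partial>M) =
     (\<integral>\<^sup>+x. \<integral>\<^sup>+y. ennreal (cmod (f x)) * (ennreal (cmod (g y)) * ennreal C) \<partial>M \<partial>M)"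
    by (simp add: ennreal_mult' mult.assoc)
  also have "\<dots> = (\<integral>\<^sup>+x. ennreal (cmod (f x)) \<partial>M) * ((\<integral>\<^sup>+y. ennreal (cmod (g y)) \<partial>M) * ennreal C)"
    by (simp add: nn_integral_cmult nn_integral_multc)
  also have "\<dots> < \<infinity>"
    using assms by (auto simp: integrable_iff_bounded ennreal_mult_less_top)
  finally show ?thesis .
qed

lemma nn_integral_prod_shear:
  assumes [measurable]: "f \<in> borel_measurable M" "g \<in> borel_measurable M"
  shows "(\<integral>\<^sup>+x. \<integral>\<^sup>+y. ennreal (cmod (f x) * cmod (g (- x + y)) * C) \<partial>M \<partial>M) =
    (\<integral>\<^sup>+x. \<integral>\<^sup>+y. ennreal (cmod (f x) * cmod (g y) * C) \<partial>M \<partial>M)"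
  by (intro nn_integral_cong nn_integral_preserving[OF preserving_left, of "\<lambda>y. ennreal (cmod (f _) * cmod (g y) * C)"]) measurable

lemma group_conv_integrable:
  assumes f: "integrable M f" and g: "integrable M g"
  shows "integrable M (group_conv M f g)"
proof -
  have [measurable]: "f \<in> borel_measurable M" "g \<in> borel_measurable M" using f g by auto
  have "(\<integral>\<^sup>+y. \<integral>\<^sup>+x. ennreal (cmod (f y * g (- y + x))) \<partial>M \<partial>M) < \<infinity>"
    using nn_integral_prod_shear[of f g 1] nn_integral_prod_finite[OF f g, of 1] by (simp add: norm_mult)
  then have "integrable (M \<Otimes>\<^sub>M M) (\<lambda>(y, x). f y * g (- y + x))"
    by (rule MM.Fubini_absolute(4)[rotated]) measurable
  then have "integrable M (\<lambda>x. \<integral>y. f y * g (- y + x) \<partial>M)"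
    by (rule MM.integrable_snd)
  then show ?thesis by (simp add: group_conv_def[abs_def])
qed

text \<open>
  The factors are reversed since \<open>\<pi>(y + w)\<^sup>* = \<pi>(w)\<^sup>* \<pi>(y)\<^sup>*\<close>. In coordinates both sides are the
  integral of \<open>f y * g w * \<pi>(- (y + w)) u n\<close>, written with \<open>w\<close> on the right and with
  \<open>t = y + w\<close> on the left.
\<close>

lemma fourier_group_conv:
  assumes f: "integrable M f" and g: "integrable M g" and r: "unitary_rep (d, \<pi>)" and u: "u \<in> hilb d"
  shows "fourier M (group_conv M f g) (d, \<pi>) u = fourier M g (d, \<pi>) (fourier M f (d, \<pi>) u)"
proof
  fix n
  have [measurable]: "f \<in> borel_measurable M" "g \<in> borel_measurable M" using f g by auto
  note m = rep_coord_measurable[OF r u, measurable]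
  let ?v = "fourier M f (d, \<pi>) u"
  have v: "?v \<in> hilb d" by (rule fourier_hilb[OF f r u])
  (* beyond the dimension d there is no basis vector to pair with, but both sides vanish *)
  have inner: "\<pi> (- w) ?v n = (\<integral>y. f y * \<pi> (- (y + w)) u n \<partial>M)" for w
  proof (cases "enat n < d")
    case True
    note e = ebasis_hilb[OF True]
    have "\<pi> (- w) ?v n = ip ?v (\<pi> w (ebasis n))"
      by (simp add: unitary_rep_ip_adjoint[OF r v e] ip_ebasis)
    also have "\<dots> = (\<integral>y. f y * ip (\<pi> (- y) u) (\<pi> w (ebasis n)) \<partial>M)"
      by (rule fourier_weak[OF f r u unitary_repD(3)[OF r e]])
    also have "\<dots> = (\<integral>y. f y * \<pi> (- (y + w)) u n \<partial>M)"
      by (simp add: unitary_rep_ip_adjoint[OF r unitary_repD(3)[OF r u] e] ip_ebasis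
          unitary_repD(4)[OF r u, symmetric] minus_add)
    finally show ?thesis .
  next
    case False
    then have "\<pi> x w n = 0" if "w \<in> hilb d" for x w
      using hilbD(2)[OF unitary_repD(3)[OF r that]] by simp
    then show ?thesis using v u by simp
  qed
  define F where "F = (\<lambda>y t. f y * g (- y + t) * \<pi> (- t) u n)"
  have [measurable]: "case_prod F \<in> borel_measurable (M \<Otimes>\<^sub>M M)"
    unfolding F_def by measurable
  have bnd: "cmod (f y * g w * \<pi> x u n) \<le> cmod (f y) * cmod (g w) * vnorm u" for y w x
    unfolding norm_mult by (intro mult_left_mono rep_coord_bound[OF r u]) simp
  have Ffin: "(\<integral>\<^sup>+y. \<integral>\<^sup>+t. ennreal (cmod (F y t)) \<partial>M \<partial>M) < \<infinity>"
  proof -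
    have "(\<integral>\<^sup>+y. \<integral>\<^sup>+t. ennreal (cmod (F y t)) \<partial>M \<partial>M) \<le>
      (\<integral>\<^sup>+y. \<integral>\<^sup>+t. ennreal (cmod (f y) * cmod (g (- y + t)) * vnorm u) \<partial>M \<partial>M)"
      unfolding F_def by (intro nn_integral_mono ennreal_leI bnd)
    also have "\<dots> < \<infinity>"
      unfolding nn_integral_prod_shear[OF \<open>f \<in> borel_measurable M\<close> \<open>g \<in> borel_measurable M\<close>]
      by (rule nn_integral_prod_finite[OF f g])
    finally show ?thesis .
  qed
  define H where "H = (\<lambda>y w. f y * g w * \<pi> (- (y + w)) u n)"
  have [measurable]: "case_prod H \<in> borel_measurable (M \<Otimes>\<^sub>M M)"
    unfolding H_def by measurable
  have Hfin: "(\<integral>\<^sup>+y. \<integral>\<^sup>+w. ennreal (cmod (H y w)) \<partial>M \<partial>M) < \<infinity>"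
  proof -
    have "(\<integral>\<^sup>+y. \<integral>\<^sup>+w. ennreal (cmod (H y w)) \<partial>M \<partial>M) \<le>
      (\<integral>\<^sup>+y. \<integral>\<^sup>+w. ennreal (cmod (f y) * cmod (g w) * vnorm u) \<partial>M \<partial>M)"
      unfolding H_def by (intro nn_integral_mono ennreal_leI bnd)
    also have "\<dots> < \<infinity>" by (rule nn_integral_prod_finite[OF f g])
    finally show ?thesis .
  qed
  have "fourier M g (d, \<pi>) ?v n = (\<integral>w. g w * (\<integral>y. f y * \<pi> (- (y + w)) u n \<partial>M) \<partial>M)"
    by (simp add: fourier_unitary_rep[OF r v] inner)
  also have "\<dots> = (\<integral>w. \<integral>y. H y w \<partial>M \<partial>M)"
    unfolding H_def by (simp add: integral_mult_right_zero[symmetric] ac_simps del: integral_mult_right_zero)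
  also have "\<dots> = (\<integral>y. \<integral>w. H y w \<partial>M \<partial>M)"
    by (rule MM.Fubini_absolute(1)[OF _ Hfin, symmetric]) measurable
  also have "\<dots> = (\<integral>y. \<integral>t. F y t \<partial>M \<partial>M)"
  proof (rule Bochner_Integration.integral_cong[OF refl])
    fix y
    have "(\<integral>w. H y w \<partial>M) = (\<integral>t. H y (- y + t) \<partial>M)"
      by (rule integral_preserving[OF preserving_left, symmetric]) measurable
    then show "(\<integral>w. H y w \<partial>M) = (\<integral>t. F y t \<partial>M)"
      by (simp add: H_def F_def add.assoc[symmetric])
  qed
  also have "\<dots> = (\<integral>t. \<integral>y. F y t \<partial>M \<partial>M)"
    by (rule MM.Fubini_absolute(1)[OF _ Ffin]) measurable
  also have "\<dots> = fourier M (group_conv M f g) (d, \<pi>) u n"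
    by (simp add: fourier_unitary_rep[OF r u] group_conv_def F_def)
  finally show "fourier M (group_conv M f g) (d, \<pi>) u n = fourier M g (d, \<pi>) ?v n" ..
qed

end

section \<open>Fields of Hilbert-Schmidt operators\<close>

text \<open>
  The terms of \<open>hs_norm2\<close> as a real series, on which sums can be computed without values at
  infinity.
\<close>

definition hs_term :: "enat \<Rightarrow> cop \<Rightarrow> nat \<Rightarrow> real" where
  "hs_term d S j = (if enat j < d then (vnorm (S (ebasis j)))\<^sup>2 else 0)"

lemma hs_term_nonneg: "0 \<le> hs_term d S j"
  by (simp add: hs_term_def)

lemma hs_norm2_eq: "hs_norm2 d S = (\<Sum>j. ennreal (hs_term d S j))"
  unfolding hs_norm2_def hs_term_def by (rule suminf_cong) auto

lemma hs_norm2_finite: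
  assumes "hs_norm2 d S < \<infinity>"
  shows "summable (hs_term d S)" "enn2real (hs_norm2 d S) = (\<Sum>j. hs_term d S j)"
proof -
  show s: "summable (hs_term d S)"
    using assms by (intro summable_suminf_not_top) (auto simp: hs_norm2_eq hs_term_nonneg)
  show "enn2real (hs_norm2 d S) = (\<Sum>j. hs_term d S j)"
    unfolding hs_norm2_eq suminf_ennreal2[OF hs_term_nonneg s]
    by (simp add: suminf_nonneg s hs_term_nonneg)
qed

lemma hs_inner_bound:
  assumes fin: "hs_norm2 d S < \<infinity>" "hs_norm2 d T < \<infinity>"
    and h: "\<And>j. enat j < d \<Longrightarrow> S (ebasis j) \<in> hilb d" "\<And>j. enat j < d \<Longrightarrow> T (ebasis j) \<in> hilb d"
  shows "summable (\<lambda>j. if enat j < d then ip (S (ebasis j)) (T (ebasis j)) else 0)"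
    and "cmod (hs_inner d S T) \<le> enn2real (hs_norm2 d S) + enn2real (hs_norm2 d T)"
proof -
  let ?q = "\<lambda>j. if enat j < d then ip (S (ebasis j)) (T (ebasis j)) else 0"
  have b: "cmod (?q j) \<le> hs_term d S j + hs_term d T j" for j
  proof (cases "enat j < d")
    case True
    have "cmod (?q j) \<le> vnorm (S (ebasis j)) * vnorm (T (ebasis j))"
      using ip_Cauchy_Schwarz[OF h(1)[OF True] h(2)[OF True]] True by simp
    also have "\<dots> \<le> hs_term d S j + hs_term d T j"
      using sum_squares_bound[of "vnorm (S (ebasis j))" "vnorm (T (ebasis j))"] True
        mult_nonneg_nonneg[OF vnorm_nonneg[OF h(1)[OF True]] vnorm_nonneg[OF h(2)[OF True]]]
      by (simp add: hs_term_def)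
    finally show ?thesis .
  qed (simp add: hs_term_def)
  note s = hs_norm2_finite[OF fin(1)] hs_norm2_finite[OF fin(2)]
  have sn: "summable (\<lambda>j. cmod (?q j))"
    by (rule summable_comparison_test'[OF summable_add[OF s(1) s(3)], of 0]) (use b in simp)
  then show "summable ?q" by (rule summable_norm_cancel)
  have "cmod (hs_inner d S T) \<le> (\<Sum>j. cmod (?q j))"
    unfolding hs_inner_def by (rule summable_norm[OF sn])
  also have "\<dots> \<le> (\<Sum>j. hs_term d S j + hs_term d T j)"
    by (rule suminf_le[OF b sn summable_add[OF s(1) s(3)]])
  also have "\<dots> = enn2real (hs_norm2 d S) + enn2real (hs_norm2 d T)"
    using suminf_add[OF s(1) s(3)] s by simp
  finally show "cmod (hs_inner d S T) \<le> enn2real (hs_norm2 d S) + enn2real (hs_norm2 d T)" .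
qed

text \<open>
  The expansion of the square of a Hilbert-Schmidt norm. Letting \<open>c\<close> vary, it recovers the inner
  product from norms.
\<close>

lemma hs_norm2_expand:
  assumes fin: "hs_norm2 d S < \<infinity>" "hs_norm2 d T < \<infinity>"
    and h: "\<And>j. enat j < d \<Longrightarrow> S (ebasis j) \<in> hilb d" "\<And>j. enat j < d \<Longrightarrow> T (ebasis j) \<in> hilb d"
    and W: "\<And>j. enat j < d \<Longrightarrow> W (ebasis j) = (\<lambda>n. 1 * S (ebasis j) n + c * T (ebasis j) n)"
  shows "enn2real (hs_norm2 d W) =
    enn2real (hs_norm2 d S) + (cmod c)\<^sup>2 * enn2real (hs_norm2 d T) + 2 * Re (cnj c * hs_inner d S T)"
proof -
  let ?q = "\<lambda>j. if enat j < d then ip (S (ebasis j)) (T (ebasis j)) else 0"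
  have q: "?q sums hs_inner d S T"
    unfolding hs_inner_def using hs_inner_bound(1)[OF fin h] by (rule summable_sums)
  have t: "hs_term d W j = hs_term d S j + (cmod c)\<^sup>2 * hs_term d T j + 2 * Re (cnj c * ?q j)" for j
  proof (cases "enat j < d")
    case True
    note hj = h(1)[OF True] h(2)[OF True]
    have "complex_of_real (hs_term d W j) = ip (W (ebasis j)) (W (ebasis j))"
      using hilb_lincomb[OF hj, of 1 c] True by (simp add: hs_term_def ip_self[of _ d] W)
    also have "\<dots> = ip (S (ebasis j)) (S (ebasis j)) + cnj c * ?q j + c * cnj (?q j) + c * cnj c * ip (T (ebasis j)) (T (ebasis j))"
      unfolding W[OF True] ip_lincomb_self[OF hj] using True by simp
    also have "\<dots> = of_real (hs_term d S j + (cmod c)\<^sup>2 * hs_term d T j + 2 * Re (cnj c * ?q j))"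
      using True unfolding ip_self[OF hj(1)] ip_self[OF hj(2)] complex_norm_square[of c, symmetric]
      by (simp add: hs_term_def complex_eq_iff algebra_simps)
    finally show ?thesis unfolding of_real_eq_iff .
  qed (simp add: hs_term_def)
  note s = hs_norm2_finite[OF fin(1)] hs_norm2_finite[OF fin(2)]
  have "(\<lambda>j. hs_term d S j + (cmod c)\<^sup>2 * hs_term d T j + 2 * Re (cnj c * ?q j)) sums
    (enn2real (hs_norm2 d S) + (cmod c)\<^sup>2 * enn2real (hs_norm2 d T) + 2 * Re (cnj c * hs_inner d S T))"
    unfolding s(2,4) by (intro sums_add sums_mult sums_Re summable_sums s q)
  then have "hs_term d W sums
    (enn2real (hs_norm2 d S) + (cmod c)\<^sup>2 * enn2real (hs_norm2 d T) + 2 * Re (cnj c * hs_inner d S T))"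
    unfolding t[symmetric] .
  then have sW: "summable (hs_term d W)" and eW: "(\<Sum>j. hs_term d W j) =
    enn2real (hs_norm2 d S) + (cmod c)\<^sup>2 * enn2real (hs_norm2 d T) + 2 * Re (cnj c * hs_inner d S T)"
    by (auto simp: sums_iff)
  have "enn2real (hs_norm2 d W) = (\<Sum>j. hs_term d W j)"
    unfolding hs_norm2_eq suminf_ennreal2[OF hs_term_nonneg sW]
    by (simp add: suminf_nonneg sW hs_term_nonneg)
  then show ?thesis by (simp only: eW)
qed

text \<open>
  The fibres have different dimensions, so that \<open>ebasis j\<close> is not a vector field; this one agrees
  with it wherever it lies in the fibre. Applying an operator field to it gives measurable matrix
  entries.
\<close>

definition basis_field :: "('p \<Rightarrow> enat) \<Rightarrow> nat \<Rightarrow> 'p \<Rightarrow> cvec" where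
  "basis_field d j p = (if enat j < d p then ebasis j else (\<lambda>_. 0))"

lemma dim_pred_measurable:
  assumes "d \<in> measurable N (count_space UNIV)"
  shows "Measurable.pred N (\<lambda>p. enat j < d p)"
  by (rule measurable_compose[OF assms]) simp

lemma basis_field_vector_field:
  assumes d: "d \<in> measurable N (count_space UNIV)"
  shows "vector_field N d (basis_field d j)"
proof -
  note [measurable] = dim_pred_measurable[OF d]
  have "(\<lambda>p. basis_field d j p n) = (\<lambda>p. if enat j < d p then ebasis j n else 0)" for n
    by (auto simp: basis_field_def)
  then have "(\<lambda>p. basis_field d j p n) \<in> borel_measurable N" for n by simp
  then show ?thesis
    by (auto simp: vector_field_def basis_field_def ebasis_hilb zero_hilb)
qed

lemma op_field_coord_measurable:
  assumes "d \<in> measurable N (count_space UNIV)" "op_field N d T"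
  shows "(\<lambda>p. T p (basis_field d j p) n) \<in> borel_measurable N"
  using assms basis_field_vector_field[OF assms(1)] by (auto simp: op_field_def vector_field_def)

lemma hs_norm2_measurable:
  assumes d: "d \<in> measurable N (count_space UNIV)" and T: "op_field N d T"
  shows "(\<lambda>p. hs_norm2 (d p) (T p)) \<in> borel_measurable N"
proof -
  note [measurable] = dim_pred_measurable[OF d] op_field_coord_measurable[OF d T]
  have "(\<lambda>p. hs_norm2 (d p) (T p)) =
    (\<lambda>p. \<Sum>j. if enat j < d p then ennreal ((sqrt (\<Sum>n. (cmod (T p (basis_field d j p) n))\<^sup>2))\<^sup>2) else 0)"
    unfolding hs_norm2_def vnorm_def by (intro ext suminf_cong) (auto simp: basis_field_def)
  also have "\<dots> \<in> borel_measurable N" by measurable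
  finally show ?thesis .
qed

lemma hs_inner_measurable:
  assumes d: "d \<in> measurable N (count_space UNIV)" and S: "op_field N d S" and T: "op_field N d T"
  shows "(\<lambda>p. hs_inner (d p) (S p) (T p)) \<in> borel_measurable N"
proof -
  note [measurable] = dim_pred_measurable[OF d] op_field_coord_measurable[OF d S] op_field_coord_measurable[OF d T]
  have "(\<lambda>p. hs_inner (d p) (S p) (T p)) =
    (\<lambda>p. \<Sum>j. if enat j < d p then (\<Sum>n. S p (basis_field d j p) n * cnj (T p (basis_field d j p) n)) else 0)"
    unfolding hs_inner_def ip_def by (intro ext suminf_cong) (auto simp: basis_field_def)
  also have "\<dots> \<in> borel_measurable N" by measurable
  finally show ?thesis .
qed

lemma op_field_ebasis:
  assumes "op_field N d T" "p \<in> space N" "enat j < d p"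
  shows "T p (ebasis j) \<in> hilb (d p)"
  using assms ebasis_hilb[OF assms(3)] by (auto simp: op_field_def bounded_op_def linear_op_def)

lemma L2_fields_hs_norm2:
  assumes d: "d \<in> measurable N (count_space UNIV)" and T: "T \<in> L2_fields N d"
  shows "AE p in N. hs_norm2 (d p) (T p) < \<infinity>" "integrable N (\<lambda>p. enn2real (hs_norm2 (d p) (T p)))"
    "(\<integral>p. enn2real (hs_norm2 (d p) (T p)) \<partial>N) = enn2real (\<integral>\<^sup>+p. hs_norm2 (d p) (T p) \<partial>N)"
proof -
  have op: "op_field N d T" and fin: "(\<integral>\<^sup>+p. hs_norm2 (d p) (T p) \<partial>N) < \<infinity>"
    using T by (auto simp: L2_fields_def)
  note [measurable] = hs_norm2_measurable[OF d op]
  have "AE p in N. hs_norm2 (d p) (T p) \<noteq> \<infinity>"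
    using fin by (intro nn_integral_PInf_AE) auto
  then show ae: "AE p in N. hs_norm2 (d p) (T p) < \<infinity>"
    by eventually_elim (simp add: less_top)
  have eq: "(\<integral>\<^sup>+p. ennreal (enn2real (hs_norm2 (d p) (T p))) \<partial>N) = (\<integral>\<^sup>+p. hs_norm2 (d p) (T p) \<partial>N)"
    using ae by (intro nn_integral_cong_AE) (auto elim!: eventually_mono)
  show "integrable N (\<lambda>p. enn2real (hs_norm2 (d p) (T p)))"
    using fin eq by (intro integrableI_bounded) auto
  show "(\<integral>p. enn2real (hs_norm2 (d p) (T p)) \<partial>N) = enn2real (\<integral>\<^sup>+p. hs_norm2 (d p) (T p) \<partial>N)"
    by (subst integral_eq_nn_integral) (auto simp: eq)
qed

lemma L2_fields_inner_integrable:
  assumes d: "d \<in> measurable N (count_space UNIV)" and S: "S \<in> L2_fields N d" and T: "T \<in> L2_fields N d"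
  shows "integrable N (\<lambda>p. hs_inner (d p) (S p) (T p))"
proof (rule Bochner_Integration.integrable_bound)
  have op: "op_field N d S" "op_field N d T" using S T by (auto simp: L2_fields_def)
  show "integrable N (\<lambda>p. enn2real (hs_norm2 (d p) (S p)) + enn2real (hs_norm2 (d p) (T p)))"
    by (intro Bochner_Integration.integrable_add L2_fields_hs_norm2 d S T)
  show "(\<lambda>p. hs_inner (d p) (S p) (T p)) \<in> borel_measurable N"
    by (rule hs_inner_measurable[OF d op])
  show "AE p in N. norm (hs_inner (d p) (S p) (T p)) \<le>
      norm (enn2real (hs_norm2 (d p) (S p)) + enn2real (hs_norm2 (d p) (T p)))"
    using L2_fields_hs_norm2(1)[OF d S] L2_fields_hs_norm2(1)[OF d T] AE_space
  proof eventually_elim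
    case (elim p)
    have "cmod (hs_inner (d p) (S p) (T p)) \<le> enn2real (hs_norm2 (d p) (S p)) + enn2real (hs_norm2 (d p) (T p))"
      using elim by (intro hs_inner_bound op_field_ebasis[OF op(1)] op_field_ebasis[OF op(2)]) auto
    then show ?case by simp
  qed
qed

lemma L2_fields_expand:
  assumes d: "d \<in> measurable N (count_space UNIV)" and S: "S \<in> L2_fields N d" and T: "T \<in> L2_fields N d"
    and W: "\<And>p j. p \<in> space N \<Longrightarrow> enat j < d p \<Longrightarrow> W p (ebasis j) = (\<lambda>n. 1 * S p (ebasis j) n + c * T p (ebasis j) n)"
    and Wm: "op_field N d W"
  shows "(\<integral>p. enn2real (hs_norm2 (d p) (W p)) \<partial>N) =
    (\<integral>p. enn2real (hs_norm2 (d p) (S p)) \<partial>N) + (cmod c)\<^sup>2 * (\<integral>p. enn2real (hs_norm2 (d p) (T p)) \<partial>N)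
    + 2 * Re (cnj c * L2_fields_inner N d S T)"
proof -
  have op: "op_field N d S" "op_field N d T" using S T by (auto simp: L2_fields_def)
  note [measurable] = hs_norm2_measurable[OF d op(1)] hs_norm2_measurable[OF d op(2)]
    hs_norm2_measurable[OF d Wm] hs_inner_measurable[OF d op]
  note int = L2_fields_inner_integrable[OF d S T]
  have "(\<integral>p. enn2real (hs_norm2 (d p) (W p)) \<partial>N) =
    (\<integral>p. enn2real (hs_norm2 (d p) (S p)) + (cmod c)\<^sup>2 * enn2real (hs_norm2 (d p) (T p)) +
      2 * Re (cnj c * hs_inner (d p) (S p) (T p)) \<partial>N)"
  proof (rule integral_cong_AE)
    show "AE p in N. enn2real (hs_norm2 (d p) (W p)) =
      enn2real (hs_norm2 (d p) (S p)) + (cmod c)\<^sup>2 * enn2real (hs_norm2 (d p) (T p)) +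
      2 * Re (cnj c * hs_inner (d p) (S p) (T p))"
      using L2_fields_hs_norm2(1)[OF d S] L2_fields_hs_norm2(1)[OF d T] AE_space
      by eventually_elim
        (intro hs_norm2_expand op_field_ebasis[OF op(1)] op_field_ebasis[OF op(2)] W, auto)
  qed measurable
  also have "\<dots> = (\<integral>p. enn2real (hs_norm2 (d p) (S p)) \<partial>N) + (cmod c)\<^sup>2 * (\<integral>p. enn2real (hs_norm2 (d p) (T p)) \<partial>N)
    + 2 * Re (cnj c * (\<integral>p. hs_inner (d p) (S p) (T p) \<partial>N))"
  proof -
    have intc: "integrable N (\<lambda>p. cnj c * hs_inner (d p) (S p) (T p))" using int by simp
    then have intr: "integrable N (\<lambda>p. 2 * Re (cnj c * hs_inner (d p) (S p) (T p)))"
      by - (rule integrable_mult_right, rule integrable_Re)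
    have "(\<integral>p. 2 * Re (cnj c * hs_inner (d p) (S p) (T p)) \<partial>N) =
        2 * Re (cnj c * (\<integral>p. hs_inner (d p) (S p) (T p) \<partial>N))"
      using integral_Re[OF intc] int by (simp only: integral_mult_right_zero)
    moreover have "(\<integral>p. (cmod c)\<^sup>2 * enn2real (hs_norm2 (d p) (T p)) \<partial>N) =
        (cmod c)\<^sup>2 * (\<integral>p. enn2real (hs_norm2 (d p) (T p)) \<partial>N)"
      by (rule integral_mult_right_zero)
    ultimately show ?thesis
      using L2_fields_hs_norm2(2)[OF d S] L2_fields_hs_norm2(2)[OF d T] intr
      by (simp only: Bochner_Integration.integral_add Bochner_Integration.integrable_add
          integrable_mult_right)
  qed
  finally show ?thesis by (simp add: L2_fields_inner_def)
qed

text \<open>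
  Operators are functions of which only the values on the fibre matter, and composition with a
  symbol changes the other values.
\<close>

lemma op_field_cong:
  assumes "op_field N d T" "\<And>p u. p \<in> space N \<Longrightarrow> u \<in> hilb (d p) \<Longrightarrow> S p u = T p u"
  shows "op_field N d S"
  unfolding op_field_def
proof (intro conjI ballI allI impI)
  fix p assume p: "p \<in> space N"
  then have "bounded_op (d p) (T p)" using assms by (auto simp: op_field_def)
  moreover have "(\<lambda>n. a * u n + b * v n) \<in> hilb (d p)" if "u \<in> hilb (d p)" "v \<in> hilb (d p)" for u v a b
    using that by (rule hilb_lincomb)
  ultimately show "bounded_op (d p) (S p)"
    unfolding bounded_op_def linear_op_def by (simp add: assms(2)[OF p])
next
  fix v assume v: "vector_field N d v"
  then have "vector_field N d (\<lambda>p. T p (v p))" using assms by (auto simp: op_field_def)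
  moreover have "S p (v p) = T p (v p)" if "p \<in> space N" for p
    using v that assms(2) by (auto simp: vector_field_def)
  ultimately show "vector_field N d (\<lambda>p. S p (v p))"
    by (simp add: vector_field_def cong: measurable_cong)
qed

lemma hs_norm2_cong:
  "(\<And>u. u \<in> hilb d \<Longrightarrow> S u = T u) \<Longrightarrow> hs_norm2 d S = hs_norm2 d T"
  unfolding hs_norm2_def by (rule suminf_cong) (auto simp: ebasis_hilb)

lemma hs_inner_cong:
  "(\<And>u. u \<in> hilb d \<Longrightarrow> S u = S' u) \<Longrightarrow> hs_inner d S T = hs_inner d S' T"
  unfolding hs_inner_def by (rule suminf_cong) (auto simp: ebasis_hilb)

lemma L2_fields_cong:
  assumes "T \<in> L2_fields N d" "\<And>p u. p \<in> space N \<Longrightarrow> u \<in> hilb (d p) \<Longrightarrow> S p u = T p u"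
  shows "S \<in> L2_fields N d"
proof -
  have "(\<integral>\<^sup>+p. hs_norm2 (d p) (S p) \<partial>N) = (\<integral>\<^sup>+p. hs_norm2 (d p) (T p) \<partial>N)"
    using assms(2) by (intro nn_integral_cong hs_norm2_cong) auto
  then show ?thesis using assms op_field_cong[of N d T S] by (auto simp: L2_fields_def)
qed

section \<open>The operator-valued Parseval identity\<close>

context unimodular_haar
begin

text \<open>
  Enumerate a dense set and let \<open>D (idx n z)\<close> be its first element in \<open>z + A n\<close>, where the
  \<open>A n\<close> form a neighbourhood basis of the neutral element. By translation, one sequence of
  neighbourhoods serves all points.
\<close>

lemma countably_valued_approximation:
  obtains D :: "nat \<Rightarrow> 'g" and idx :: "nat \<Rightarrow> 'g \<Rightarrow> nat"
  where "\<And>n. idx n \<in> measurable M (count_space UNIV)" "\<And>z. (\<lambda>n. D (idx n z)) \<longlonglongrightarrow> z"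
proof -
  obtain D' :: "'g set" where D': "countable D'" "\<And>X. open X \<Longrightarrow> X \<noteq> {} \<Longrightarrow> \<exists>d\<in>D'. d \<in> X"
    by (rule countable_dense_setE) blast
  have ne: "D' \<noteq> {}" using D'(2)[of UNIV] by auto
  define D where "D = from_nat_into D'"
  have rD: "range D = D'" using D'(1) ne by (simp add: D_def range_from_nat_into)
  obtain A :: "nat \<Rightarrow> 'g set" where A: "\<And>i. open (A i)" "\<And>i. 0 \<in> A i"
      "\<And>S. open S \<Longrightarrow> 0 \<in> S \<Longrightarrow> eventually (\<lambda>i. A i \<subseteq> S) sequentially"
    by (rule countable_basis_at_decseq[of 0]) blast
  define V where "V = (\<lambda>n i. {z. - z + D i \<in> A n})"
  have Vo: "open (V n i)" for n i
  proof -
    have "open ((\<lambda>z. - z + D i) -` A n)"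
      by (intro open_vimage A continuous_intros)
    then show ?thesis by (simp add: V_def vimage_def)
  qed
  then have [measurable]: "V n i \<in> sets M" for n i by simp
  have ex: "\<exists>i. z \<in> V n i" for n z
  proof -
    have o: "open ((\<lambda>y. - z + y) -` A n)" by (intro open_vimage A continuous_intros)
    have "z \<in> (\<lambda>y. - z + y) -` A n" using A(2) by simp
    then have "(\<lambda>y. - z + y) -` A n \<noteq> {}" by blast
    from D'(2)[OF o this] obtain d where "d \<in> D'" "- z + d \<in> A n" by auto
    then show ?thesis unfolding rD[symmetric] by (auto simp: V_def)
  qed
  define idx where "idx = (\<lambda>n z. LEAST i. z \<in> V n i)"
  have "idx n \<in> measurable M (count_space UNIV)" for n unfolding idx_def by measurable
  moreover have "(\<lambda>n. D (idx n z)) \<longlonglongrightarrow> z" for z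
  proof -
    have "- z + D (idx n z) \<in> A n" for n
      using LeastI_ex[OF ex[of z n]] by (simp add: idx_def V_def)
    then have "(\<lambda>n. - z + D (idx n z)) \<longlonglongrightarrow> 0"
      by (intro topological_tendstoI) (use A(3) in \<open>force elim!: eventually_mono\<close>)
    then have "(\<lambda>n. z + (- z + D (idx n z))) \<longlonglongrightarrow> z + 0"
      by (intro tendsto_add tendsto_const)
    then show ?thesis by (simp add: add.assoc[symmetric])
  qed
  ultimately show ?thesis using that by blast
qed

text \<open>
  A function continuous in the first and measurable in the second argument is the limit of
  \<open>\<phi> (D (idx n z)) c\<close>, which is jointly measurable because its first argument takes
  countably many values.
\<close>

lemma Caratheodory_measurable:
  fixes \<phi> :: "'g \<Rightarrow> 'c \<Rightarrow> complex"
  assumes cont: "\<And>c. c \<in> space N \<Longrightarrow> continuous_on UNIV (\<lambda>z. \<phi> z c)"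
    and meas: "\<And>z. \<phi> z \<in> borel_measurable N"
  shows "(\<lambda>(z, c). \<phi> z c) \<in> borel_measurable (M \<Otimes>\<^sub>M N)"
proof -
  obtain D :: "nat \<Rightarrow> 'g" and idx where [measurable]: "\<And>n. idx n \<in> measurable M (count_space UNIV)"
    and lim: "\<And>z. (\<lambda>n. D (idx n z)) \<longlonglongrightarrow> z"
    by (rule countably_valued_approximation) blast
  note [measurable] = meas
  show ?thesis
  proof (rule borel_measurable_LIMSEQ_metric)
    show "(\<lambda>p. \<phi> (D (idx n (fst p))) (snd p)) \<in> borel_measurable (M \<Otimes>\<^sub>M N)" for n
      by (rule measurable_compose_countable[where g = "\<lambda>p. idx n (fst p)"]) measurable
    fix p assume "p \<in> space (M \<Otimes>\<^sub>M N)"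
    then have c: "snd p \<in> space N" by (auto simp: space_pair_measure)
    show "(\<lambda>n. \<phi> (D (idx n (fst p))) (snd p)) \<longlonglongrightarrow> (case p of (z, c) \<Rightarrow> \<phi> z c)"
      unfolding split_beta' by (rule continuous_on_tendsto_compose[OF cont[OF c] lim]) auto
  qed
qed

end

text \<open>
  Extended by zero to indices beyond the dimension, so that the adjoint is given by one formula
  for representations of all dimensions.
\<close>

definition matrix_coeff :: "'g rep \<Rightarrow> nat \<Rightarrow> nat \<Rightarrow> 'g \<Rightarrow> complex" where
  "matrix_coeff r j m z = (if enat j < fst r then snd r z (ebasis j) m else 0)"

lemma adjoint_op_coord: "adjoint_op (fst r) (snd r z) u n = (\<Sum>m. u m * cnj (matrix_coeff r n m z))"
  by (simp add: adjoint_op_def matrix_coeff_def ip_def)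

lemma irreps_unitary: "r \<in> irreps \<Longrightarrow> unitary_rep (fst r, snd r)"
  by (cases r) (auto simp: irreps_def irreducible_rep_def)

lemma irrep_borel_generator:
  assumes "u \<in> hilb d" "v \<in> hilb d" "B \<in> sets borel"
  shows "{r\<in>irreps. fst r = d \<and> ip (snd r x u) v \<in> B} \<in> sets irrep_borel"
  unfolding irrep_borel_def by (rule in_measure_of) (use assms in blast)+

lemma space_irrep_borel: "space irrep_borel = irreps"
  by (simp add: irrep_borel_def space_measure_of_conv)

lemma dim_measurable_irrep_borel: "fst \<in> measurable (irrep_borel :: 'g::topological_group_add rep measure) (count_space UNIV)"
proof -
  have "fst -` {d} \<inter> space irrep_borel \<in> sets (irrep_borel :: 'g rep measure)" for d
  proof -
    have "fst -` {d} \<inter> space irrep_borel = {r\<in>irreps. fst r = d \<and> ip (snd r (0::'g) (\<lambda>_. 0)) (\<lambda>_. 0) \<in> UNIV}"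
      by (auto simp: space_irrep_borel)
    then show ?thesis using irrep_borel_generator[OF zero_hilb zero_hilb, of UNIV] by simp
  qed
  then show ?thesis by (simp add: measurable_count_space_eq2_countable)
qed

text \<open>
  The generators of the Borel structure fix the dimension \<open>d\<close>. For each \<open>d\<close> the coefficient is
  either one of the generating functions or identically zero, and there are countably many values
  of \<open>d\<close>.
\<close>

lemma matrix_coeff_measurable_irrep_borel:
  "(\<lambda>r. matrix_coeff r j m z) \<in> borel_measurable (irrep_borel :: 'g::topological_group_add rep measure)"
proof (rule measurableI)
  fix B :: "complex set" assume B: "B \<in> sets borel"
  let ?P = "\<lambda>d. {r\<in>(irreps :: 'g rep set). fst r = d \<and> matrix_coeff r j m z \<in> B}"
  have "?P d \<in> sets irrep_borel" for d
  proof (cases "enat j < d \<and> enat m < d")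
    case True
    then have "?P d = {r\<in>irreps. fst r = d \<and> ip (snd r z (ebasis j)) (ebasis m) \<in> B}"
      by (auto simp: matrix_coeff_def ip_ebasis)
    then show ?thesis using irrep_borel_generator[OF ebasis_hilb ebasis_hilb B] True by auto
  next
    case False
    have "matrix_coeff r j m z = 0" if "r \<in> irreps" "fst r = d" for r
    proof (cases "enat j < d")
      case True
      then have "snd r z (ebasis j) \<in> hilb d"
        using unitary_repD(3)[OF irreps_unitary[OF that(1)]] that(2) ebasis_hilb by blast
      then show ?thesis using False True by (auto simp: matrix_coeff_def hilb_def)
    qed (use that in \<open>simp add: matrix_coeff_def\<close>)
    then have "?P d = (if 0 \<in> B then {r\<in>irreps. fst r = d \<and> ip (snd r z (\<lambda>_. 0)) (\<lambda>_. 0) \<in> UNIV} else {})"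
      by auto
    then show ?thesis using irrep_borel_generator[OF zero_hilb zero_hilb, where B = UNIV and x = z] by simp
  qed
  then have "(\<Union>d. ?P d) \<in> sets irrep_borel"
    by (intro sets.countable_UN') auto
  moreover have "(\<lambda>r. matrix_coeff r j m z) -` B \<inter> space irrep_borel = (\<Union>d. ?P d)"
    by (auto simp: space_irrep_borel)
  ultimately show "(\<lambda>r. matrix_coeff r j m z) -` B \<inter> space irrep_borel \<in> sets irrep_borel" by simp
qed simp

locale plancherel_group = unimodular_haar M
  for M :: "'g::{topological_group_add, t2_space, second_countable_topology} measure" +
  fixes \<rho> :: "'g rep set \<Rightarrow> 'g rep" and \<mu> :: "'g rep set measure"
  assumes choice: "measurable_choice \<rho>" and plancherel: "plancherel_measure M \<rho> \<mu>"
begin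

lemma sets_mu: "sets \<mu> = sets dual_borel"
  using plancherel by (simp add: plancherel_measure_def)

sublocale mu: sigma_finite_measure \<mu>
  using plancherel by (simp add: plancherel_measure_def)

sublocale MN: pair_sigma_finite M \<mu> ..

lemma space_mu: "space \<mu> = unitary_dual"
  unfolding sets_eq_imp_space_eq[OF sets_mu] by (simp add: dual_borel_def space_measure_of_conv)

lemma rho_irreps:
  assumes "c \<in> unitary_dual" shows "\<rho> c \<in> irreps"
proof -
  have "\<rho> c \<in> c" using choice assms by (auto simp: measurable_choice_def)
  then show ?thesis using assms by (auto simp: unitary_dual_def quotient_def)
qed

lemma rho_unitary: "c \<in> unitary_dual \<Longrightarrow> unitary_rep (fst (\<rho> c), snd (\<rho> c))"
  by (intro irreps_unitary rho_irreps)

lemma rho_measurable: "\<rho> \<in> measurable \<mu> irrep_borel"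
  using choice measurable_cong_sets[OF sets_mu refl] by (auto simp: measurable_choice_def)

lemma fdim_measurable: "fdim \<rho> \<in> measurable (M \<Otimes>\<^sub>M \<mu>) (count_space UNIV)"
proof -
  have "(\<lambda>p. fst (\<rho> (snd p))) \<in> measurable (M \<Otimes>\<^sub>M \<mu>) (count_space UNIV)"
    by (rule measurable_compose[OF measurable_compose[OF measurable_snd rho_measurable] dim_measurable_irrep_borel])
  then show ?thesis by (simp add: fdim_def split_beta')
qed

text \<open>
  The coefficient is continuous in the group element and measurable in the class.
\<close>

lemma matrix_coeff_measurable:
  assumes "h \<in> measurable N M" "g \<in> measurable N \<mu>"
  shows "(\<lambda>p. matrix_coeff (\<rho> (g p)) j m (h p)) \<in> borel_measurable N"
proof -
  have "(\<lambda>(z, c). matrix_coeff (\<rho> c) j m z) \<in> borel_measurable (M \<Otimes>\<^sub>M \<mu>)"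
  proof (rule Caratheodory_measurable)
    fix c assume "c \<in> space \<mu>"
    then have r: "unitary_rep (fst (\<rho> c), snd (\<rho> c))" using rho_unitary space_mu by simp
    show "continuous_on UNIV (\<lambda>z. matrix_coeff (\<rho> c) j m z)"
      unfolding matrix_coeff_def
      by (cases "enat j < fst (\<rho> c)") (auto intro: unitary_rep_coord_continuous[OF r ebasis_hilb])
  next
    show "(\<lambda>c. matrix_coeff (\<rho> c) j m z) \<in> borel_measurable \<mu>" for z
      by (rule measurable_compose[OF rho_measurable matrix_coeff_measurable_irrep_borel])
  qed
  from measurable_compose[OF measurable_Pair[OF assms] this] show ?thesis by simp
qed

text \<open>
  Both \<open>B[f]\<close> and the symbol \<open>\<sigma>\<close> are of this form, the former with the kernel
  \<open>f y * a (- x + y)\<close> and the latter with \<open>\<kappa>\<close>.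
\<close>

definition fourier_field :: "('g \<Rightarrow> 'g \<Rightarrow> complex) \<Rightarrow> 'g \<times> 'g rep set \<Rightarrow> cop" where
  "fourier_field k = (\<lambda>(x, c). fourier M (k x) (\<rho> c))"

lemma fourier_rho_bounded_op:
  "integrable M f \<Longrightarrow> c \<in> unitary_dual \<Longrightarrow> bounded_op (fst (\<rho> c)) (fourier M f (\<rho> c))"
  using fourier_bounded_op[of f "fst (\<rho> c)" "snd (\<rho> c)"] rho_unitary[of c] by simp

lemma fourier_field_op_field:
  assumes k: "case_prod k \<in> borel_measurable (M \<Otimes>\<^sub>M M)" and int: "\<And>x. integrable M (k x)"
  shows "op_field (M \<Otimes>\<^sub>M \<mu>) (fdim \<rho>) (fourier_field k)"
proof -
  have bd: "bounded_op (fdim \<rho> p) (fourier_field k p)" if "p \<in> space (M \<Otimes>\<^sub>M \<mu>)" for p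
    using that fourier_rho_bounded_op[OF int]
    by (auto simp: space_pair_measure fdim_def fourier_field_def space_mu)
  moreover have "vector_field (M \<Otimes>\<^sub>M \<mu>) (fdim \<rho>) (\<lambda>p. fourier_field k p (v p))"
    if v: "vector_field (M \<Otimes>\<^sub>M \<mu>) (fdim \<rho>) v" for v
    unfolding vector_field_def
  proof (intro conjI ballI allI)
    fix p assume p: "p \<in> space (M \<Otimes>\<^sub>M \<mu>)"
    show "fourier_field k p (v p) \<in> hilb (fdim \<rho> p)"
      using bd[OF p] v p by (auto simp: bounded_op_def linear_op_def vector_field_def)
  next
    fix n
    have [measurable]: "(\<lambda>p. v p m) \<in> borel_measurable (M \<Otimes>\<^sub>M \<mu>)" for m
      using v by (auto simp: vector_field_def)
    have [measurable]: "(\<lambda>q. matrix_coeff (\<rho> (snd (fst q))) n m (snd q)) \<in> borel_measurable ((M \<Otimes>\<^sub>M \<mu>) \<Otimes>\<^sub>M M)" for m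
      by (rule matrix_coeff_measurable) measurable
    have [measurable]: "(\<lambda>q. k (fst (fst q)) (snd q)) \<in> borel_measurable ((M \<Otimes>\<^sub>M \<mu>) \<Otimes>\<^sub>M M)"
      using measurable_compose[OF _ k, of "\<lambda>q. (fst (fst q), snd q)" "(M \<Otimes>\<^sub>M \<mu>) \<Otimes>\<^sub>M M"] by simp
    have "(\<lambda>p. \<integral>z. k (fst p) z * (\<Sum>m. v p m * cnj (matrix_coeff (\<rho> (snd p)) n m z)) \<partial>M) \<in> borel_measurable (M \<Otimes>\<^sub>M \<mu>)"
      by (rule borel_measurable_lebesgue_integral) (unfold split_beta', measurable)
    then show "(\<lambda>p. fourier_field k p (v p) n) \<in> borel_measurable (M \<Otimes>\<^sub>M \<mu>)"
      by (simp add: fourier_field_def split_beta' fourier_def adjoint_op_coord)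
  qed
  ultimately show ?thesis by (auto simp: op_field_def)
qed

text \<open>
  The Plancherel formula is available for functions in \<open>L\<^sup>1 \<inter> L\<^sup>2\<close>; the kernels to which it can be
  applied for every value of the first variable, with a finite total, are the following.
\<close>

definition L2_kernel :: "('g \<Rightarrow> 'g \<Rightarrow> complex) \<Rightarrow> bool" where
  "L2_kernel k \<longleftrightarrow> case_prod k \<in> borel_measurable (M \<Otimes>\<^sub>M M) \<and>
    (\<forall>x. integrable M (k x)) \<and> (\<forall>x. k x \<in> L2 M) \<and>
    (\<integral>\<^sup>+x. \<integral>\<^sup>+y. ennreal ((cmod (k x y))\<^sup>2) \<partial>M \<partial>M) < \<infinity>"

lemma L2_kernel_L2:
  assumes "L2_kernel k" shows "case_prod k \<in> L2 (M \<Otimes>\<^sub>M M)"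
proof (rule L2I)
  show m [measurable]: "case_prod k \<in> borel_measurable (M \<Otimes>\<^sub>M M)"
    using assms by (simp add: L2_kernel_def)
  have "(\<integral>\<^sup>+p. ennreal ((cmod (case_prod k p))\<^sup>2) \<partial>(M \<Otimes>\<^sub>M M)) =
    (\<integral>\<^sup>+x. \<integral>\<^sup>+y. ennreal ((cmod (case_prod k (x, y)))\<^sup>2) \<partial>M \<partial>M)"
    by (rule nn_integral_fst[symmetric]) measurable
  then show "(\<integral>\<^sup>+p. ennreal ((cmod (case_prod k p))\<^sup>2) \<partial>(M \<Otimes>\<^sub>M M)) < \<infinity>"
    using assms by (simp add: L2_kernel_def)
qed

lemma L2_kernel_lincomb:
  assumes k: "L2_kernel k1" "L2_kernel k2"
  shows "L2_kernel (\<lambda>x y. k1 x y + c * k2 x y)"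
proof -
  have "(\<lambda>p. case_prod k1 p + c * case_prod k2 p) \<in> L2 (M \<Otimes>\<^sub>M M)"
    by (intro L2_add L2_scale L2_kernel_L2 k)
  then have l2: "(\<lambda>(x, y). k1 x y + c * k2 x y) \<in> L2 (M \<Otimes>\<^sub>M M)" by (simp add: split_beta')
  then have m [measurable]: "(\<lambda>(x, y). k1 x y + c * k2 x y) \<in> borel_measurable (M \<Otimes>\<^sub>M M)"
    by (simp add: L2_def)
  have "(\<integral>\<^sup>+x. \<integral>\<^sup>+y. ennreal ((cmod ((\<lambda>(x, y). k1 x y + c * k2 x y) (x, y)))\<^sup>2) \<partial>M \<partial>M) =
    (\<integral>\<^sup>+p. ennreal ((cmod ((\<lambda>(x, y). k1 x y + c * k2 x y) p))\<^sup>2) \<partial>(M \<Otimes>\<^sub>M M))"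
    by (rule nn_integral_fst) measurable
  with L2_nn_integral_finite[OF l2] m show ?thesis
    using k by (auto simp: L2_kernel_def intro!: L2_add L2_scale)
qed

text \<open>
  The Plancherel formula for each \<open>x\<close>, integrated over \<open>x\<close>.
\<close>

lemma nn_integral_hs_norm2_fourier_field:
  assumes "L2_kernel k"
  shows "(\<integral>\<^sup>+p. hs_norm2 (fdim \<rho> p) (fourier_field k p) \<partial>(M \<Otimes>\<^sub>M \<mu>)) =
    (\<integral>\<^sup>+p. ennreal ((cmod (case_prod k p))\<^sup>2) \<partial>(M \<Otimes>\<^sub>M M))"
proof -
  have m [measurable]: "case_prod k \<in> borel_measurable (M \<Otimes>\<^sub>M M)" and int: "\<And>x. integrable M (k x)"
    and l2: "\<And>x. k x \<in> L2 M"
    using assms by (auto simp: L2_kernel_def)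
  note hm = hs_norm2_measurable[OF fdim_measurable fourier_field_op_field[OF m int]]
  have "(\<integral>\<^sup>+p. hs_norm2 (fdim \<rho> p) (fourier_field k p) \<partial>(M \<Otimes>\<^sub>M \<mu>)) =
    (\<integral>\<^sup>+x. \<integral>\<^sup>+c. hs_norm2 (fdim \<rho> (x, c)) (fourier_field k (x, c)) \<partial>\<mu> \<partial>M)"
    by (rule mu.nn_integral_fst[OF hm, symmetric])
  also have "\<dots> = (\<integral>\<^sup>+x. \<integral>\<^sup>+y. ennreal ((cmod (k x y))\<^sup>2) \<partial>M \<partial>M)"
    using plancherel int l2 by (simp add: plancherel_measure_def fdim_def fourier_field_def)
  also have "\<dots> = (\<integral>\<^sup>+p. ennreal ((cmod (case_prod k p))\<^sup>2) \<partial>(M \<Otimes>\<^sub>M M))"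
    by (subst nn_integral_fst[symmetric]) auto
  finally show ?thesis .
qed

lemma fourier_field_L2_fields:
  assumes "L2_kernel k"
  shows "fourier_field k \<in> L2_fields (M \<Otimes>\<^sub>M \<mu>) (fdim \<rho>)"
  using fourier_field_op_field[of k] nn_integral_hs_norm2_fourier_field[OF assms]
    L2_nn_integral_finite[OF L2_kernel_L2[OF assms]] assms
  by (auto simp: L2_fields_def L2_kernel_def)

lemma integral_hs_norm2_fourier_field:
  assumes "L2_kernel k"
  shows "(\<integral>p. enn2real (hs_norm2 (fdim \<rho> p) (fourier_field k p)) \<partial>(M \<Otimes>\<^sub>M \<mu>)) =
    (\<integral>p. (cmod (case_prod k p))\<^sup>2 \<partial>(M \<Otimes>\<^sub>M M))"
proof -
  have m [measurable]: "case_prod k \<in> borel_measurable (M \<Otimes>\<^sub>M M)"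
    using assms by (simp add: L2_kernel_def)
  show ?thesis
    unfolding L2_fields_hs_norm2(3)[OF fdim_measurable fourier_field_L2_fields[OF assms]]
      nn_integral_hs_norm2_fourier_field[OF assms]
    by (rule integral_eq_nn_integral[symmetric]) auto
qed

end

lemma L2_norm_expand:
  assumes f: "f \<in> L2 N" and g: "g \<in> L2 N"
  shows "(\<integral>x. (cmod (f x + c * g x))\<^sup>2 \<partial>N) =
    (\<integral>x. (cmod (f x))\<^sup>2 \<partial>N) + (cmod c)\<^sup>2 * (\<integral>x. (cmod (g x))\<^sup>2 \<partial>N) + 2 * Re (cnj c * (\<integral>x. f x * cnj (g x) \<partial>N))"
proof -
  have i: "integrable N (\<lambda>x. f x * cnj (g x))" by (rule L2_mult_integrable[OF f L2_cnj[OF g]])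
  have intc: "integrable N (\<lambda>x. cnj c * (f x * cnj (g x)))" using i by simp
  then have intr: "integrable N (\<lambda>x. 2 * Re (cnj c * (f x * cnj (g x))))"
    by - (rule integrable_mult_right, rule integrable_Re)
  have "(\<lambda>x. (cmod (f x + c * g x))\<^sup>2) =
    (\<lambda>x. (cmod (f x))\<^sup>2 + (cmod c)\<^sup>2 * (cmod (g x))\<^sup>2 + 2 * Re (cnj c * (f x * cnj (g x))))"
    unfolding cmod_power2 by (intro ext) (simp add: power2_eq_square algebra_simps)
  moreover have "(\<integral>x. 2 * Re (cnj c * (f x * cnj (g x))) \<partial>N) = 2 * Re (cnj c * (\<integral>x. f x * cnj (g x) \<partial>N))"
    using integral_Re[OF intc] by (simp only: integral_mult_right_zero)
  moreover have "(\<integral>x. (cmod c)\<^sup>2 * (cmod (g x))\<^sup>2 \<partial>N) = (cmod c)\<^sup>2 * (\<integral>x. (cmod (g x))\<^sup>2 \<partial>N)"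
    by (rule integral_mult_right_zero)
  moreover have "integrable N (\<lambda>x. (cmod (f x))\<^sup>2)" "integrable N (\<lambda>x. (cmod (g x))\<^sup>2)"
    using f g by (auto simp: L2_def)
  ultimately show ?thesis
    using intr by (simp only: Bochner_Integration.integral_add Bochner_Integration.integrable_add
          integrable_mult_right)
qed

context plancherel_group
begin

text \<open>
  Polarization of \<open>integral_hs_norm2_fourier_field\<close>. The map from kernels to fields is linear, so
  \<open>k1 + c k2\<close> has the same norm as its field; comparing the cross terms in both expansions for
  \<open>c = 1\<close> and \<open>c = \<i>\<close> gives the identity of the inner products.
\<close>

lemma fourier_field_Parseval:
  assumes k: "L2_kernel k1" "L2_kernel k2"
  shows "L2_fields_inner (M \<Otimes>\<^sub>M \<mu>) (fdim \<rho>) (fourier_field k1) (fourier_field k2) =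
    (\<integral>p. case_prod k1 p * cnj (case_prod k2 p) \<partial>(M \<Otimes>\<^sub>M M))" (is "?A = ?B")
proof -
  have "Re (cnj c * ?A) = Re (cnj c * ?B)" for c
  proof -
    let ?k = "\<lambda>x y. k1 x y + c * k2 x y"
    have kc: "L2_kernel ?k" by (rule L2_kernel_lincomb[OF k])
    have W: "fourier_field ?k p (ebasis j) =
        (\<lambda>n. 1 * fourier_field k1 p (ebasis j) n + c * fourier_field k2 p (ebasis j) n)"
      if p: "p \<in> space (M \<Otimes>\<^sub>M \<mu>)" and j: "enat j < fdim \<rho> p" for p j
    proof -
      obtain x d where [simp]: "p = (x, d)" by (cases p)
      have r: "unitary_rep (fst (\<rho> d), snd (\<rho> d))"
        using p rho_unitary by (simp add: space_pair_measure space_mu)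
      have e: "ebasis j \<in> hilb (fst (\<rho> d))"
        using j by (intro ebasis_hilb) (simp add: fdim_def)
      have i: "integrable M (k1 x)" "integrable M (k2 x)" using k by (auto simp: L2_kernel_def)
      have "(\<integral>z. (k1 x z + c * k2 x z) * snd (\<rho> d) (- z) (ebasis j) n \<partial>M) =
        (\<integral>z. k1 x z * snd (\<rho> d) (- z) (ebasis j) n \<partial>M) + c * (\<integral>z. k2 x z * snd (\<rho> d) (- z) (ebasis j) n \<partial>M)" for n
        using fourier_integrable[OF i(1) r e, of uminus] fourier_integrable[OF i(2) r e, of uminus]
        by (simp add: distrib_right mult.assoc)
      then show ?thesis
        using fourier_unitary_rep[OF r e] by (simp add: fourier_field_def)
    qed
    have op: "op_field (M \<Otimes>\<^sub>M \<mu>) (fdim \<rho>) (fourier_field ?k)"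
      using fourier_field_L2_fields[OF kc] by (simp add: L2_fields_def)
    have "(\<integral>p. (cmod (case_prod ?k p))\<^sup>2 \<partial>(M \<Otimes>\<^sub>M M)) =
      (\<integral>p. (cmod (case_prod k1 p))\<^sup>2 \<partial>(M \<Otimes>\<^sub>M M)) + (cmod c)\<^sup>2 * (\<integral>p. (cmod (case_prod k2 p))\<^sup>2 \<partial>(M \<Otimes>\<^sub>M M))
        + 2 * Re (cnj c * ?A)"
      using L2_fields_expand[OF fdim_measurable fourier_field_L2_fields[OF k(1)] fourier_field_L2_fields[OF k(2)] W op]
      by (simp only: integral_hs_norm2_fourier_field k kc)
    moreover have "(\<integral>p. (cmod (case_prod ?k p))\<^sup>2 \<partial>(M \<Otimes>\<^sub>M M)) =
      (\<integral>p. (cmod (case_prod k1 p))\<^sup>2 \<partial>(M \<Otimes>\<^sub>M M)) + (cmod c)\<^sup>2 * (\<integral>p. (cmod (case_prod k2 p))\<^sup>2 \<partial>(M \<Otimes>\<^sub>M M))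
        + 2 * Re (cnj c * ?B)"
      using L2_norm_expand[OF L2_kernel_L2[OF k(1)] L2_kernel_L2[OF k(2)], of c]
      by (simp add: split_beta')
    ultimately show ?thesis by simp
  qed
  from this[of 1] this[of \<i>] show ?thesis by (simp add: complex_eq_iff)
qed

end

section \<open>The Wick quantization as a convolution\<close>

text \<open>
  Test against the difference. This removes the ambiguity in the choice of the adjoint, which is
  only determined up to null sets.
\<close>

lemma L2_inner_determines:
  assumes "h \<in> L2 N" "h' \<in> L2 N" and eq: "\<And>g. g \<in> L2 N \<Longrightarrow> L2_inner N h g = L2_inner N h' g"
  shows "AE x in N. h x = h' x"
proof -
  let ?g = "\<lambda>x. h x - h' x"
  have g: "?g \<in> L2 N" using assms(1,2) by (rule L2_diff)
  then have [measurable]: "?g \<in> borel_measurable N" by (simp add: L2_def)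
  have "(\<integral>x. ?g x * cnj (?g x) \<partial>N) = 0"
  proof -
    have "integrable N (\<lambda>x. h x * cnj (?g x))" "integrable N (\<lambda>x. h' x * cnj (?g x))"
      by (intro L2_mult_integrable[OF _ L2_cnj[OF g]] assms)+
    then have "(\<integral>x. h x * cnj (?g x) - h' x * cnj (?g x) \<partial>N) = L2_inner N h ?g - L2_inner N h' ?g"
      unfolding L2_inner_def by (rule Bochner_Integration.integral_diff)
    then show ?thesis using eq[OF g] by (simp only: left_diff_distrib) simp
  qed
  then have "complex_of_real (\<integral>x. (cmod (?g x))\<^sup>2 \<partial>N) = 0"
    by (simp only: complex_norm_square[symmetric] integral_complex_of_real)
  then have "(\<integral>x. (cmod (?g x))\<^sup>2 \<partial>N) = 0" by (simp only: of_real_eq_0_iff)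
  moreover have "integrable N (\<lambda>x. (cmod (?g x))\<^sup>2)" using g by (simp add: L2_def)
  ultimately have "AE x in N. (cmod (?g x))\<^sup>2 = 0"
    by (subst (asm) integral_nonneg_eq_0_iff_AE) auto
  then show ?thesis by eventually_elim simp
qed

locale wick_setting = wick_kernel_data M a k s A + plancherel_group M \<rho> \<mu>
  for M :: "'g::{topological_group_add, t2_space, second_countable_topology} measure"
    and a k s A \<rho> \<mu>
begin

text \<open>
  The function \<open>f\<close> seen through the window \<open>a\<close> placed at \<open>x\<close>; its Fourier transform is
  \<open>B[f](x, \<cdot>)\<close>.
\<close>

definition window :: "('g \<Rightarrow> complex) \<Rightarrow> 'g \<Rightarrow> 'g \<Rightarrow> complex" where
  "window f x y = f y * a (- x + y)"

lemma wick_B_eq: "wick_B M \<rho> a f = fourier_field (window f)"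
  by (simp add: wick_B_def fourier_field_def window_def[abs_def])

lemma window_measurable:
  assumes "f \<in> borel_measurable M" shows "case_prod (window f) \<in> borel_measurable (M \<Otimes>\<^sub>M M)"
proof -
  note [measurable] = assms
  show ?thesis unfolding window_def split_beta' by measurable
qed

lemma window_L1_L2:
  assumes f: "f \<in> L2 M"
  shows "integrable M (window f x)" "window f x \<in> L2 M"
proof -
  have [measurable]: "f \<in> borel_measurable M" using f by (simp add: L2_def)
  show "integrable M (window f x)"
    using L2_mult_integrable[OF f L2_preserving[OF preserving_left a_L2]] by (simp add: window_def[abs_def])
  show "window f x \<in> L2 M"
    using L2_mult_bounded[OF f _ a_bound, of "\<lambda>y. - x + y"] by (simp add: window_def[abs_def])
qed

text \<open>
  This is the isometry property of \<open>B\<close> on the side of kernels: the reflected translates of \<open>a\<close>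
  are unit vectors.
\<close>

lemma nn_integral_window:
  assumes [measurable]: "f \<in> borel_measurable M"
  shows "(\<integral>\<^sup>+x. \<integral>\<^sup>+y. ennreal ((cmod (window f x y))\<^sup>2) \<partial>M \<partial>M) = (\<integral>\<^sup>+y. ennreal ((cmod (f y))\<^sup>2) \<partial>M)"
proof -
  have "(\<integral>\<^sup>+x. \<integral>\<^sup>+y. ennreal ((cmod (window f x y))\<^sup>2) \<partial>M \<partial>M) =
    (\<integral>\<^sup>+y. \<integral>\<^sup>+x. ennreal ((cmod (f y))\<^sup>2) * ennreal ((cmod (a (- x + y)))\<^sup>2) \<partial>M \<partial>M)"
    unfolding window_def norm_mult power_mult_distrib
    by (subst MM.Fubini') (auto simp: ennreal_mult)
  also have "\<dots> = (\<integral>\<^sup>+y. ennreal ((cmod (f y))\<^sup>2) * (\<integral>\<^sup>+x. ennreal ((cmod (a (- x + y)))\<^sup>2) \<partial>M) \<partial>M)"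
    by (intro nn_integral_cong nn_integral_cmult) measurable
  also have "(\<lambda>y. \<integral>\<^sup>+x. ennreal ((cmod (a (- x + y)))\<^sup>2) \<partial>M) = (\<lambda>_. 1)"
    using nn_integral_preserving[OF preserving_reflect_right, of "\<lambda>z. ennreal ((cmod (a z))\<^sup>2)"]
    by (simp add: nn_integral_a)
  finally show ?thesis by simp
qed

lemma window_L2_kernel:
  assumes f: "f \<in> L2 M" shows "L2_kernel (window f)"
proof -
  have m: "f \<in> borel_measurable M" using f by (simp add: L2_def)
  show ?thesis
    unfolding L2_kernel_def nn_integral_window[OF m]
    using window_measurable[OF m] window_L1_L2[OF f] L2_nn_integral_finite[OF f] by simp
qed

text \<open>
  By \<open>fourier_group_conv\<close> this is the kernel whose Fourier transform is the composition of
  \<open>\<sigma>(x, \<cdot>)\<close> with \<open>B[f](x, \<cdot>)\<close>.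
\<close>

definition windowed_conv :: "('g \<Rightarrow> complex) \<Rightarrow> 'g \<Rightarrow> 'g \<Rightarrow> complex" where
  "windowed_conv f x = group_conv M (window f x) (k x)"

lemma windowed_conv_diff:
  assumes "f \<in> L2 M"
  shows "windowed_conv f x y = (\<integral>w. window f x (y - w) * k x w \<partial>M)"
  unfolding windowed_conv_def using window_L1_L2(1)[OF assms, of x] k_int
  by (intro group_conv_diff) auto

lemma norm_conv_le:
  assumes [measurable]: "u \<in> borel_measurable M" "v \<in> borel_measurable M"
    and v: "AE w in M. cmod (v w) \<le> s w"
  shows "ennreal (cmod (\<integral>w. u (y - w) * v w \<partial>M)) \<le> (\<integral>\<^sup>+w. ennreal (cmod (u (y - w)) * s w) \<partial>M)"
proof (cases "integrable M (\<lambda>w. u (y - w) * v w)")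
  case True
  then have "ennreal (cmod (\<integral>w. u (y - w) * v w \<partial>M)) \<le> (\<integral>\<^sup>+w. ennreal (cmod (u (y - w) * v w)) \<partial>M)"
    by (rule integral_norm_bound_ennreal)
  also have "\<dots> \<le> (\<integral>\<^sup>+w. ennreal (cmod (u (y - w)) * s w) \<partial>M)"
    using v by (intro nn_integral_mono_AE, eventually_elim)
      (auto simp: norm_mult intro!: ennreal_leI mult_left_mono)
  finally show ?thesis .
qed (simp add: not_integrable_integral_eq)

lemma nn_integral_norm_conv_le:
  assumes [measurable]: "u \<in> borel_measurable M" "\<And>y. v y \<in> borel_measurable M"
    and v: "\<And>y. AE w in M. cmod (v y w) \<le> s w"
  shows "(\<integral>\<^sup>+y. ennreal ((cmod (\<integral>w. u (y - w) * v y w \<partial>M))\<^sup>2) \<partial>M) \<le>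
    (\<integral>\<^sup>+w. ennreal (s w) \<partial>M)\<^sup>2 * (\<integral>\<^sup>+x. ennreal ((cmod (u x))\<^sup>2) \<partial>M)"
proof -
  have "(\<integral>\<^sup>+y. ennreal ((cmod (\<integral>w. u (y - w) * v y w \<partial>M))\<^sup>2) \<partial>M) \<le>
    (\<integral>\<^sup>+y. (\<integral>\<^sup>+w. ennreal (cmod (u (y - w)) * s w) \<partial>M)\<^sup>2 \<partial>M)"
    by (intro nn_integral_mono, subst ennreal_power[symmetric], simp)
      (intro power_mono norm_conv_le v, auto)
  also have "\<dots> \<le> (\<integral>\<^sup>+w. ennreal (s w) \<partial>M)\<^sup>2 * (\<integral>\<^sup>+x. ennreal ((cmod (u x))\<^sup>2) \<partial>M)"
    by (rule Young_L2_L1) (auto simp: s_nonneg)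
  finally show ?thesis .
qed

text \<open>
  By Young's inequality, convolution with \<open>k x\<close> multiplies the norm in \<open>L\<^sup>2\<close> by at most the
  integral of \<open>s\<close>, for all \<open>x\<close> alike; the bound for \<open>window f\<close> therefore carries over.
\<close>

lemma windowed_conv_L2_kernel:
  assumes f: "f \<in> L2 M" shows "L2_kernel (windowed_conv f)"
proof -
  have [measurable]: "f \<in> borel_measurable M" using f by (simp add: L2_def)
  have [measurable]: "window f x \<in> borel_measurable M" for x
    using window_L1_L2(1)[OF f] by auto
  note [measurable] = window_measurable[OF \<open>f \<in> borel_measurable M\<close>]
  have m [measurable]: "case_prod (windowed_conv f) \<in> borel_measurable (M \<Otimes>\<^sub>M M)"
    unfolding windowed_conv_def group_conv_def window_def split_beta' by measurable
  have i: "integrable M (windowed_conv f x)" for x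
    unfolding windowed_conv_def by (intro group_conv_integrable window_L1_L2 f k_int)
  let ?C = "(\<integral>\<^sup>+w. ennreal (s w) \<partial>M)\<^sup>2"
  have C: "?C < \<infinity>" using nn_integral_s by (simp add: power_less_top_ennreal)
  have b: "(\<integral>\<^sup>+y. ennreal ((cmod (windowed_conv f x y))\<^sup>2) \<partial>M) \<le> ?C * (\<integral>\<^sup>+y. ennreal ((cmod (window f x y))\<^sup>2) \<partial>M)" for x
    unfolding windowed_conv_diff[OF f] using k_int by (intro nn_integral_norm_conv_le k_le_s) auto
  have l2: "windowed_conv f x \<in> L2 M" for x
  proof (rule L2I)
    show "windowed_conv f x \<in> borel_measurable M" using i by auto
    show "(\<integral>\<^sup>+y. ennreal ((cmod (windowed_conv f x y))\<^sup>2) \<partial>M) < \<infinity>"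
      using order_le_less_trans[OF b[of x]] C L2_nn_integral_finite[OF window_L1_L2(2)[OF f, of x]]
      by (simp add: ennreal_mult_less_top)
  qed
  have "(\<integral>\<^sup>+x. \<integral>\<^sup>+y. ennreal ((cmod (windowed_conv f x y))\<^sup>2) \<partial>M \<partial>M) \<le>
    (\<integral>\<^sup>+x. ?C * (\<integral>\<^sup>+y. ennreal ((cmod (window f x y))\<^sup>2) \<partial>M) \<partial>M)"
    by (intro nn_integral_mono b)
  also have "\<dots> = ?C * (\<integral>\<^sup>+y. ennreal ((cmod (f y))\<^sup>2) \<partial>M)"
    by (subst nn_integral_cmult) (auto simp: nn_integral_window)
  also have "\<dots> < \<infinity>"
    using C L2_nn_integral_finite[OF f] by (simp add: ennreal_mult_less_top)
  finally show ?thesis using m i l2 by (simp add: L2_kernel_def)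
qed

definition wick_conv :: "('g \<Rightarrow> complex) \<Rightarrow> 'g \<Rightarrow> complex" where
  "wick_conv f y = group_conv M f (K y) y"

lemma wick_conv_diff:
  assumes "f \<in> borel_measurable M" shows "wick_conv f y = (\<integral>w. f (y - w) * K y w \<partial>M)"
  unfolding wick_conv_def using assms K_int by (intro group_conv_diff) auto

lemma wick_conv_measurable:
  assumes [measurable]: "f \<in> borel_measurable M" shows "wick_conv f \<in> borel_measurable M"
proof -
  have "(\<lambda>y. \<integral>w. f (y - w) * K y w \<partial>M) \<in> borel_measurable M" by measurable
  moreover have "wick_conv f = (\<lambda>y. \<integral>w. f (y - w) * K y w \<partial>M)"
    using wick_conv_diff[OF assms] by (rule ext)
  ultimately show ?thesis by simp
qed

lemma wick_conv_L2:
  assumes f: "f \<in> L2 M" shows "wick_conv f \<in> L2 M"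
proof (rule L2I)
  have fm [measurable]: "f \<in> borel_measurable M" using f by (simp add: L2_def)
  then show "wick_conv f \<in> borel_measurable M" by (rule wick_conv_measurable)
  have "(\<integral>\<^sup>+y. ennreal ((cmod (wick_conv f y))\<^sup>2) \<partial>M) \<le>
    (\<integral>\<^sup>+w. ennreal (s w) \<partial>M)\<^sup>2 * (\<integral>\<^sup>+x. ennreal ((cmod (f x))\<^sup>2) \<partial>M)"
    unfolding wick_conv_diff[OF fm]
    by (rule nn_integral_norm_conv_le) (use K_int K_le_s in \<open>auto elim!: eventually_mono\<close>)
  also have "\<dots> < \<infinity>"
    using nn_integral_s L2_nn_integral_finite[OF f] by (simp add: power_less_top_ennreal ennreal_mult_less_top)
  finally show "(\<integral>\<^sup>+y. ennreal ((cmod (wick_conv f y))\<^sup>2) \<partial>M) < \<infinity>" .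
qed

text \<open>
  The inner integral over \<open>x\<close> is at most \<open>s w\<close> times the modulus of \<open>f (y - w) * g y\<close>, by
  \<open>nn_integral_integrand\<close>; the rest is the pairing of \<open>\<bar>g\<bar>\<close> with the convolution of
  \<open>\<bar>f\<bar>\<close> and \<open>s\<close>, finite by Young's inequality.
\<close>

lemma triple_integral_finite:
  assumes f: "f \<in> L2 M" and g: "g \<in> L2 M"
  shows "(\<integral>\<^sup>+y. \<integral>\<^sup>+w. \<integral>\<^sup>+x. ennreal (cmod (f (y - w) * cnj (g y) *
    (a (- x + y - w) * cnj (a (- x + y)) * k x w))) \<partial>M \<partial>M \<partial>M) < \<infinity>"
proof -
  have [measurable]: "f \<in> borel_measurable M" "g \<in> borel_measurable M" using f g by (auto simp: L2_def)
  (* the convolution of the modulus of f with s *)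
  define Y where "Y = (\<lambda>y. \<integral>\<^sup>+w. ennreal (cmod (f (y - w)) * s w) \<partial>M)"
  have [measurable]: "Y \<in> borel_measurable M" unfolding Y_def by measurable
  have "(\<integral>\<^sup>+w. \<integral>\<^sup>+x. ennreal (cmod (f (y - w) * cnj (g y) *
      (a (- x + y - w) * cnj (a (- x + y)) * k x w))) \<partial>M \<partial>M) \<le> ennreal (cmod (g y)) * Y y" for y
  proof -
    have "(\<integral>\<^sup>+w. \<integral>\<^sup>+x. ennreal (cmod (f (y - w) * cnj (g y) *
      (a (- x + y - w) * cnj (a (- x + y)) * k x w))) \<partial>M \<partial>M) =
      (\<integral>\<^sup>+w. ennreal (cmod (g y)) * ennreal (cmod (f (y - w))) *
        (\<integral>\<^sup>+x. ennreal (cmod (a (- x + y - w) * cnj (a (- x + y)) * k x w)) \<partial>M) \<partial>M)"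
      by (intro nn_integral_cong, subst nn_integral_cmult[symmetric])
        (auto simp: norm_mult ennreal_mult ac_simps)
    also have "\<dots> \<le> (\<integral>\<^sup>+w. ennreal (cmod (g y)) * ennreal (cmod (f (y - w)) * s w) \<partial>M)"
      using nn_integral_integrand
      by (intro nn_integral_mono_AE, eventually_elim)
        (auto simp: ennreal_mult s_nonneg mult.assoc intro!: mult_left_mono)
    also have "\<dots> = ennreal (cmod (g y)) * Y y"
      unfolding Y_def by (rule nn_integral_cmult) measurable
    finally show ?thesis .
  qed
  then have "(\<integral>\<^sup>+y. \<integral>\<^sup>+w. \<integral>\<^sup>+x. ennreal (cmod (f (y - w) * cnj (g y) *
      (a (- x + y - w) * cnj (a (- x + y)) * k x w))) \<partial>M \<partial>M \<partial>M) \<le>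
      (\<integral>\<^sup>+y. ennreal (cmod (g y)) * Y y \<partial>M)"
    by (intro nn_integral_mono)
  also have "\<dots> < \<infinity>"
  proof -
    have "(\<integral>\<^sup>+y. ennreal (cmod (g y)) * Y y \<partial>M)\<^sup>2 \<le>
      (\<integral>\<^sup>+y. (ennreal (cmod (g y)))\<^sup>2 \<partial>M) * (\<integral>\<^sup>+y. (Y y)\<^sup>2 \<partial>M)"
      by (rule Cauchy_Schwarz_nn_integral) measurable
    also have "\<dots> \<le> (\<integral>\<^sup>+y. ennreal ((cmod (g y))\<^sup>2) \<partial>M) *
      ((\<integral>\<^sup>+w. ennreal (s w) \<partial>M)\<^sup>2 * (\<integral>\<^sup>+x. ennreal ((cmod (f x))\<^sup>2) \<partial>M))"
      unfolding Y_def by (intro mult_mono Young_L2_L1) (auto simp: s_nonneg ennreal_power)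
    also have "\<dots> < \<infinity>"
      using nn_integral_s L2_nn_integral_finite[OF f] L2_nn_integral_finite[OF g]
      by (simp add: power_less_top_ennreal ennreal_mult_less_top)
    finally show ?thesis by (simp add: power_less_top_ennreal)
  qed
  finally show ?thesis .
qed

text \<open>
  Both sides are integrals of the same function \<open>Q y w x\<close>. Integrating
  over \<open>x\<close> first assembles the Wick kernel at \<open>(y, w)\<close>; integrating over \<open>w\<close> first
  assembles the convolution of the windowed function with \<open>k x\<close>, paired with the window of \<open>g\<close>.
\<close>

lemma wick_conv_inner:
  assumes f: "f \<in> L2 M" and g: "g \<in> L2 M"
  shows "L2_inner M (wick_conv f) g =
    (\<integral>p. case_prod (windowed_conv f) p * cnj (case_prod (window g) p) \<partial>(M \<Otimes>\<^sub>M M))"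
proof -
  have fm [measurable]: "f \<in> borel_measurable M" and gm [measurable]: "g \<in> borel_measurable M"
    using f g by (auto simp: L2_def)
  define Q where "Q = (\<lambda>y w x. f (y - w) * cnj (g y) * (a (- x + y - w) * cnj (a (- x + y)) * k x w))"
  have fin: "(\<integral>\<^sup>+y. \<integral>\<^sup>+w. \<integral>\<^sup>+x. ennreal (cmod (Q y w x)) \<partial>M \<partial>M \<partial>M) < \<infinity>"
    unfolding Q_def by (rule triple_integral_finite[OF f g])
  have ae: "AE y in M. (\<integral>\<^sup>+w. \<integral>\<^sup>+x. ennreal (cmod (Q y w x)) \<partial>M \<partial>M) \<noteq> \<infinity>"
    using fin unfolding Q_def by (intro nn_integral_PInf_AE) auto
  have left: "(\<integral>w. \<integral>x. Q y w x \<partial>M \<partial>M) = wick_conv f y * cnj (g y)" for y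
  proof -
    have "(\<integral>x. Q y w x \<partial>M) = f (y - w) * K y w * cnj (g y)" for w
      by (simp add: Q_def wick_kernel_def)
    then show ?thesis by (simp add: wick_conv_diff[OF fm])
  qed
  have right: "(\<integral>x. \<integral>w. Q y w x \<partial>M \<partial>M) = (\<integral>x. windowed_conv f x y * cnj (window g x y) \<partial>M)" for y
  proof (rule Bochner_Integration.integral_cong[OF refl])
    fix x
    have "windowed_conv f x y * cnj (window g x y) = (\<integral>w. window f x (y - w) * k x w * cnj (window g x y) \<partial>M)"
      by (simp add: windowed_conv_diff[OF f])
    also have "(\<lambda>w. window f x (y - w) * k x w * cnj (window g x y)) = (\<lambda>w. Q y w x)"
      by (simp add: Q_def window_def add_diff_eq ac_simps)
    finally show "(\<integral>w. Q y w x \<partial>M) = windowed_conv f x y * cnj (window g x y)" ..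
  qed
  have "integrable (M \<Otimes>\<^sub>M M) (\<lambda>p. case_prod (windowed_conv f) p * cnj (case_prod (window g) p))"
    by (intro L2_mult_integrable L2_cnj L2_kernel_L2 windowed_conv_L2_kernel window_L2_kernel f g)
  then have int: "integrable (M \<Otimes>\<^sub>M M) (\<lambda>(x, y). windowed_conv f x y * cnj (window g x y))"
    by (simp add: split_beta')
  have meas: "(\<lambda>y. \<integral>x. windowed_conv f x y * cnj (window g x y) \<partial>M) \<in> borel_measurable M"
    using MM.integrable_snd[OF int] by auto
  have "L2_inner M (wick_conv f) g = (\<integral>y. \<integral>x. windowed_conv f x y * cnj (window g x y) \<partial>M \<partial>M)"
    unfolding L2_inner_def
  proof (rule integral_cong_AE[OF _ meas])
    show "(\<lambda>y. wick_conv f y * cnj (g y)) \<in> borel_measurable M"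
      using wick_conv_measurable[OF fm] by measurable
    show "AE y in M. wick_conv f y * cnj (g y) = (\<integral>x. windowed_conv f x y * cnj (window g x y) \<partial>M)"
      using ae
    proof eventually_elim
      case (elim y)
      have "(\<integral>w. \<integral>x. Q y w x \<partial>M \<partial>M) = (\<integral>x. \<integral>w. Q y w x \<partial>M \<partial>M)"
      proof (rule MM.Fubini_absolute(1))
        show "(\<lambda>(w, x). Q y w x) \<in> borel_measurable (M \<Otimes>\<^sub>M M)" unfolding Q_def by measurable
        show "(\<integral>\<^sup>+w. \<integral>\<^sup>+x. ennreal (cmod (Q y w x)) \<partial>M \<partial>M) < \<infinity>"
          using elim by (simp add: less_top)
      qed
      then show ?case by (simp only: left right)
    qed
  qed
  also have "\<dots> = (\<integral>p. case_prod (windowed_conv f) p * cnj (case_prod (window g) p) \<partial>(M \<Otimes>\<^sub>M M))"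
    using MM.integral_snd[OF int] by (simp add: split_beta')
  finally show ?thesis .
qed

text \<open>
  The field \<open>\<sigma> B[f]\<close> agrees fibrewise with the Fourier field of \<open>windowed_conv f\<close>. By Parseval's
  identity and \<open>wick_conv_inner\<close>, pairing it with \<open>B[g]\<close> is pairing \<open>wick_conv f\<close> with
  \<open>g\<close>. Hence \<open>wick_conv f\<close> satisfies the condition that defines the adjoint, and so does the
  value selected by the adjoint, which is then equal to it almost everywhere.
\<close>

lemma Op_Wick_eq_wick_conv:
  assumes \<sigma>: "conv_kernel M \<rho> \<sigma> \<kappa>" and \<kappa>: "\<And>x. integrable M (\<kappa> x)" "\<And>x. AE w in M. k x w = \<kappa> x w"
    and f: "f \<in> L2 M"
  shows "AE x in M. Op_Wick M \<mu> \<rho> a \<sigma> f x = wick_conv f x"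
proof -
  have ru: "unitary_rep (fst (\<rho> c), snd (\<rho> c))" if "c \<in> unitary_dual" for c
    using that by (rule rho_unitary)
  have \<sigma>k: "\<sigma> (x, c) u = fourier M (k x) (\<rho> c) u" if c: "c \<in> unitary_dual" and u: "u \<in> hilb (fst (\<rho> c))" for x c u
  proof -
    have "fourier M (\<kappa> x) (\<rho> c) u = fourier M (k x) (\<rho> c) u"
      using fourier_cong_AE[OF \<kappa>(2)[of x] _ _ ru[OF c] u] \<kappa>(1)[of x] k_int[of x] by simp
    then show ?thesis using \<sigma> c u by (simp add: conv_kernel_def)
  qed
  have \<sigma>field: "\<sigma> p u = fourier_field k p u" if "p \<in> space (M \<Otimes>\<^sub>M \<mu>)" "u \<in> hilb (fdim \<rho> p)" for p u
    using that \<sigma>k by (auto simp: space_pair_measure space_mu fdim_def fourier_field_def)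
  have Linf: "\<sigma> \<in> Linf_fields (M \<Otimes>\<^sub>M \<mu>) (fdim \<rho>)"
  proof -
    have "op_field (M \<Otimes>\<^sub>M \<mu>) (fdim \<rho>) \<sigma>"
      using fourier_field_op_field[OF k_meas k_int] \<sigma>field by (rule op_field_cong)
    moreover have "vnorm (\<sigma> p u) \<le> (\<integral>w. s w \<partial>M) * vnorm u"
      if p: "p \<in> space (M \<Otimes>\<^sub>M \<mu>)" and u: "u \<in> hilb (fdim \<rho> p)" for p u
    proof -
      obtain x c where pc: "p = (x, c)" by (cases p)
      have c: "c \<in> unitary_dual" using p by (simp add: pc space_pair_measure space_mu)
      have u': "u \<in> hilb (fst (\<rho> c))" using u by (simp add: pc fdim_def)
      have "vnorm (\<sigma> p u) \<le> (\<integral>w. cmod (k x w) \<partial>M) * vnorm u"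
        using fourier_hilb(2)[OF k_int ru[OF c] u', of x] \<sigma>k[OF c u', of x] by (simp add: pc)
      also have "\<dots> \<le> (\<integral>w. s w \<partial>M) * vnorm u"
        using k_int s_int k_le_s vnorm_nonneg[OF u] by (intro mult_right_mono integral_mono_AE) auto
      finally show ?thesis .
    qed
    ultimately show ?thesis unfolding Linf_fields_def by blast
  qed
  define \<tau> where "\<tau> = (\<lambda>p. \<sigma> p \<circ> wick_B M \<rho> a f p)"
  have \<tau>: "\<tau> p u = fourier_field (windowed_conv f) p u" if p: "p \<in> space (M \<Otimes>\<^sub>M \<mu>)" and u: "u \<in> hilb (fdim \<rho> p)" for p u
  proof -
    obtain x c where pc: "p = (x, c)" by (cases p)
    have c: "c \<in> unitary_dual" using p by (simp add: pc space_pair_measure space_mu)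
    have u': "u \<in> hilb (fst (\<rho> c))" using u by (simp add: pc fdim_def)
    note w = window_L1_L2(1)[OF f, of x]
    have "fourier M (window f x) (\<rho> c) u \<in> hilb (fst (\<rho> c))"
      using fourier_hilb(1)[OF w ru[OF c] u'] by simp
    from \<sigma>k[OF c this, of x] show ?thesis
      using fourier_group_conv[OF w k_int ru[OF c] u', of x]
      by (simp add: \<tau>_def pc wick_B_eq fourier_field_def windowed_conv_def)
  qed
  have \<tau>L2: "\<tau> \<in> L2_fields (M \<Otimes>\<^sub>M \<mu>) (fdim \<rho>)"
    using fourier_field_L2_fields[OF windowed_conv_L2_kernel[OF f]] \<tau> by (rule L2_fields_cong)
  have inner: "L2_inner M (wick_conv f) g = L2_fields_inner (M \<Otimes>\<^sub>M \<mu>) (fdim \<rho>) \<tau> (wick_B M \<rho> a g)"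
    if g: "g \<in> L2 M" for g
  proof -
    have "L2_fields_inner (M \<Otimes>\<^sub>M \<mu>) (fdim \<rho>) \<tau> (wick_B M \<rho> a g) =
      L2_fields_inner (M \<Otimes>\<^sub>M \<mu>) (fdim \<rho>) (fourier_field (windowed_conv f)) (fourier_field (window g))"
      unfolding L2_fields_inner_def wick_B_eq
      by (intro Bochner_Integration.integral_cong[OF refl] hs_inner_cong \<tau>)
    also have "\<dots> = L2_inner M (wick_conv f) g"
      unfolding wick_conv_inner[OF f g]
      by (rule fourier_field_Parseval[OF windowed_conv_L2_kernel[OF f] window_L2_kernel[OF g]])
    finally show ?thesis ..
  qed
  (* the condition under the choice operator in the definition of the adjoint *)
  define P where "P = (\<lambda>h. h \<in> L2 M \<and>
    (\<forall>g\<in>L2 M. L2_inner M h g = L2_fields_inner (M \<Otimes>\<^sub>M \<mu>) (fdim \<rho>) \<tau> (wick_B M \<rho> a g)))"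
  have "P (wick_conv f)" using wick_conv_L2[OF f] inner by (simp add: P_def)
  then have "P (SOME h. P h)" by (rule someI[of P])
  moreover have "Op_Wick M \<mu> \<rho> a \<sigma> f = (SOME h. P h)"
    using Linf f \<tau>L2 by (simp add: Op_Wick_def wick_B_adj_def P_def \<tau>_def)
  ultimately have "P (Op_Wick M \<mu> \<rho> a \<sigma> f)" by simp
  then show "AE x in M. Op_Wick M \<mu> \<rho> a \<sigma> f x = wick_conv f x"
    using wick_conv_L2[OF f] inner by (intro L2_inner_determines) (auto simp: P_def)
qed

end

theorem lemma2p7:
  fixes M :: "'g::{topological_group_add, t2_space, second_countable_topology} measure"
    and \<rho> :: "'g rep set \<Rightarrow> 'g rep"
    and \<mu> :: "'g rep set measure"
    and a :: "'g \<Rightarrow> complex"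
    and \<sigma> :: "'g \<times> 'g rep set \<Rightarrow> cop"
    and \<kappa> :: "'g \<Rightarrow> 'g \<Rightarrow> complex"
  assumes "locally_compact_space (euclidean :: 'g topology)"
    and "unimodular TYPE('g)"
    and "type_I TYPE('g)"
    and "haar_measure M"
    and "measurable_choice \<rho>"
    and "plancherel_measure M \<rho> \<mu>"
    and "continuous_on UNIV a" and "bounded (range a)" and "a \<in> L2 M" and "L2_norm M a = 1"
    and "\<sigma> \<in> Cb_FL1 M \<rho>" and "\<kappa> \<in> Cb_L1 M" and "conv_kernel M \<rho> \<sigma> \<kappa>"
  shows "(\<exists>k. measurable_version M \<kappa> k) \<and>
         (\<forall>k. measurable_version M \<kappa> k \<longrightarrow>
           (\<forall>x. AE w in M. integrable M (\<lambda>z. a (- z + x - w) * cnj (a (- z + x)) * k z w)) \<and>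
           (\<forall>x w. wick_kernel M a k x w = (\<integral>z. a (z - w) * cnj (a z) * k (x - z) w \<partial>M)) \<and>
           wick_kernel M a k \<in> Cb_L1 M \<and>
           (\<forall>f\<in>Cc.
              continuous_on UNIV (\<lambda>x. group_conv M f (wick_kernel M a k x) x) \<and>
              (AE x in M. Op_Wick M \<mu> \<rho> a \<sigma> f x = group_conv M f (wick_kernel M a k x) x)))"
proof (intro conjI allI impI)
  interpret unimodular_haar M by (rule unimodular_haarI) fact+
  show "\<exists>k. measurable_version M \<kappa> k"
    by (rule ex_measurable_version) (use assms in simp_all)
  fix k assume k: "measurable_version M \<kappa> k"
  obtain A where A: "\<And>x. cmod (a x) \<le> A"
    using assms(8) by (auto simp: bounded_iff)
  obtain s where s: "integrable M s" "\<And>w. 0 \<le> s w" "\<And>x. AE w in M. cmod (\<kappa> x w) \<le> s w"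
    by (rule Cb_L1_dominated[OF assms(12)]) blast
  have ae: "AE w in M. k x w = \<kappa> x w" for x using k by (simp add: measurable_version_def)
  interpret wick_setting M a k s A \<rho> \<mu>
  proof
    show "k \<in> Cb_L1 M" by (rule measurable_version_Cb_L1[OF k assms(12)]) simp
    show "AE w in M. cmod (k z w) \<le> s w" for z
      using ae[of z] s(3)[of z] by eventually_elim simp
  qed (use assms A s k in \<open>auto simp: measurable_version_def\<close>)
  show "AE w in M. integrable M (\<lambda>z. a (- z + x - w) * cnj (a (- z + x)) * k z w)" for x
    using integrable_integrand by eventually_elim blast
  show "wick_kernel M a k x w = (\<integral>z. a (z - w) * cnj (a z) * k (x - z) w \<partial>M)" for x w
    by (rule K_substituted)
  show "wick_kernel M a k \<in> Cb_L1 M" by (rule K_Cb_L1)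
  show "\<forall>f\<in>Cc. continuous_on UNIV (\<lambda>x. group_conv M f (wick_kernel M a k x) x) \<and>
      (AE x in M. Op_Wick M \<mu> \<rho> a \<sigma> f x = group_conv M f (wick_kernel M a k x) x)"
  proof (intro ballI conjI)
    fix f :: "'g \<Rightarrow> complex" assume f: "f \<in> Cc"
    then obtain B where "\<And>x. cmod (f x) \<le> B" by (rule Cc_bounded) blast
    with f show "continuous_on UNIV (\<lambda>x. group_conv M f (wick_kernel M a k x) x)"
      by (intro conv_K_continuous) (auto simp: Cc_def)
    have "integrable M (\<kappa> x)" for x using assms(12) by (simp add: Cb_L1_def)
    with assms(13) have "AE x in M. Op_Wick M \<mu> \<rho> a \<sigma> f x = wick_conv f x"
      using ae Cc_L2[OF f] by (rule Op_Wick_eq_wick_conv)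
    then show "AE x in M. Op_Wick M \<mu> \<rho> a \<sigma> f x = group_conv M f (wick_kernel M a k x) x"
      by (simp only: wick_conv_def)
  qed
qed

end
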